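(* Let $G$ be a connected graph with maximum degree $\Delta$. Then the distinguishing chromatic index of type I of the symmetric digraph $\overleftrightarrow{G}$ satisfies $$\chi'_{D_{1,2}}(\overleftrightarrow{G}) \leq \left\lceil 2\sqrt{\Delta}\right\rceil.$$
   Context: For a simple graph $G$, the symmetric digraph $\overleftrightarrow{G}$ is obtained by replacing each edge $uv$ of $G$ by the pair of opposite arcs $\overrightarrow{uv}$ and $\overrightarrow{vu}$. An arc-colouring of $\overleftrightarrow{G}$ is proper of type I if there is no monochromatic 2-cycle (arcs $\overrightarrow{uv},\overrightarrow{vu}$ of the same colour) and no monochromatic 2-path (arcs $\overrightarrow{uv},\overrightarrow{vw}$ with $w\neq u$ of the same colour); equivalently, any two consecutive arcs $\overrightarrow{uv},\overrightarrow{vw}$ receive distinct colours. An arc-colouring is distinguishing if the only automorphism of $\overleftrightarrow{G}$ (equivalently, of $G$) preserving the colour of every arc is the identity. $\chi'_{D_{1,2}}(\overleftrightarrow{G})$ denotes the least number of colours in a distinguishing proper arc-colouring of type I of $\overleftrightarrow{G}$. *)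

theory Defs
  imports Complex_Main
begin

definition simple_graph :: "'a set \<Rightarrow> ('a \<Rightarrow> 'a \<Rightarrow> bool) \<Rightarrow> bool" where
  "simple_graph V E \<longleftrightarrow> finite V \<and> V \<noteq> {} \<and>
     (\<forall>u v. E u v \<longrightarrow> u \<in> V \<and> v \<in> V) \<and>
     (\<forall>u v. E u v \<longrightarrow> E v u) \<and> (\<forall>u. \<not> E u u)"

definition connected_graph :: "'a set \<Rightarrow> ('a \<Rightarrow> 'a \<Rightarrow> bool) \<Rightarrow> bool" where
  "connected_graph V E \<longleftrightarrow> (\<forall>u\<in>V. \<forall>v\<in>V. E\<^sup>*\<^sup>* u v)"

definition degree :: "'a set \<Rightarrow> ('a \<Rightarrow> 'a \<Rightarrow> bool) \<Rightarrow> 'a \<Rightarrow> nat" where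
  "degree V E v = card {u \<in> V. E v u}"

definition max_degree :: "'a set \<Rightarrow> ('a \<Rightarrow> 'a \<Rightarrow> bool) \<Rightarrow> nat" where
  "max_degree V E = Max (degree V E ` V)"

definition arcs :: "('a \<Rightarrow> 'a \<Rightarrow> bool) \<Rightarrow> ('a \<times> 'a) set" where
  "arcs E = {(u, v). E u v}"

definition graph_automorphism :: "'a set \<Rightarrow> ('a \<Rightarrow> 'a \<Rightarrow> bool) \<Rightarrow> ('a \<Rightarrow> 'a) \<Rightarrow> bool" where
  "graph_automorphism V E f \<longleftrightarrow> bij_betw f V V \<and>
     (\<forall>u\<in>V. \<forall>v\<in>V. E (f u) (f v) \<longleftrightarrow> E u v)"

definition proper_type1_arc_colouring ::
  "('a \<Rightarrow> 'a \<Rightarrow> bool) \<Rightarrow> nat \<Rightarrow> ('a \<times> 'a \<Rightarrow> nat) \<Rightarrow> bool" where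
  "proper_type1_arc_colouring E k c \<longleftrightarrow>
     (\<forall>a\<in>arcs E. c a < k) \<and>
     (\<forall>u v w. E u v \<and> E v w \<longrightarrow> c (u, v) \<noteq> c (v, w))"

definition distinguishing_arc_colouring ::
  "'a set \<Rightarrow> ('a \<Rightarrow> 'a \<Rightarrow> bool) \<Rightarrow> ('a \<times> 'a \<Rightarrow> nat) \<Rightarrow> bool" where
  "distinguishing_arc_colouring V E c \<longleftrightarrow>
     (\<forall>f. graph_automorphism V E f \<and> (\<forall>(u, v)\<in>arcs E. c (f u, f v) = c (u, v))
          \<longrightarrow> (\<forall>x\<in>V. f x = x))"

definition chi_D12 :: "'a set \<Rightarrow> ('a \<Rightarrow> 'a \<Rightarrow> bool) \<Rightarrow> nat" where
  "chi_D12 V E = (LEAST k. \<exists>c. proper_type1_arc_colouring E k c \<and>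
                                distinguishing_arc_colouring V E c)"

end

theory Submission
  imports Defs
begin

text \<open>
  Write \<open>k = \<lceil>2 sqrt \<Delta>\<rceil>\<close>, \<open>a = \<lfloor>k/2\<rfloor>\<close> and \<open>b = k - a\<close>, so that \<open>a b \<ge> \<Delta>\<close>. Every vertex \<open>x\<close> gets a set
  \<open>T x\<close> of colours, normally of size \<open>a\<close>, and the arc from \<open>x\<close> to \<open>y\<close> gets a colour in \<open>T x - T y\<close>; such a
  colouring is automatically proper of type I, and it exists as soon as adjacent vertices have
  incomparable sets. The pair of colours on the two arcs of the edge \<open>vx\<close>, seen from \<open>v\<close>, can take
  all values in \<open>T v \<times> - T v\<close>, which has at least \<open>\<Delta>\<close> elements. Starting from a recognisable root, the set
  \<open>F\<close> of coloured vertices grows by all uncoloured neighbours (kids) of some \<open>v \<in> F\<close>, and the labels of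
  the kids at \<open>v\<close> are kept distinct; then an automorphism that preserves the colours and fixes
  the root fixes all of \<open>V\<close>.

  The root is a vertex of degree \<open>\<Delta>\<close> whose set \<open>R\<close> has size \<open>b\<close>, is used by no other vertex, and
  consists of colours that really occur on arcs leaving the root. Kids are coloured greedily, and
  counting the \<open>a\<close>-sets which offer an unused label at \<open>v\<close> shows that this succeeds unless
  \<open>\<Delta> \<in> {4, 6, 9}\<close>. For \<open>\<Delta> \<in> {6, 9}\<close> only the last kid \<open>u\<close> can fail. It may reuse a label at \<open>v\<close> if
  it is separated from its twins (the kids with the same neighbours in \<open>F\<close>) by a label at another
  neighbour, and a failure of this, too, is excluded by counting.

  For \<open>\<Delta> = 4\<close> excluding a set is too expensive. Instead two adjacent vertices \<open>r\<close> and \<open>s\<close> with sets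
  \<open>{0, 1}\<close> and \<open>{2, 3}\<close> are recognised by the label \<open>(0, 2)\<close>, which is forbidden on all other edges
  between vertices with these two sets. The greedy colouring then gets stuck only at three kids with
  the same four neighbours, all in \<open>F\<close>, whose sets form two complementary pairs. Such a neighbour has
  only one neighbour in \<open>F\<close>, so its set can be changed to make room for the kids.
\<close>

section \<open>Counting colour sets\<close>

text \<open>The label of an edge \<open>xy\<close>, seen from \<open>x\<close>, is the pair of the colours of \<open>(x, y)\<close> and \<open>(y, x)\<close>.\<close>

definition rect :: "nat set \<Rightarrow> nat set \<Rightarrow> (nat \<times> nat) set" where
  "rect S T = (S - T) \<times> (T - S)"

text \<open>Deleting \<open>B\<close> from such an \<open>X\<close> leaves an arbitrary subset of
  \<open>P - A - B\<close> of size \<open>a - card B\<close>. The counts in \<open>reach1\<close>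
  and \<open>reach2\<close> reduce to this.\<close>

lemma card_between:
  assumes P: "finite P" "A \<subseteq> P" "B \<subseteq> P" "A \<inter> B = {}" "card B \<le> a"
  shows "card {X. X \<subseteq> P \<and> card X = a \<and> A \<inter> X = {} \<and> B \<subseteq> X} = (card P - card A - card B) choose (a - card B)"
proof -
  have f: "finite A" "finite B" using P finite_subset by blast+
  let ?Y = "{Y. Y \<subseteq> P - A - B \<and> card Y = a - card B}"
  have "bij_betw (\<lambda>Y. Y \<union> B) ?Y {X. X \<subseteq> P \<and> card X = a \<and> A \<inter> X = {} \<and> B \<subseteq> X}"
  proof (rule bij_betw_byWitness[where f' = "\<lambda>X. X - B"])
    show "(\<lambda>Y. Y \<union> B) ` ?Y \<subseteq> {X. X \<subseteq> P \<and> card X = a \<and> A \<inter> X = {} \<and> B \<subseteq> X}"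
    proof
      fix X assume "X \<in> (\<lambda>Y. Y \<union> B) ` ?Y"
      then obtain Y where Y: "X = Y \<union> B" "Y \<subseteq> P - A - B" "card Y = a - card B" by auto
      have "finite Y" using Y(2) P(1) finite_subset[of Y P] by blast
      then have "card X = a" unfolding Y(1) using Y f P(5) by (subst card_Un_disjoint) auto
      then show "X \<in> {X. X \<subseteq> P \<and> card X = a \<and> A \<inter> X = {} \<and> B \<subseteq> X}" using Y P by auto
    qed
    show "(\<lambda>X. X - B) ` {X. X \<subseteq> P \<and> card X = a \<and> A \<inter> X = {} \<and> B \<subseteq> X} \<subseteq> ?Y"
      using f P by (auto simp: card_Diff_subset)
  qed auto
  then have "card {X. X \<subseteq> P \<and> card X = a \<and> A \<inter> X = {} \<and> B \<subseteq> X} = card ?Y"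
    by (simp add: bij_betw_same_card)
  also have "\<dots> = card (P - A - B) choose (a - card B)" using P by (intro n_subsets) auto
  also have "card (P - A - B) = card P - card A - card B"
    using P f by (subst card_Diff_subset; (auto)?) (subst card_Diff_subset; auto)
  finally show ?thesis .
qed

text \<open>The neighbour of \<open>S\<close> in the Johnson graph that trades \<open>fst p\<close>
  for \<open>snd p\<close>. For \<open>fst p\<close> in \<open>S\<close> and \<open>snd p\<close>
  outside, it offers \<open>p\<close> and no other label to a vertex with set \<open>S\<close>, so
  different labels lead to different sets.\<close>

definition exchange :: "nat set \<Rightarrow> nat \<times> nat \<Rightarrow> nat set" where
  "exchange S p = insert (snd p) (S - {fst p})"

lemma rect_exchange: "fst p \<in> S \<Longrightarrow> snd p \<notin> S \<Longrightarrow> rect S (exchange S p) = {p}"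
  by (cases p) (auto simp: rect_def exchange_def)

lemma card_exchange: "finite S \<Longrightarrow> fst p \<in> S \<Longrightarrow> snd p \<notin> S \<Longrightarrow> card (exchange S p) = card S"
  by (simp add: exchange_def card.insert_remove) (metis card_gt_0_iff empty_iff Suc_pred)

lemma rect_singleton:
  assumes "finite S" "finite X" "card X = card S" "rect S X = {p}"
  shows "X = exchange S p \<and> fst p \<in> S \<and> snd p \<notin> S"
proof -
  have p: "p \<in> (S - X) \<times> (X - S)" using assms(4) unfolding rect_def by blast
  have "S - X = {fst p}" "X - S = {snd p}"
    using assms(4) p unfolding rect_def by (auto simp: set_eq_iff mem_Times_iff) (metis prod.collapse prod.inject)+
  then show ?thesis using p unfolding exchange_def by (auto simp: mem_Times_iff)
qed

lemma rect_nonempty: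
  assumes "finite S" "finite X" "card X = card S" "S \<noteq> X"
  shows "rect S X \<noteq> {}"
  unfolding rect_def using assms card_subset_eq[of X S] card_subset_eq[of S X] by auto

definition reach :: "nat \<Rightarrow> nat \<Rightarrow> nat set \<Rightarrow> (nat \<times> nat) set \<Rightarrow> nat set set" where
  "reach k a S M = {X. X \<subseteq> {..<k} \<and> card X = a \<and> rect S X \<inter> M \<noteq> {}}"

lemma finite_reach: "finite (reach k a S M)"
  by (rule finite_subset[of _ "Pow {..<k}"]) (auto simp: reach_def)

lemma exchange_reach:
  assumes "S \<subseteq> {..<k}" "card S = a" "p \<in> M" "M \<subseteq> S \<times> ({..<k} - S)"
  shows "exchange S p \<in> reach k a S M"
proof -
  have p: "fst p \<in> S" "snd p \<notin> S" "snd p < k" using assms by auto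
  then show ?thesis using assms rect_exchange[of p S] card_exchange[of S p] finite_subset[OF assms(1)]
    unfolding reach_def by (auto simp: exchange_def)
qed

lemma exchange_inj: "inj_on (exchange S) (S \<times> (- S))"
  by (rule inj_onI) (metis rect_exchange mem_Times_iff ComplD singleton_inject)

lemma label_bounds:
  assumes "S \<subseteq> {..<k}" "M \<subseteq> S \<times> ({..<k} - S)" "p \<in> M"
  shows "fst p \<in> S" "snd p \<notin> S" "snd p < k" "fst p < k" "fst p \<noteq> snd p"
  using assms by (cases p; auto)+

text \<open>A single free label \<open>p\<close> is offered by every \<open>a\<close>-set that
  contains \<open>snd p\<close> and avoids \<open>fst p\<close>.\<close>

lemma reach1:
  assumes S: "S \<subseteq> {..<k}" "card S = a" "1 \<le> a" and M: "M \<subseteq> S \<times> ({..<k} - S)" "p \<in> M"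
  shows "(k - 2) choose (a - 1) \<le> card (reach k a S M)"
proof -
  have p: "fst p \<in> S" "snd p \<notin> S" "snd p < k" "fst p < k" "fst p \<noteq> snd p"
    using label_bounds[OF S(1) M] by auto
  have "{X. X \<subseteq> {..<k} \<and> card X = a \<and> {fst p} \<inter> X = {} \<and> {snd p} \<subseteq> X} \<subseteq> reach k a S M"
    using p M(2) by (force simp: reach_def rect_def mem_Times_iff)
  from card_mono[OF finite_reach this] card_between[of "{..<k}" "{fst p}" "{snd p}" a] p S(3)
  show ?thesis by (simp add: numeral_2_eq_2)
qed

text \<open>Two labels \<open>p\<close> and \<open>q\<close> in \<open>M\<close> give two families
  as in \<open>reach1\<close>, whose overlap is bounded by \<open>m\<close>. Each further label of
  \<open>M\<close> contributes its exchange, which offers neither \<open>p\<close> nor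
  \<open>q\<close> and so lies outside both families.\<close>

lemma reach2:
  assumes S: "S \<subseteq> {..<k}" "card S = a" "2 \<le> a" and M: "M \<subseteq> S \<times> ({..<k} - S)" "2 \<le> card M"
    and m: "(k - 3) choose (a - 2) \<le> m" "(k - 3) choose (a - 1) \<le> m"
  shows "2 * ((k - 2) choose (a - 1)) + card M - 2 \<le> card (reach k a S M) + m"
proof -
  define C where "C A B = {X. X \<subseteq> {..<k} \<and> card X = a \<and> A \<inter> X = {} \<and> B \<subseteq> X}" for A B
  have fM: "finite M" using M(2) card.infinite by fastforce
  obtain p q where pq: "p \<in> M" "q \<in> M" "p \<noteq> q"
    by (metis M(2) card_le_Suc0_iff_eq fM not_less_eq_eq numeral_2_eq_2)
  note p = label_bounds[OF S(1) M(1) pq(1)] and q = label_bounds[OF S(1) M(1) pq(2)]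
  let ?P = "C {fst p} {snd p}" and ?Q = "C {fst q} {snd q}"
  let ?J = "exchange S ` (M - {p, q})"
  have fin: "finite (C A B)" for A B by (rule finite_subset[of _ "Pow {..<k}"]) (auto simp: C_def)
  have cP: "card ?P = (k - 2) choose (a - 1)"
    using card_between[of "{..<k}" "{fst p}" "{snd p}" a] p S(3) unfolding C_def by (simp add: numeral_2_eq_2)
  have cQ: "card ?Q = (k - 2) choose (a - 1)"
    using card_between[of "{..<k}" "{fst q}" "{snd q}" a] q S(3) unfolding C_def by (simp add: numeral_2_eq_2)
  \<comment> \<open>If the second coordinates agree, the first ones differ and two colours are
    avoided; otherwise two colours are required. This is where the two binomials bounded by
    \<open>m\<close> come from.\<close>
  have cPQ: "card (?P \<inter> ?Q) \<le> m"
  proof (cases "snd p = snd q")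
    case True
    then have ne: "fst p \<noteq> fst q" using pq(3) by (simp add: prod_eq_iff)
    have "?P \<inter> ?Q \<subseteq> C {fst p, fst q} {snd p}" unfolding C_def by auto
    then have "card (?P \<inter> ?Q) \<le> card (C {fst p, fst q} {snd p})" by (rule card_mono[OF fin])
    also have "\<dots> = (k - 3) choose (a - 1)"
      using card_between[of "{..<k}" "{fst p, fst q}" "{snd p}" a] p q ne S(3) True unfolding C_def by (auto simp: numeral_3_eq_3)
    finally show ?thesis using m by simp
  next
    case False
    have "snd q \<noteq> fst p" using p q by metis
    have "?P \<inter> ?Q \<subseteq> C {fst p} {snd p, snd q}" unfolding C_def by auto
    then have "card (?P \<inter> ?Q) \<le> card (C {fst p} {snd p, snd q})" by (rule card_mono[OF fin])
    also have "\<dots> = (k - 3) choose (a - 2)"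
      using card_between[of "{..<k}" "{fst p}" "{snd p, snd q}" a] p q False S(3) \<open>snd q \<noteq> fst p\<close> unfolding C_def by (auto simp: numeral_3_eq_3 numeral_2_eq_2)
    finally show ?thesis using m by simp
  qed
  have mem: "rect S (exchange S t) = {t}" if "t \<in> M" for t using that M by (intro rect_exchange) auto
  have PM: "X \<in> reach k a S M \<and> t \<in> rect S X" if "X \<in> C {fst t} {snd t}" "t \<in> M" for X t
    using that M(1) unfolding reach_def C_def rect_def by (cases t) auto
  have disj: "(?P \<union> ?Q) \<inter> ?J = {}"
  proof (rule ccontr)
    assume "\<not> ?thesis"
    then obtain t where t: "t \<in> M" "t \<noteq> p" "t \<noteq> q" "exchange S t \<in> ?P \<or> exchange S t \<in> ?Q" by blast
    then show False using PM[of "exchange S t" p] PM[of "exchange S t" q] pq mem[OF t(1)] by auto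
  qed
  have "?P \<union> ?Q \<union> ?J \<subseteq> reach k a S M"
    using PM pq exchange_reach[OF S(1,2) _ M(1)] by blast
  then have "card (?P \<union> ?Q \<union> ?J) \<le> card (reach k a S M)" by (rule card_mono[OF finite_reach])
  moreover have "card (?P \<union> ?Q \<union> ?J) = card (?P \<union> ?Q) + card ?J"
    using disj fin fM by (intro card_Un_disjoint) auto
  moreover have "card ?J = card M - 2"
  proof -
    have "inj_on (exchange S) (M - {p, q})" by (rule inj_on_subset[OF exchange_inj]) (use M in auto)
    then show ?thesis using pq fM by (simp add: card_image card_Diff_subset)
  qed
  moreover have "card ?P + card ?Q = card (?P \<union> ?Q) + card (?P \<inter> ?Q)" by (rule card_Un_Int[OF fin fin])
  ultimately show ?thesis using cP cQ cPQ M(2) by linarith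
qed

text \<open>A pair \<open>X\<close> disjoint from \<open>S\<close> offers all of
  \<open>S \<times> X\<close>. Fewer than \<open>card M\<close> labels at \<open>S\<close> lie
  outside this rectangle, so \<open>X\<close> reaches \<open>M\<close>. These sets come on top of
  the exchanges, which still meet \<open>S\<close>.\<close>

lemma reach_small:
  assumes S: "S \<subseteq> {..<k}" "card S = a" "2 \<le> a" and M: "M \<subseteq> S \<times> ({..<k} - S)"
    and k: "k = 4 \<and> a = 2 \<and> 1 \<le> card M \<or> k = 5 \<and> a = 2 \<and> 3 \<le> card M"
  shows "card M + ((k - 2) choose 2) \<le> card (reach k a S M)"
proof -
  let ?J = "exchange S ` M" and ?X = "{X. X \<subseteq> {..<k} - S \<and> card X = a}"
  have fM: "finite M" using M by (rule finite_subset) (use S finite_subset in auto)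
  have fS: "finite S" using S finite_subset by blast
  have cS: "card ({..<k} - S) = k - 2" using S k by (subst card_Diff_subset[OF fS]) auto
  have X: "X \<in> reach k a S M" if "X \<in> ?X" for X
  proof -
    have r: "rect S X = S \<times> X" using that unfolding rect_def by auto
    have "rect S X \<inter> M \<noteq> {}"
    proof
      assume e: "rect S X \<inter> M = {}"
      have fX: "finite X" using that finite_subset by blast
      have "M \<subseteq> S \<times> ({..<k} - S - X)" using e M unfolding r by auto
      then have "card M \<le> card (S \<times> ({..<k} - S - X))" by (rule card_mono[rotated]) (use fS in auto)
      also have "\<dots> = a * (k - 2 - a)" using that S(2) cS fX by (simp add: card_cartesian_product card_Diff_subset)
      finally show False using k by auto
    qed
    then show ?thesis using that unfolding reach_def by auto
  qed
  have "inj_on (exchange S) M" by (rule inj_on_subset[OF exchange_inj]) (use M in auto)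
  then have cJ: "card ?J = card M" by (rule card_image)
  have cX: "card ?X = (k - 2) choose a" using n_subsets[of "{..<k} - S" a] cS by simp
  have "?J \<inter> ?X = {}"
  proof (rule ccontr)
    assume "?J \<inter> ?X \<noteq> {}"
    then obtain p where p: "p \<in> M" "exchange S p \<subseteq> {..<k} - S" by blast
    then have "S \<subseteq> {fst p}" unfolding exchange_def by auto
    then have "card S \<le> 1" using card_mono[of "{fst p}" S] by simp
    then show False using S by simp
  qed
  then have "card (?J \<union> ?X) = card M + ((k - 2) choose a)"
    using cJ cX fM by (subst card_Un_disjoint) auto
  moreover have "?J \<union> ?X \<subseteq> reach k a S M" using X exchange_reach[OF S(1,2) _ M] by blast
  ultimately show ?thesis using card_mono[OF finite_reach, of "?J \<union> ?X"] k by (metis (no_types, lifting))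
qed

section \<open>Growth of central binomial coefficients\<close>

lemma central_even: "3 \<le> n \<Longrightarrow> (n + 1) * (n + 1) + 1 \<le> (2 * n) choose n"
proof (induction n rule: dec_induct)
  case base then show ?case by (simp add: eval_nat_numeral)
next
  case (step n)
  have "(2 * Suc n) choose (Suc n) = (2 * n choose n) + (2 * n choose Suc n) + ((Suc (2 * n)) choose n)"
    by simp
  moreover have "(2 * n choose n) \<le> (Suc (2 * n)) choose n" by (cases n) simp_all
  \<comment> \<open>The binomial coefficient at least doubles in each step, while the quadratic at
    most doubles.\<close>
  ultimately have "2 * (2 * n choose n) \<le> (2 * Suc n) choose (Suc n)" by linarith
  moreover have "(Suc n + 1) * (Suc n + 1) + 1 \<le> 2 * ((n + 1) * (n + 1) + 1)" using step(1) by (simp add: algebra_simps)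
  ultimately show ?case using mult_le_mono2[OF step.IH, of 2] by (meson le_trans)
qed

lemma central_odd: "3 \<le> n \<Longrightarrow> (n + 1) * (n + 2) + 1 \<le> (2 * n + 1) choose n"
proof (induction n rule: dec_induct)
  case base then show ?case by (simp add: eval_nat_numeral)
next
  case (step n)
  let ?c = "(2 * n + 1) choose n"
  have "(2 * Suc n + 1) choose (Suc n) = ((2 * n + 2) choose n) + ((2 * n + 2) choose (Suc n))" by simp
  moreover have "?c \<le> (2 * n + 2) choose n" by (cases n) simp_all
  moreover have "?c \<le> (2 * n + 2) choose (Suc n)" by simp
  ultimately have "2 * ?c \<le> (2 * Suc n + 1) choose (Suc n)" by linarith
  moreover have "(Suc n + 1) * (Suc n + 2) + 1 \<le> 2 * ((n + 1) * (n + 2) + 1)"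
    using step(1) by (simp add: algebra_simps)
  ultimately show ?case using mult_le_mono2[OF step.IH, of 2] by (meson le_trans)
qed

text \<open>From \<open>k = 8\<close> on a single free label suffices: the sets counted in
  \<open>reach1\<close> outnumber all \<open>a * (k - a)\<close> labels at a vertex. Only smaller
  \<open>k\<close> call for a finer count.\<close>

lemma choose_large:
  assumes "8 \<le> k" "a = k div 2"
  shows "a * (k - a) + 1 \<le> (k - 2) choose (a - 1)"
proof -
  define n where "n = a - 1"
  have n: "3 \<le> n" "a = n + 1" using assms unfolding n_def by auto
  consider "k = 2 * n + 2" | "k = 2 * n + 3" using assms n by linarith
  then show ?thesis
  proof cases
    case 1 then show ?thesis using central_even[OF n(1)] n by simp
  next
    case 2 then show ?thesis using central_odd[OF n(1)] n by (simp add: numeral_3_eq_3)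
  qed
qed

text \<open>A kid has at most \<open>\<Delta> - 1\<close> neighbours besides its parent that can
  forbid a set, so \<open>\<Delta>\<close> reachable sets are enough; the extra 1 for
  \<open>a = b\<close> pays for the exclusion of the root's set. A parent with
  \<open>\<Delta> - 1\<close> kids has used \<open>\<Delta> - 2\<close> labels before the last one.
  For \<open>\<Delta> = 6\<close> and \<open>\<Delta> = 9\<close> the bound stops one label
  earlier.\<close>

lemma reach_bound:
  assumes \<Delta>: "4 * \<Delta> \<le> k\<^sup>2" "(k - 1)\<^sup>2 < 4 * \<Delta>" "\<Delta> \<noteq> 4" "2 \<le> \<Delta>"
    and a: "a = k div 2" "b = k - a" and S: "S \<subseteq> {..<k}" "card S = a"
    and U: "finite U" "card U + (if \<Delta> = 6 \<or> \<Delta> = 9 then 3 else 2) \<le> \<Delta>"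
  shows "\<Delta> + (if a = b then 1 else 0) \<le> card (reach k a S (S \<times> ({..<k} - S) - U))"
proof -
  let ?M = "S \<times> ({..<k} - S) - U"
  have k3: "3 \<le> k"
  proof (rule ccontr)
    assume "\<not> 3 \<le> k"
    then have "k\<^sup>2 \<le> 2\<^sup>2" by (intro power_mono) auto
    then show False using \<Delta> by simp
  qed
  have fS: "finite S" using S finite_subset by blast
  have cSS: "card (S \<times> ({..<k} - S)) = a * b"
    using S a fS by (simp add: card_cartesian_product card_Diff_subset)
  have ab: "\<Delta> \<le> a * b"
  proof (cases "even k")
    case True
    then show ?thesis using \<Delta>(1) a by (auto simp: power2_eq_square elim!: evenE)
  next
    case False
    then obtain j where "k = 2 * j + 1" by (rule oddE)
    then show ?thesis using \<Delta>(1) a by (auto simp: power2_eq_square algebra_simps)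
  qed
  have M: "?M \<subseteq> S \<times> ({..<k} - S)" by auto
  have cM: "a * b \<le> card ?M + card U"
    using diff_card_le_card_Diff[OF U(1), of "S \<times> ({..<k} - S)"] cSS by linarith
  show ?thesis
  proof (cases "8 \<le> k")
    case True
    have "card ?M \<noteq> 0" using cM U(2) ab \<Delta>(4) by (auto split: if_splits)
    then obtain p where "p \<in> ?M" by (metis card.empty equals0I)
    from reach1[OF S _ M this] have "(k - 2) choose (a - 1) \<le> card (reach k a S ?M)" using k3 a by auto
    then show ?thesis using choose_large[OF True a(1)] ab a(2) by auto
  next
    case False
    then consider "k = 3" | "k = 4" | "k = 5" | "k = 6" | "k = 7" using k3 by linarith
    then show ?thesis
    proof cases
      case 1
      then have "\<Delta> = 2" using \<Delta> by simp
      then have U0: "U = {}" using U by auto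
      have "inj_on (exchange S) ?M" by (rule inj_on_subset[OF exchange_inj]) auto
      then have "card (exchange S ` ?M) = 2" using cSS U0 1 a by (simp add: card_image)
      moreover have "exchange S ` ?M \<subseteq> reach k a S ?M" using exchange_reach[OF S _ M] by blast
      ultimately have "2 \<le> card (reach k a S ?M)" using card_mono[OF finite_reach] by metis
      then show ?thesis using 1 a \<open>\<Delta> = 2\<close> by simp
    next
      case 2
      then have D: "\<Delta> = 3" using \<Delta> by simp
      then have "card U \<le> 1" using U by simp
      then have "3 \<le> card ?M" using cM 2 a by simp
      then have "card ?M + ((k - 2) choose 2) \<le> card (reach k a S ?M)"
        using reach_small[OF S _ M] 2 a \<open>3 \<le> card ?M\<close> by simp
      then show ?thesis using 2 a D \<open>3 \<le> card ?M\<close> by simp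
    next
      case 3
      then have D: "\<Delta> = 5 \<or> \<Delta> = 6" using \<Delta> by simp linarith
      then have "card U \<le> 3" using U by auto
      then have c: "3 \<le> card ?M" using cM 3 a by simp
      then have "card ?M + ((k - 2) choose 2) \<le> card (reach k a S ?M)"
        using reach_small[OF S _ M] 3 a c by simp
      moreover have "(k - 2) choose 2 = 3" using 3 by (simp add: eval_nat_numeral)
      moreover have "a \<noteq> b" using 3 a by simp
      ultimately show ?thesis using D c by auto
    next
      \<comment> \<open>The estimate is tight for \<open>\<Delta> = 9\<close>: with 3 free labels it
        yields \<open>2 * 6 + 3 - 2 - 3 = 10\<close> sets, and \<open>\<Delta> + 1\<close> are
        wanted.\<close>
      case 4
      then have D: "\<Delta> = 7 \<or> \<Delta> = 8 \<or> \<Delta> = 9" using \<Delta> by simp linarith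
      then have c: "3 \<le> card ?M" using cM U 4 a by auto
      have a3: "a = 3" using 4 a by simp
      have "2 * ((k - 2) choose (a - 1)) + card ?M - 2 \<le> card (reach k a S ?M) + 3"
        by (rule reach2[OF S _ M]) (use c in \<open>simp_all add: 4 a3\<close>, simp_all add: eval_nat_numeral)
      moreover have "(k - 2) choose (a - 1) = 6" by (simp add: 4 a3) (simp add: eval_nat_numeral)
      ultimately have "\<Delta> + 1 \<le> card (reach k a S ?M)" using D c by linarith
      then show ?thesis by auto
    next
      case 5
      then have D: "\<Delta> \<le> 12" "10 \<le> \<Delta>" using \<Delta> by simp_all
      then have c: "2 \<le> card ?M" using cM U 5 a by auto
      have a3: "a = 3" using 5 a by simp
      have "2 * ((k - 2) choose (a - 1)) + card ?M - 2 \<le> card (reach k a S ?M) + 6"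
        by (rule reach2[OF S _ M]) (use c in \<open>simp_all add: 5 a3\<close>, simp_all add: eval_nat_numeral)
      moreover have "(k - 2) choose (a - 1) = 10" by (simp add: 5 a3) (simp add: eval_nat_numeral)
      moreover have "a \<noteq> b" using 5 a by simp
      ultimately show ?thesis using D c by auto
    qed
  qed
qed

section \<open>Extending partial colourings\<close>

text \<open>\<open>Fam\<close> contains the sets allowed at the vertices, and \<open>Lb S T\<close> the labels allowed on an edge
  between vertices with sets \<open>S\<close> and \<open>T\<close>. The root is the pair \<open>r\<close>, \<open>s\<close>, where \<open>r = s\<close> unless \<open>\<Delta> = 4\<close>.\<close>

locale arc_ext =
  fixes V :: "'a set" and E :: "'a \<Rightarrow> 'a \<Rightarrow> bool" and \<Delta> k :: nat
    and Fam :: "nat set set" and Lb :: "nat set \<Rightarrow> nat set \<Rightarrow> (nat \<times> nat) set"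
    and r s :: 'a
  assumes simple: "simple_graph V E" and conn: "connected_graph V E"
    and deg: "\<And>v. card {u. E v u} \<le> \<Delta>"
    and Fam_sub: "Fam \<subseteq> Pow {..<k}"
    and Lb_sub: "\<And>S T. Lb S T \<subseteq> rect S T"
    and Lb_ne: "\<And>S T. S \<in> Fam \<Longrightarrow> T \<in> Fam \<Longrightarrow> S \<noteq> T \<Longrightarrow> Lb S T \<noteq> {}"
    and Lb_sym: "\<And>S T p q. (p, q) \<in> Lb S T \<Longrightarrow> (q, p) \<in> Lb T S"
begin

abbreviation N :: "'a \<Rightarrow> 'a set" where "N v \<equiv> {u. E v u}"

lemma E_V: "E u v \<Longrightarrow> u \<in> V \<and> v \<in> V" and E_sym: "E u v \<Longrightarrow> E v u" and E_irrefl: "\<not> E u u"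
  and fin_V: "finite V"
  using simple unfolding simple_graph_def by blast+

lemma fin_N: "finite (N v)"
  by (rule finite_subset[OF _ fin_V]) (use E_V in blast)

lemma fin_Fam: "finite Fam"
  using Fam_sub finite_subset by blast

lemma Lb_D: "p \<in> Lb S T \<Longrightarrow> fst p \<in> S \<and> fst p \<notin> T \<and> snd p \<in> T \<and> snd p \<notin> S"
  using Lb_sub[of S T] by (auto simp: rect_def)

lemma fin_Lb: "S \<in> Fam \<Longrightarrow> X \<in> Fam \<Longrightarrow> finite (Lb S X)"
  using Fam_sub Lb_sub[of S X] unfolding rect_def
  by (meson PowD finite_Diff finite_SigmaI finite_lessThan finite_subset subset_iff)

text \<open>No assumption is made on arcs that \<open>f\<close> moves out of \<open>F\<close>, so rigidity is inherited by every
  colouring of the whole graph that extends \<open>c\<close>.\<close>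

definition rigid :: "'a set \<Rightarrow> ('a \<times> 'a \<Rightarrow> nat) \<Rightarrow> bool" where
  "rigid F c \<longleftrightarrow> (\<forall>f. graph_automorphism V E f \<and> f r = r \<and> f s = s \<and>
      (\<forall>x\<in>F. \<forall>y\<in>F. E x y \<and> f x \<in> F \<and> f y \<in> F \<longrightarrow> c (f x, f y) = c (x, y))
      \<longrightarrow> (\<forall>x\<in>F. f x = x))"

text \<open>The root \<open>r\<close> may carry a set outside \<open>Fam\<close>, and the edge
  between \<open>r\<close> and \<open>s\<close> may carry a label outside \<open>Lb\<close>. For
  \<open>\<Delta> = 4\<close> the latter is the label by which the root edge is recognised.\<close>

definition state :: "'a set \<Rightarrow> ('a \<Rightarrow> nat set) \<Rightarrow> ('a \<times> 'a \<Rightarrow> nat) \<Rightarrow> bool" where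
  "state F T c \<longleftrightarrow> r \<in> F \<and> s \<in> F \<and> F \<subseteq> V \<and>
     (\<forall>x\<in>F. T x \<subseteq> {..<k}) \<and> (\<forall>x\<in>F. x \<noteq> r \<longrightarrow> T x \<in> Fam) \<and>
     (\<forall>x\<in>F. \<forall>y\<in>F. E x y \<longrightarrow> c (x, y) \<in> T x \<and> c (x, y) \<notin> T y) \<and>
     (\<forall>x\<in>F. \<forall>y\<in>F. E x y \<longrightarrow> (x, y) \<noteq> (r, s) \<longrightarrow> (x, y) \<noteq> (s, r) \<longrightarrow>
        (c (x, y), c (y, x)) \<in> Lb (T x) (T y)) \<and>
     rigid F c"

text \<open>By the second condition, uncoloured vertices are adjacent only to coloured vertices with
  sets in \<open>Fam\<close>, so that \<open>Lb_ne\<close> applies. By the third, every coloured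
  vertex has at most \<open>\<Delta> - 1\<close> kids.\<close>

definition rooted_state :: "'a set \<Rightarrow> ('a \<Rightarrow> nat set) \<Rightarrow> ('a \<times> 'a \<Rightarrow> nat) \<Rightarrow> bool" where
  "rooted_state F T c \<longleftrightarrow> state F T c \<and> (T r \<in> Fam \<or> N r \<subseteq> F) \<and> (\<forall>x\<in>F. \<exists>y\<in>F. E x y)"

lemma rooted_state_sub: "rooted_state F T c \<Longrightarrow> F \<subseteq> V \<and> r \<in> F \<and> s \<in> F"
  unfolding rooted_state_def state_def by simp

lemma rooted_state_col: "rooted_state F T c \<Longrightarrow> x \<in> F \<Longrightarrow> y \<in> F \<Longrightarrow> E x y \<Longrightarrow> c (x, y) \<in> T x \<and> c (x, y) \<notin> T y"
  and rooted_state_bounded: "rooted_state F T c \<Longrightarrow> x \<in> F \<Longrightarrow> T x \<subseteq> {..<k}"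
  and rooted_state_T: "rooted_state F T c \<Longrightarrow> x \<in> F \<Longrightarrow> x \<noteq> r \<Longrightarrow> T x \<in> Fam"
  and rooted_state_Lb: "rooted_state F T c \<Longrightarrow> x \<in> F \<Longrightarrow> y \<in> F \<Longrightarrow> E x y \<Longrightarrow> (x, y) \<noteq> (r, s) \<Longrightarrow> (x, y) \<noteq> (s, r) \<Longrightarrow>
    (c (x, y), c (y, x)) \<in> Lb (T x) (T y)"
  and rooted_state_rigid: "rooted_state F T c \<Longrightarrow> rigid F c"
  unfolding rooted_state_def state_def by simp_all

section \<open>Colouring the kids of one vertex\<close>

definition proper_sets :: "'a set \<Rightarrow> ('a \<Rightarrow> nat set) \<Rightarrow> 'a set \<Rightarrow> ('a \<Rightarrow> nat set) \<Rightarrow> bool" where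
  "proper_sets F T K T' \<longleftrightarrow> (\<forall>x\<in>K. T' x \<in> Fam \<and> (\<forall>w\<in>F. E x w \<longrightarrow> T' x \<noteq> T w) \<and>
     (\<forall>y\<in>K. E x y \<longrightarrow> T' x \<noteq> T' y))"

lemma rooted_state_Fam: "rooted_state F T c \<Longrightarrow> w \<in> F \<Longrightarrow> E x w \<Longrightarrow> x \<notin> F \<Longrightarrow> T w \<in> Fam"
  unfolding rooted_state_def state_def using E_sym by (cases "w = r") (simp_all add: subset_iff, blast)

lemma card_kids:
  assumes "rooted_state F T c" "v \<in> F"
  shows "card (N v - F) < \<Delta>"
proof -
  obtain y where y: "y \<in> F" "E v y" using assms unfolding rooted_state_def by blast
  have "N v - F \<subset> N v" using y by auto
  then show ?thesis using psubset_card_mono[OF fin_N] deg[of v] by (meson le_trans not_le)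
qed

text \<open>An automorphism that fixes \<open>F\<close> pointwise permutes the kids of
  \<open>v\<close> and preserves their neighbours in \<open>F\<close>, so it can only move a kid to
  a twin; by \<open>dist\<close>, twins differ in some label. The lemma concerns
  \<open>state\<close> because it is also applied to a root on its own, which has no coloured
  neighbour yet.\<close>

lemma extend_state:
  assumes g: "state F T c" and v: "v \<in> F" and K: "K = N v - F" and t: "proper_sets F T K T'"
    and L: "\<And>x w. x \<in> K \<Longrightarrow> w \<in> F \<Longrightarrow> E x w \<Longrightarrow> L x w \<in> Lb (T w) (T' x)"
    and dist: "\<And>x y. x \<in> K \<Longrightarrow> y \<in> K \<Longrightarrow> x \<noteq> y \<Longrightarrow> (\<And>w. w \<in> F \<Longrightarrow> E x w \<longleftrightarrow> E y w) \<Longrightarrow>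
        \<exists>w\<in>F. E x w \<and> L x w \<noteq> L y w"
  shows "\<exists>T2 c2. state (F \<union> K) T2 c2 \<and> (\<forall>x\<in>F. T2 x = T x) \<and> (\<forall>x\<in>F. \<forall>y\<in>F. c2 (x, y) = c (x, y)) \<and>
      (\<forall>x\<in>K. \<forall>w\<in>F. E x w \<longrightarrow> (c2 (w, x), c2 (x, w)) = L x w)"
proof -
  \<comment> \<open>Labels between two kids are arbitrary. The numbering decides from which end of
    the edge the chosen label is read, so that its two arcs fit together.\<close>
  obtain idx :: "'a \<Rightarrow> nat" where idx: "inj_on idx V"
    using finite_imp_inj_to_nat_seg[OF fin_V] by blast
  define M where "M x y = (SOME p. p \<in> Lb (T' x) (T' y))" for x y
  have M: "M x y \<in> Lb (T' x) (T' y)" if "x \<in> K" "y \<in> K" "E x y" for x y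
    unfolding M_def by (rule someI_ex) (use that t Lb_ne in \<open>unfold proper_sets_def, blast\<close>)
  define T2 where "T2 x = (if x \<in> F then T x else T' x)" for x
  define c2 where "c2 = (\<lambda>(x, y). if x \<in> F then (if y \<in> F then c (x, y) else fst (L y x))
      else if y \<in> F then snd (L x y) else if idx x < idx y then fst (M x y) else snd (M y x))"
  have KF: "x \<notin> F" "x \<in> V" "E v x" "E x v" if "x \<in> K" for x using that K E_V E_sym by auto
  have gF: "r \<in> F" "s \<in> F" "F \<subseteq> V" "\<And>x. x \<in> F \<Longrightarrow> T x \<subseteq> {..<k}" "\<And>x. x \<in> F \<Longrightarrow> x \<noteq> r \<Longrightarrow> T x \<in> Fam"
     "\<And>x y. x \<in> F \<Longrightarrow> y \<in> F \<Longrightarrow> E x y \<Longrightarrow> c (x, y) \<in> T x \<and> c (x, y) \<notin> T y"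
     "\<And>x y. x \<in> F \<Longrightarrow> y \<in> F \<Longrightarrow> E x y \<Longrightarrow> (x, y) \<noteq> (r, s) \<Longrightarrow> (x, y) \<noteq> (s, r) \<Longrightarrow> (c (x, y), c (y, x)) \<in> Lb (T x) (T y)"
     and rig: "rigid F c"
    using g unfolding state_def by blast+
  have tF: "T' x \<in> Fam" if "x \<in> K" for x using t that unfolding proper_sets_def by blast
  have new: "(c2 (x, y), c2 (y, x)) \<in> Lb (T2 x) (T2 y)" if xy: "E x y" "x \<in> F \<union> K" "y \<in> F \<union> K" "\<not> (x \<in> F \<and> y \<in> F)" for x y
  proof -
    consider "x \<in> F" "y \<in> K" | "x \<in> K" "y \<in> F" | "x \<in> K" "y \<in> K" using xy by blast
    then show ?thesis
    proof cases
      case 1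
      then show ?thesis using L[of y x] xy KF E_sym by (auto simp: c2_def T2_def)
    next
      case 2
      have "(snd (L x y), fst (L x y)) \<in> Lb (T' x) (T y)"
        using L[of x y] 2 xy Lb_sym by (metis prod.collapse)
      then show ?thesis using 2 KF by (auto simp: c2_def T2_def)
    next
      case 3
      have "x \<noteq> y" using xy E_irrefl by auto
      then have "idx x \<noteq> idx y" using idx 3 KF(2) unfolding inj_on_def by blast
      moreover have "(snd (M y x), fst (M y x)) \<in> Lb (T' x) (T' y)"
        using M[of y x] 3 xy E_sym Lb_sym by (metis prod.collapse)
      ultimately show ?thesis using 3 KF(1) M[of x y] xy
        by (auto simp: c2_def T2_def split: if_splits)
    qed
  qed
  have old: "c2 (x, y) = c (x, y)" if "x \<in> F" "y \<in> F" for x y using that by (simp add: c2_def)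
  have rigid2: "rigid (F \<union> K) c2"
    unfolding rigid_def
  proof (intro allI impI, elim conjE)
    fix f assume f: "graph_automorphism V E f" "f r = r" "f s = s"
      and pres: "\<forall>x\<in>F \<union> K. \<forall>y\<in>F \<union> K. E x y \<and> f x \<in> F \<union> K \<and> f y \<in> F \<union> K \<longrightarrow> c2 (f x, f y) = c2 (x, y)"
    have "\<forall>x\<in>F. \<forall>y\<in>F. E x y \<and> f x \<in> F \<and> f y \<in> F \<longrightarrow> c (f x, f y) = c (x, y)"
      using pres old by (metis UnI1)
    then have fixF: "f x = x" if "x \<in> F" for x using rig f that unfolding rigid_def by blast
    have inj: "inj_on f V" and fV: "\<And>x. x \<in> V \<Longrightarrow> f x \<in> V" using f(1) unfolding graph_automorphism_def bij_betw_def by blast+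
    have auto: "E (f x) (f y) \<longleftrightarrow> E x y" if "x \<in> V" "y \<in> V" for x y
      using f(1) that unfolding graph_automorphism_def by blast
    have "f x = x" if x: "x \<in> K" for x
    proof (rule ccontr)
      assume ne: "f x \<noteq> x"
      have "f x \<notin> F"
      proof
        assume a: "f x \<in> F"
        then have "f (f x) = f x" by (rule fixF)
        then show False using inj ne KF(2)[OF x] fV unfolding inj_on_def by blast
      qed
      moreover have "E v (f x)" using auto[of v x] fixF[OF v] v gF(3) KF(2)[OF x] KF(3)[OF x] by auto
      ultimately have fx: "f x \<in> K" using K by auto
      have nb: "E x w \<longleftrightarrow> E (f x) w" if "w \<in> F" for w
        using auto[of x w] fixF[OF that] KF(2)[OF x] gF(3) that by auto
      obtain w where w: "w \<in> F" "E x w" "L x w \<noteq> L (f x) w"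
        using dist[OF x fx ne[symmetric]] nb by blast
      have "c2 (f x, f w) = c2 (x, w)" "c2 (f w, f x) = c2 (w, x)"
        using pres[rule_format, of x w] pres[rule_format, of w x] x w fx fixF[OF w(1)] E_sym[OF w(2)] by auto
      then have "snd (L x w) = snd (L (f x) w)" "fst (L x w) = fst (L (f x) w)"
        using fixF[OF w(1)] w KF(1)[OF x] KF(1)[OF fx] unfolding c2_def by auto
      then show False using w(3) by (simp add: prod_eq_iff)
    qed
    then show "\<forall>x\<in>F \<union> K. f x = x" using fixF by blast
  qed
  have "state (F \<union> K) T2 c2"
    unfolding state_def
  proof (intro conjI ballI impI)
    show "r \<in> F \<union> K" "s \<in> F \<union> K" "F \<union> K \<subseteq> V" using gF(1-3) KF(2) by auto
    show "T2 x \<subseteq> {..<k}" if "x \<in> F \<union> K" for x 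
    proof (cases "x \<in> F")
      case True then show ?thesis using gF(4) by (simp add: T2_def)
    next
      case False
      then have "T2 x \<in> Pow {..<k}" using tF[of x] that Fam_sub by (auto simp: T2_def)
      then show ?thesis by blast
    qed
    show "T2 x \<in> Fam" if "x \<in> F \<union> K" "x \<noteq> r" for x using that gF(5) tF by (auto simp: T2_def)
    show "(c2 (x, y), c2 (y, x)) \<in> Lb (T2 x) (T2 y)" if "x \<in> F \<union> K" "y \<in> F \<union> K" "E x y" "(x, y) \<noteq> (r, s)" "(x, y) \<noteq> (s, r)" for x y
      using that new[of x y] gF(7)[of x y] old by (cases "x \<in> F \<and> y \<in> F") (auto simp: T2_def)
    fix x y assume xy: "x \<in> F \<union> K" "y \<in> F \<union> K" "E x y"
    have "c2 (x, y) \<in> T2 x \<and> c2 (x, y) \<notin> T2 y"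
    proof (cases "x \<in> F \<and> y \<in> F")
      case True then show ?thesis using gF(6)[of x y] xy old by (auto simp: T2_def)
    next
      case False then show ?thesis using Lb_D[OF new[OF xy(3,1,2)]] by simp
    qed
    then show "c2 (x, y) \<in> T2 x" "c2 (x, y) \<notin> T2 y" by auto
  next
    show "rigid (F \<union> K) c2" by (rule rigid2)
  qed
  moreover have "(c2 (w, x), c2 (x, w)) = L x w" if "x \<in> K" "w \<in> F" for x w
    using that KF by (auto simp: c2_def)
  ultimately show ?thesis using old by (intro exI[of _ T2] exI[of _ c2]) (auto simp: T2_def)
qed

lemma extend:
  assumes g: "rooted_state F T c" and v: "v \<in> F" and K: "K = N v - F" and t: "proper_sets F T K T'"
    and L: "\<And>x w. x \<in> K \<Longrightarrow> w \<in> F \<Longrightarrow> E x w \<Longrightarrow> L x w \<in> Lb (T w) (T' x)"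
    and dist: "\<And>x y. x \<in> K \<Longrightarrow> y \<in> K \<Longrightarrow> x \<noteq> y \<Longrightarrow> (\<And>w. w \<in> F \<Longrightarrow> E x w \<longleftrightarrow> E y w) \<Longrightarrow>
        \<exists>w\<in>F. E x w \<and> L x w \<noteq> L y w"
  shows "\<exists>T2 c2. rooted_state (F \<union> K) T2 c2 \<and> (\<forall>x\<in>F. T2 x = T x) \<and> (\<forall>x\<in>F. \<forall>y\<in>F. c2 (x, y) = c (x, y)) \<and>
      (\<forall>x\<in>K. \<forall>w\<in>F. E x w \<longrightarrow> (c2 (w, x), c2 (x, w)) = L x w)"
proof -
  have p: "state F T c" and g2: "T r \<in> Fam \<or> N r \<subseteq> F" "\<forall>x\<in>F. \<exists>y\<in>F. E x y"
    using g unfolding rooted_state_def by auto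
  from extend_state[OF p v K t L dist] obtain T2 c2 where e: "state (F \<union> K) T2 c2" "\<forall>x\<in>F. T2 x = T x"
    "\<forall>x\<in>F. \<forall>y\<in>F. c2 (x, y) = c (x, y)" "\<forall>x\<in>K. \<forall>w\<in>F. E x w \<longrightarrow> (c2 (w, x), c2 (x, w)) = L x w" by blast
  have "r \<in> F" using p unfolding state_def by blast
  then have "T2 r \<in> Fam \<or> N r \<subseteq> F \<union> K" using g2(1) e(2) by auto
  moreover have "\<exists>y\<in>F \<union> K. E x y" if "x \<in> F \<union> K" for x
  proof (cases "x \<in> F")
    case True then show ?thesis using g2(2) by blast
  next
    case False
    then have "E x v" using that K E_sym by auto
    then show ?thesis using v by blast
  qed
  ultimately have "rooted_state (F \<union> K) T2 c2" using e(1) unfolding rooted_state_def by blast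
  then show ?thesis using e(2-4) by blast
qed

text \<open>Only the labels at \<open>v\<close> are recorded: their injectivity already separates
  all kids, so the labels at other coloured neighbours may be arbitrary.\<close>

definition assignment :: "'a set \<Rightarrow> ('a \<Rightarrow> nat set) \<Rightarrow> 'a \<Rightarrow> 'a set \<Rightarrow> ('a \<Rightarrow> nat set) \<Rightarrow> ('a \<Rightarrow> nat \<times> nat) \<Rightarrow> bool" where
  "assignment F T v K T' l \<longleftrightarrow> proper_sets F T K T' \<and> (\<forall>x\<in>K. l x \<in> Lb (T v) (T' x)) \<and> inj_on l K"

text \<open>The last conclusion keeps some control over labels at neighbours other than
  \<open>v\<close>; the construction of the root edge for \<open>\<Delta> = 4\<close> reads off such
  a label at \<open>s\<close>.\<close>

lemma assignment_extend:
  assumes g: "rooted_state F T c" and v: "v \<in> F" and K: "K = N v - F" and p: "assignment F T v K T' l"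
  shows "\<exists>T2 c2. rooted_state (F \<union> K) T2 c2 \<and> (\<forall>x\<in>F. T2 x = T x) \<and> (\<forall>x\<in>F. \<forall>y\<in>F. c2 (x, y) = c (x, y)) \<and>
      (\<forall>x\<in>K. (c2 (v, x), c2 (x, v)) = l x) \<and>
      (\<forall>x\<in>K. \<forall>w\<in>F. E x w \<longrightarrow> (c2 (w, x), c2 (x, w)) \<in> Lb (T w) (T' x))"
proof -
  define L where "L x w = (if w = v then l x else (SOME q. q \<in> Lb (T w) (T' x)))" for x w
  have t: "proper_sets F T K T'" using p unfolding assignment_def by blast
  have L: "L x w \<in> Lb (T w) (T' x)" if "x \<in> K" "w \<in> F" "E x w" for x w
  proof (cases "w = v")
    case True then show ?thesis using p that unfolding assignment_def L_def by auto
  next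
    case False
    have "T w \<in> Fam" using rooted_state_Fam[OF g that(2,3)] that K by auto
    then have "Lb (T w) (T' x) \<noteq> {}" using t that by (intro Lb_ne) (auto simp: proper_sets_def)
    then show ?thesis using False unfolding L_def by (auto intro: someI)
  qed
  have dist: "\<exists>w\<in>F. E x w \<and> L x w \<noteq> L y w" if "x \<in> K" "y \<in> K" "x \<noteq> y" "\<And>w. w \<in> F \<Longrightarrow> E x w \<longleftrightarrow> E y w" for x y
  proof (intro bexI[OF _ v] conjI)
    show "E x v" using that K E_sym by auto
    show "L x v \<noteq> L y v" using p that unfolding assignment_def L_def inj_on_def by auto
  qed
  from extend[OF g v K t L dist] obtain T2 c2 where *: "rooted_state (F \<union> K) T2 c2" "\<forall>x\<in>F. T2 x = T x" "\<forall>x\<in>F. \<forall>y\<in>F. c2 (x, y) = c (x, y)"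
      "\<forall>x\<in>K. \<forall>w\<in>F. E x w \<longrightarrow> (c2 (w, x), c2 (x, w)) = L x w" by blast
  have "(c2 (v, x), c2 (x, v)) = l x" if "x \<in> K" for x
    using *(4) that v K E_sym by (auto simp: L_def)
  moreover have "(c2 (w, x), c2 (x, w)) \<in> Lb (T w) (T' x)" if "x \<in> K" "w \<in> F" "E x w" for x w
    using *(4) L that by fastforce
  ultimately show ?thesis using *(1-3) by blast
qed

text \<open>The parent \<open>v\<close> is left out of the count because a set that offers a label
  at \<open>v\<close> differs from \<open>T v\<close> anyway. For a kid \<open>u\<close> of
  \<open>v\<close> this leaves at most \<open>\<Delta> - 1\<close> forbidden sets.\<close>

lemma greedy_step:
  assumes p: "assignment F T v K0 T' l" and u: "u \<notin> K0" and d: "K0 \<inter> F = {}"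
    and big: "card ((N u \<inter> F - {v}) \<union> (N u \<inter> K0)) < card {X \<in> Fam. \<not> Lb (T v) X \<subseteq> l ` K0}"
  shows "\<exists>X q. assignment F T v (insert u K0) (T'(u := X)) (l(u := q))"
proof -
  let ?A = "{X \<in> Fam. \<not> Lb (T v) X \<subseteq> l ` K0}"
  let ?B = "(N u \<inter> F - {v}) \<union> (N u \<inter> K0)"
  define h where "h x = (if x \<in> F then T x else T' x)" for x
  have fB: "finite ?B" using fin_N by auto
  have "card (h ` ?B) < card ?A" using big card_image_le[OF fB, of h] by simp
  then have "\<not> ?A \<subseteq> h ` ?B" using card_mono[of "h ` ?B" ?A] fB by (meson finite_imageI not_le)
  then obtain X q where X: "X \<in> Fam" "q \<in> Lb (T v) X" "q \<notin> l ` K0" "X \<notin> h ` ?B" by blast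
  have "T v \<noteq> X" using X(2) Lb_D by blast
  have XF: "X \<noteq> T w" if "w \<in> F" "E u w" for w
    using X(4) that \<open>T v \<noteq> X\<close> unfolding h_def by (cases "w = v") auto
  have XK: "X \<noteq> T' y" if "y \<in> K0" "E u y" for y
  proof -
    have "h y = T' y" using that d unfolding h_def by auto
    moreover have "h y \<in> h ` ?B" using that by blast
    ultimately show ?thesis using X(4) by auto
  qed
  have "assignment F T v (insert u K0) (T'(u := X)) (l(u := q))"
    unfolding assignment_def proper_sets_def
  proof (intro conjI ballI impI)
    fix x assume x: "x \<in> insert u K0"
    show "(T'(u := X)) x \<in> Fam" using x p X unfolding assignment_def proper_sets_def by auto
    show "(T'(u := X)) x \<noteq> T w" if "w \<in> F" "E x w" for w
      using x p XF that unfolding assignment_def proper_sets_def by auto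
    show "(T'(u := X)) x \<noteq> (T'(u := X)) y" if yK: "y \<in> insert u K0" "E x y" for y
    proof -
      have "x \<noteq> u \<or> y \<noteq> u" using yK E_irrefl by auto
      then consider "x = u" "y \<in> K0" | "y = u" "x \<in> K0" "x \<noteq> u" | "x \<in> K0" "y \<in> K0" "x \<noteq> u" "y \<noteq> u"
        using x yK u by blast
      then show ?thesis
      proof cases
        case 1 then show ?thesis using XK[of y] yK u by auto
      next
        case 2 then show ?thesis using XK[of x] E_sym[OF yK(2)] by auto
      next
        case 3 then show ?thesis using p yK unfolding assignment_def proper_sets_def by auto
      qed
    qed
    show "(l(u := q)) x \<in> Lb (T v) ((T'(u := X)) x)" using x p X unfolding assignment_def by auto
  next
    show "inj_on (l(u := q)) (insert u K0)" using p u X(3) unfolding assignment_def by (auto simp: inj_on_def)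
  qed
  then show ?thesis by blast
qed

definition choices :: "nat set \<Rightarrow> nat \<Rightarrow> nat \<Rightarrow> bool" where
  "choices S n m \<longleftrightarrow> (\<forall>U. finite U \<and> card U \<le> n \<longrightarrow> m \<le> card {X \<in> Fam. \<not> Lb S X \<subseteq> U})"

lemma choices_mono: "choices S m d \<Longrightarrow> n \<le> m \<Longrightarrow> choices S n d"
  unfolding choices_def by (meson le_trans)

text \<open>Whenever a kid in \<open>K1\<close> is treated, at most \<open>card K1 - 1\<close>
  labels at \<open>v\<close> are in use, and its neighbours other than \<open>v\<close> forbid fewer
  than \<open>\<Delta>\<close> sets. Starting from \<open>K0\<close> makes it possible to prescribe
  some kids.\<close>

lemma greedy:
  assumes g: "rooted_state F T c" and v: "v \<in> F" and K: "K1 \<subseteq> N v - F" and K01: "K0 \<subseteq> K1"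
    and p: "assignment F T v K0 T' l" and ch: "choices (T v) (card K1 - 1) \<Delta>"
  shows "\<exists>T2 l2. assignment F T v K1 T2 l2 \<and> (\<forall>x\<in>K0. T2 x = T' x \<and> l2 x = l x)"
  using K01 p
proof (induction "card (K1 - K0)" arbitrary: K0 T' l)
  have fK1: "finite K1" using K fin_N finite_subset by blast
  case 0
  then have "K1 = K0" using fK1 by auto
  then show ?case using 0 by blast
next
  have fK1: "finite K1" using K fin_N finite_subset by blast
  case (Suc n)
  then obtain u where u: "u \<in> K1" "u \<notin> K0" by (metis Diff_eq_empty_iff card.empty nat.distinct(1) subsetI)
  have fK0: "finite K0" using fK1 Suc.prems finite_subset by blast
  have vu: "v \<in> N u" using u K E_sym by auto
  have "(N u \<inter> F - {v}) \<union> (N u \<inter> K0) \<subseteq> N u - {v}" using Suc.prems K v by auto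
  then have "card ((N u \<inter> F - {v}) \<union> (N u \<inter> K0)) \<le> card (N u - {v})" by (intro card_mono) (use fin_N in auto)
  also have "\<dots> < card (N u)" using vu fin_N by (intro psubset_card_mono) auto
  also have "\<dots> \<le> \<Delta>" by (rule deg)
  also have "\<Delta> \<le> card {X \<in> Fam. \<not> Lb (T v) X \<subseteq> l ` K0}"
  proof -
    have "card (l ` K0) \<le> card K0" by (rule card_image_le[OF fK0])
    also have "card K0 \<le> card (K1 - {u})" by (rule card_mono) (use u Suc.prems fK1 in auto)
    finally have "card (l ` K0) \<le> card K1 - 1" using u by simp
    then show ?thesis using ch fK0 unfolding choices_def by blast
  qed
  finally obtain X q where X: "assignment F T v (insert u K0) (T'(u := X)) (l(u := q))"
    using greedy_step[OF Suc.prems(2) u(2)] Suc.prems(1) K by blast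
  have "K1 - K0 = insert u (K1 - insert u K0)" using u by auto
  then have "n = card (K1 - insert u K0)" using Suc.hyps(2) fK1 by (metis Diff_iff card_insert_disjoint finite_Diff insertI1 nat.inject)
  from Suc.hyps(1)[OF this _ X] u Suc.prems(1) obtain T2 l2 where
    "assignment F T v K1 T2 l2" "\<forall>x\<in>insert u K0. T2 x = (T'(u := X)) x \<and> l2 x = (l(u := q)) x" by blast
  then show ?case using u by (intro exI[of _ T2] exI[of _ l2]) auto
qed

lemma assignment_empty: "assignment F T v {} T' l"
  by (simp add: assignment_def proper_sets_def)

section \<open>From the root to the whole graph\<close>

text \<open>Connectedness supplies a coloured vertex with a kid as long as \<open>F\<close> is not
  \<open>V\<close>. The steps preserve the colours on \<open>F\<close> but only the sets of
  \<open>r\<close> and \<open>s\<close>, since a step for \<open>\<Delta> = 4\<close> may change the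
  set of another coloured vertex.\<close>

lemma iterate:
  assumes step: "\<And>F T c v. rooted_state F T c \<Longrightarrow> N r \<subseteq> F \<Longrightarrow> N s \<subseteq> F \<Longrightarrow> v \<in> F \<Longrightarrow> N v - F \<noteq> {} \<Longrightarrow>
      \<exists>F' T' c'. rooted_state F' T' c' \<and> F \<subset> F' \<and> T' r = T r \<and> T' s = T s \<and> (\<forall>x\<in>F. \<forall>y\<in>F. c' (x, y) = c (x, y))"
    and g: "rooted_state F T c" "N r \<subseteq> F" "N s \<subseteq> F"
  shows "\<exists>T' c'. rooted_state V T' c' \<and> T' r = T r \<and> T' s = T s \<and> (\<forall>x\<in>F. \<forall>y\<in>F. c' (x, y) = c (x, y))"
  using g
proof (induction "card (V - F)" arbitrary: F T c rule: less_induct)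
  case less
  have FV: "F \<subseteq> V" "r \<in> F" using rooted_state_sub[OF less.prems(1)] by auto
  show ?case
  proof (cases "F = V")
    case True then show ?thesis using less.prems by blast
  next
    case False
    have "\<exists>v\<in>F. N v - F \<noteq> {}"
    proof (rule ccontr)
      assume a: "\<not> ?thesis"
      have "y \<in> F" if "E\<^sup>*\<^sup>* r y" for y
        using that by induction (use FV a in auto)
      then show False using False FV conn unfolding connected_graph_def by blast
    qed
    then obtain v where v: "v \<in> F" "N v - F \<noteq> {}" by blast
    obtain F' T' c' where 1: "rooted_state F' T' c'" "F \<subset> F'" "T' r = T r" "T' s = T s" "\<forall>x\<in>F. \<forall>y\<in>F. c' (x, y) = c (x, y)"
      using step[OF less.prems v] by blast
    have "F' \<subseteq> V" using rooted_state_sub[OF 1(1)] by auto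
    then have "card (V - F') < card (V - F)" using 1(2) fin_V by (intro psubset_card_mono) auto
    from less.hyps[OF this 1(1)] 1(2) less.prems obtain T2 c2 where
      "rooted_state V T2 c2" "T2 r = T' r" "T2 s = T' s" "\<forall>x\<in>F'. \<forall>y\<in>F'. c2 (x, y) = c' (x, y)" by blast
    moreover have "F \<subseteq> F'" using 1(2) by blast
    ultimately show ?thesis using 1(3-5) by (intro exI[of _ T2] exI[of _ c2]) (auto simp: subset_iff)
  qed
qed

text \<open>At the middle vertex of two consecutive arcs, the first colour lies outside its set and
  the second inside, which gives properness. Rigidity on \<open>V\<close> leaves only the root to be
  recognised.\<close>

lemma finish:
  assumes g: "rooted_state V T c"
    and uniq: "\<And>f. graph_automorphism V E f \<Longrightarrow> (\<And>x y. E x y \<Longrightarrow> c (f x, f y) = c (x, y)) \<Longrightarrow> f r = r \<and> f s = s"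
  shows "chi_D12 V E \<le> k"
proof -
  have c: "c (x, y) \<in> T x \<and> c (x, y) \<notin> T y \<and> T x \<subseteq> {..<k}" if "E x y" for x y
    using rooted_state_col[OF g] rooted_state_bounded[OF g] E_V[OF that] that by simp
  have "proper_type1_arc_colouring E k c"
    unfolding proper_type1_arc_colouring_def arcs_def using c by (auto, metis)
  moreover have "distinguishing_arc_colouring V E c"
    unfolding distinguishing_arc_colouring_def
  proof (intro allI impI)
    fix f assume f: "graph_automorphism V E f \<and> (\<forall>(u, v)\<in>arcs E. c (f u, f v) = c (u, v))"
    then have c: "c (f x, f y) = c (x, y)" if "E x y" for x y using that unfolding arcs_def by blast
    then have rs: "f r = r \<and> f s = s" using uniq f by blast
    then show "\<forall>x\<in>V. f x = x"
      using rooted_state_rigid[OF g, unfolded rigid_def, THEN spec[of _ f]] f c rs by blast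
  qed
  ultimately show ?thesis unfolding chi_D12_def by (intro Least_le) blast
qed

text \<open>If nothing works for \<open>u\<close>, then every label at \<open>v\<close> offered by an available set \<open>X \<in> A\<close> is used by
  exactly one twin of \<open>u\<close>, and that twin also uses the only label which \<open>X\<close> offers at \<open>w0\<close>. As this
  label determines \<open>X\<close>, different \<open>X\<close> are blocked by different twins.\<close>

lemma last_kid:
  assumes g: "rooted_state F T c" and v: "v \<in> F" and K: "K = N v - F" and u: "u \<in> K"
    and p: "assignment F T v (K - {u}) T' l"
    and w0: "w0 \<in> F" "E u w0" "w0 \<noteq> v"
    and single: "\<forall>S\<in>Fam. \<forall>X\<in>Fam. \<forall>Y\<in>Fam. \<forall>q. Lb S X = {q} \<longrightarrow> Lb S Y = {q} \<longrightarrow> X = Y"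
    and A: "A = {X \<in> Fam. (\<forall>w\<in>F. E u w \<longrightarrow> X \<noteq> T w) \<and> (\<forall>y\<in>K - {u}. E u y \<longrightarrow> X \<noteq> T' y)}"
    and cA: "card (K - {u}) \<le> card A"
    and no: "\<nexists>T2 c2. rooted_state (F \<union> K) T2 c2 \<and> (\<forall>x\<in>F. T2 x = T x) \<and> (\<forall>x\<in>F. \<forall>y\<in>F. c2 (x, y) = c (x, y)) \<and>
      (\<forall>x\<in>K - {u}. (c2 (v, x), c2 (x, v)) = l x \<and>
        (\<forall>w\<in>F. E x w \<longrightarrow> (c2 (w, x), c2 (x, w)) \<in> Lb (T w) (T' x)))"
  shows "card A = card (K - {u}) \<and> (\<exists>\<phi>. bij_betw \<phi> A (K - {u}) \<and>
     (\<forall>X\<in>A. (\<forall>w\<in>F. E (\<phi> X) w \<longleftrightarrow> E u w) \<and> Lb (T v) X = {l (\<phi> X)} \<and>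
       (\<forall>w\<in>F. E u w \<longrightarrow> w \<noteq> v \<longrightarrow> (\<exists>q. Lb (T w) X = {q} \<and> q \<in> Lb (T w) (T' (\<phi> X))))))"
proof -
  let ?K = "K - {u}"
  define L where "L x w = (if w = v then l x else (SOME q. q \<in> Lb (T w) (T' x)))" for x w
  define tw where "tw x \<longleftrightarrow> (\<forall>w\<in>F. E x w \<longleftrightarrow> E u w)" for x
  have t: "proper_sets F T ?K T'" and inj: "inj_on l ?K" and lv: "\<And>x. x \<in> ?K \<Longrightarrow> l x \<in> Lb (T v) (T' x)"
    using p unfolding assignment_def by blast+
  have KF: "x \<notin> F" "E v x" "E x v" if "x \<in> K" for x using that K E_sym by auto
  have fK: "finite K" using K fin_N by blast
  have TF: "T w \<in> Fam" if "x \<in> K" "w \<in> F" "E x w" for x w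
    using rooted_state_Fam[OF g that(2,3)] KF(1)[OF that(1)] by blast
  have L: "L x w \<in> Lb (T w) (T' x)" if "x \<in> ?K" "w \<in> F" "E x w" for x w
  proof (cases "w = v")
    case True then show ?thesis using lv that unfolding L_def by auto
  next
    case False
    have "Lb (T w) (T' x) \<noteq> {}" using t that TF[of x w] by (intro Lb_ne) (auto simp: proper_sets_def)
    then show ?thesis using False unfolding L_def by (auto intro: someI)
  qed
  have AF: "X \<in> Fam" if "X \<in> A" for X using that A by blast
  have fA: "finite A" using A fin_Fam by auto
  have Lne: "Lb (T w) X \<noteq> {}" if "X \<in> A" "w \<in> F" "E u w" for X w
    using that A TF[OF u that(2,3)] by (intro Lb_ne) auto
  \<comment> \<open>Here \<open>gg\<close> is any choice of labels for \<open>u\<close> with set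
    \<open>X\<close>. If no twin had exactly these labels at all coloured neighbours,
    \<open>u\<close> could be coloured with them.\<close>
  have blocked: "\<exists>x\<in>?K. tw x \<and> (\<forall>w\<in>F. E u w \<longrightarrow> gg w = L x w)"
    if X: "X \<in> A" and gg: "\<And>w. w \<in> F \<Longrightarrow> E u w \<Longrightarrow> gg w \<in> Lb (T w) X" for X gg
  proof (rule ccontr)
    assume a: "\<not> ?thesis"
    define T2 where "T2 = T'(u := X)"
    define L2 where "L2 x w = (if x = u then gg w else L x w)" for x w
    have XF: "X \<noteq> T w" if "w \<in> F" "E u w" for w using X that A by blast
    have XK: "X \<noteq> T' y" if "y \<in> ?K" "E u y" for y using X that A by blast
    have t2: "proper_sets F T K T2"
      unfolding proper_sets_def
    proof (intro conjI ballI impI)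
      fix x assume x: "x \<in> K"
      show "T2 x \<in> Fam" using x t AF[OF X] unfolding T2_def proper_sets_def by auto
      show "T2 x \<noteq> T w" if "w \<in> F" "E x w" for w
        using x t that XF[of w] unfolding T2_def proper_sets_def by (cases "x = u") auto
      show "T2 x \<noteq> T2 y" if yK: "y \<in> K" "E x y" for y
      proof -
        consider "x = u" "y \<in> ?K" | "y = u" "x \<in> ?K" | "x \<in> ?K" "y \<in> ?K"
          using x yK E_irrefl by blast
        then show ?thesis
        proof cases
          case 1 then show ?thesis using XK[of y] yK unfolding T2_def by auto
        next
          case 2 then show ?thesis using XK[of x] E_sym[OF yK(2)] unfolding T2_def by auto
        next
          case 3 then show ?thesis using t yK unfolding T2_def proper_sets_def by auto
        qed
      qed
    qed
    have L2: "L2 x w \<in> Lb (T w) (T2 x)" if "x \<in> K" "w \<in> F" "E x w" for x w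
      using that gg L unfolding L2_def T2_def by auto
    have Lvl: "L2 x v = l x" if "x \<in> ?K" for x using that unfolding L2_def L_def by auto
    have dist: "\<exists>w\<in>F. E x w \<and> L2 x w \<noteq> L2 y w"
      if xy: "x \<in> K" "y \<in> K" "x \<noteq> y" and tt: "\<And>w. w \<in> F \<Longrightarrow> E x w \<longleftrightarrow> E y w" for x y
    proof -
      consider "x = u" "y \<in> ?K" | "y = u" "x \<in> ?K" | "x \<in> ?K" "y \<in> ?K" using xy by blast
      then show ?thesis
      proof cases
        case 1
        have "tw y" using tt 1 unfolding tw_def by auto
        then show ?thesis using a 1 tt unfolding L2_def by auto
      next
        case 2
        have "tw x" using tt 2 unfolding tw_def by auto
        then obtain w where "w \<in> F" "E u w" "gg w \<noteq> L x w" using a 2 by auto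
        then show ?thesis using 2 tt unfolding L2_def by (intro bexI[of _ w]) auto
      next
        case 3
        then have "L2 x v \<noteq> L2 y v" using Lvl inj xy(3) unfolding inj_on_def by auto
        then show ?thesis using v KF(3)[OF xy(1)] by blast
      qed
    qed
    from extend[OF g v K t2 L2 dist] obtain T3 c3 where e: "rooted_state (F \<union> K) T3 c3" "\<forall>x\<in>F. T3 x = T x"
      "\<forall>x\<in>F. \<forall>y\<in>F. c3 (x, y) = c (x, y)" "\<forall>x\<in>K. \<forall>w\<in>F. E x w \<longrightarrow> (c3 (w, x), c3 (x, w)) = L2 x w" by blast
    have "(c3 (v, x), c3 (x, v)) = l x" if "x \<in> ?K" for x
      using e(4) that v KF(3) Lvl by auto
    moreover have "(c3 (w, x), c3 (x, w)) \<in> Lb (T w) (T' x)" if "x \<in> ?K" "w \<in> F" "E x w" for x w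
      using e(4) that L[OF that] unfolding L2_def by auto
    ultimately show False using no e(1-3) by blast
  qed
  define D where "D X = {x \<in> ?K. tw x \<and> l x \<in> Lb (T v) X}" for X
  have D_img: "Lb (T v) X \<subseteq> l ` D X" if X: "X \<in> A" for X
  proof
    fix q assume q: "q \<in> Lb (T v) X"
    define gg where "gg w = (if w = v then q else (SOME q. q \<in> Lb (T w) X))" for w
    have "gg w \<in> Lb (T w) X" if "w \<in> F" "E u w" for w
      using q Lne[OF X that] unfolding gg_def by (auto intro: someI)
    from blocked[OF X this] obtain x where x: "x \<in> ?K" "tw x" "\<forall>w\<in>F. E u w \<longrightarrow> gg w = L x w" by blast
    then have "q = l x" using v KF(3)[OF u] unfolding gg_def L_def by auto
    then show "q \<in> l ` D X" using x q unfolding D_def by auto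
  qed
  \<comment> \<open>Keep the label of \<open>x\<close> at \<open>v\<close> and vary only the one at
    \<open>w\<close>. As \<open>l\<close> is injective, the blocking twin is always \<open>x\<close>
    itself, so \<open>X\<close> offers no alternative at \<open>w\<close>.\<close>
  have D_sing: "Lb (T w) X = {L x w}" if X: "X \<in> A" and x: "x \<in> D X" and w: "w \<in> F" "E u w" "w \<noteq> v" for X x w
  proof -
    have "q = L x w" if q: "q \<in> Lb (T w) X" for q
    proof -
      define gg where "gg z = (if z = v then l x else if z = w then q else (SOME q. q \<in> Lb (T z) X))" for z
      have "gg z \<in> Lb (T z) X" if "z \<in> F" "E u z" for z
        using q x Lne[OF X that] unfolding gg_def D_def by (auto intro: someI)
      from blocked[OF X this] obtain y where y: "y \<in> ?K" "tw y" "\<forall>w\<in>F. E u w \<longrightarrow> gg w = L y w" by blast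
      then have "l x = l y" using v KF(3)[OF u] unfolding gg_def L_def by auto
      then have "x = y" using inj x y(1) unfolding inj_on_def D_def by auto
      then show "q = L x w" using y(3) w unfolding gg_def by auto
    qed
    then show ?thesis using Lne[OF X w(1,2)] by blast
  qed
  have Dne: "D X \<noteq> {}" if "X \<in> A" for X
    using D_img[OF that] Lne[OF that v KF(3)[OF u]] by auto
  have fD: "finite (D X)" for X using fK unfolding D_def by auto
  \<comment> \<open>This is where the second coloured neighbour \<open>w0\<close> enters: a common
    twin would force the same single label at \<open>w0\<close> on \<open>X\<close> and
    \<open>Y\<close>, and this label determines the set.\<close>
  have Ddisj: "D X \<inter> D Y = {}" if "X \<in> A" "Y \<in> A" "X \<noteq> Y" for X Y
  proof (rule ccontr)
    assume "D X \<inter> D Y \<noteq> {}"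
    then obtain x where "x \<in> D X" "x \<in> D Y" by blast
    then have "Lb (T w0) X = {L x w0}" "Lb (T w0) Y = {L x w0}" using D_sing that w0 by auto
    then show False using single TF[OF u w0(1,2)] AF[OF that(1)] AF[OF that(2)] that(3) by blast
  qed
  have sum: "(\<Sum>X\<in>A. card (D X)) = card (\<Union>X\<in>A. D X)"
    using fA fD Ddisj by (intro card_UN_disjoint[symmetric]) auto
  have sub: "(\<Union>X\<in>A. D X) \<subseteq> ?K" unfolding D_def by auto
  then have le: "(\<Sum>X\<in>A. card (D X)) \<le> card ?K" unfolding sum using fK by (intro card_mono) auto
  have ge1: "1 \<le> card (D X)" if "X \<in> A" for X using Dne[OF that] fD by (simp add: Suc_le_eq card_gt_0_iff)
  then have ge: "card A \<le> (\<Sum>X\<in>A. card (D X))" using sum_mono[of A "\<lambda>_. 1::nat" "\<lambda>X. card (D X)"] by simp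
  \<comment> \<open>The sets \<open>D X\<close> are disjoint, non-empty and contained in
    \<open>K - {u}\<close>, which has at most \<open>card A\<close> elements. So all of them are
    singletons and they exhaust it.\<close>
  have cAK: "card A = card ?K" using le ge cA by linarith
  have one: "card (D X) = 1" if X: "X \<in> A" for X
  proof (rule ccontr)
    assume "card (D X) \<noteq> 1"
    then have "(\<Sum>X\<in>A. 1) < (\<Sum>X\<in>A. card (D X))"
      using ge1 X by (intro sum_strict_mono_ex1[OF fA]) (auto simp: less_le intro!: bexI[of _ X])
    then show False using le cAK by simp
  qed
  define \<phi> where "\<phi> X = the_elem (D X)" for X
  have \<phi>: "D X = {\<phi> X}" if "X \<in> A" for X
    using card_1_singletonE[OF one[OF that]] unfolding \<phi>_def by (metis the_elem_eq)
  have \<phi>D: "\<phi> X \<in> D X" if "X \<in> A" for X using \<phi>[OF that] by simp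
  have inj\<phi>: "inj_on \<phi> A" 
  proof (rule inj_onI, rule ccontr)
    fix X Y assume XY: "X \<in> A" "Y \<in> A" "\<phi> X = \<phi> Y" "X \<noteq> Y"
    then have "\<phi> X \<in> D X \<inter> D Y" using \<phi>D[OF XY(1)] \<phi>D[OF XY(2)] by simp
    then show False using Ddisj[OF XY(1,2,4)] by blast
  qed
  have "\<phi> ` A \<subseteq> ?K" using \<phi>D unfolding D_def by auto
  then have "\<phi> ` A = ?K" using card_image[OF inj\<phi>] cAK fK by (intro card_subset_eq) auto
  then have bij: "bij_betw \<phi> A ?K" using inj\<phi> unfolding bij_betw_def by blast
  show ?thesis
  proof (intro conjI exI[of _ \<phi>] ballI impI)
    show "card A = card ?K" by (rule cAK)
    show "bij_betw \<phi> A ?K" by (rule bij)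
    fix X assume X: "X \<in> A"
    have K\<phi>: "\<phi> X \<in> ?K" "tw (\<phi> X)" using \<phi>D[OF X] unfolding D_def by auto
    show "E (\<phi> X) w = E u w" if "w \<in> F" for w using K\<phi>(2) that unfolding tw_def by auto
    have "Lb (T v) X \<subseteq> {l (\<phi> X)}" using D_img[OF X] \<phi>[OF X] by auto
    then show "Lb (T v) X = {l (\<phi> X)}" using Lne[OF X v KF(3)[OF u]] by blast
    show "\<exists>q. Lb (T w) X = {q} \<and> q \<in> Lb (T w) (T' (\<phi> X))" if w: "w \<in> F" "E u w" "w \<noteq> v" for w
      using D_sing[OF X \<phi>D[OF X] w] L[OF K\<phi>(1) w(1)] K\<phi>(2) w unfolding tw_def by blast
  qed
qed

end

section \<open>Choosing a root\<close>

text \<open>The labels are chosen to cover \<open>{..<b} \<times> {b}\<close>, so every colour of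
  the root's set \<open>{..<b}\<close> leaves the root. A neighbour with label \<open>(i, j)\<close>
  gets \<open>j\<close> together with \<open>a - 1\<close> colours of \<open>{..<b}\<close> other
  than \<open>i\<close>; these must determine \<open>i\<close>, so that different labels yield
  different sets.\<close>

lemma root_labels:
  fixes M :: "'a set"
  assumes M: "finite M" "card M = \<Delta>" and k: "k = a + b" "1 \<le> a" "b \<le> \<Delta>" "\<Delta> \<le> a * b"
    and b: "b = a \<or> b = a + 1 \<and> 3 \<le> b"
  shows "\<exists>(l :: 'a \<Rightarrow> nat \<times> nat) T0. inj_on l M \<and> l ` M \<subseteq> {..<b} \<times> ({..<k} - {..<b}) \<and> {..<b} \<subseteq> fst ` l ` M \<and>
     inj_on T0 M \<and> (\<forall>x\<in>M. T0 x \<subseteq> {..<k} \<and> card (T0 x) = a \<and> T0 x \<noteq> {..<b} \<and> fst (l x) \<notin> T0 x \<and> snd (l x) \<in> T0 x)"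
proof -
  let ?G = "{..<b} \<times> ({..<k} - {..<b})"
  have cG: "card ?G = a * b" using k by (simp add: card_cartesian_product card_Diff_subset)
  have sub: "{..<b} \<times> {b} \<subseteq> ?G" using k by auto
  have c1: "card ({..<b} \<times> {b}) \<le> \<Delta>" using k by (simp add: card_cartesian_product)
  have c2: "\<Delta> \<le> card ?G" unfolding cG by (rule k(4))
  obtain G where G: "{..<b} \<times> {b} \<subseteq> G" "G \<subseteq> ?G" "card G = \<Delta>"
    using exists_subset_between[OF c1 c2 sub] by auto
  have "finite G" using G(2) finite_subset by auto
  then obtain l where l: "bij_betw l M G" using finite_same_card_bij[OF M(1)] M(2) G(3) by metis
  \<comment> \<open>For \<open>b = a + 1\<close> two colours have to be dropped. The pairs of
    cyclically consecutive colours determine their first member once \<open>b\<close> is at least 3;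
    for \<open>b = 2\<close> they would coincide.\<close>
  define Q where "Q x = (if b = a then {..<b} - {x} else {..<b} - {x, Suc x mod b})" for x
  have Qs: "Q x \<subseteq> {..<b}" "x \<notin> Q x" for x unfolding Q_def by auto
  have smod: "Suc x mod b < b" "Suc x mod b \<noteq> x" if "b = a + 1 \<and> 3 \<le> b" "x < b" for x
    using that by (auto simp: mod_Suc split: if_splits)
  have Qc: "card (Q x) = a - 1" if "x < b" for x
  proof (cases "b = a")
    case True then show ?thesis using that unfolding Q_def by simp
  next
    case False
    then have b3: "b = a + 1 \<and> 3 \<le> b" using b by auto
    have "card {x, Suc x mod b} = 2" using smod(2)[OF b3 that] by (metis card_2_iff)
    moreover have "{x, Suc x mod b} \<subseteq> {..<b}" using smod(1)[OF b3 that] that by auto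
    ultimately show ?thesis using False b unfolding Q_def by (simp add: card_Diff_subset)
  qed
  have Qi: "x = y" if "x < b" "y < b" "Q x = Q y" for x y
  proof (cases "b = a")
    case True
    then have "{..<b} - {x} = {..<b} - {y}" using that(3) unfolding Q_def by simp
    then show ?thesis using that(1,2) by auto
  next
    case False
    then have b3: "b = a + 1 \<and> 3 \<le> b" using b by auto
    have "{..<b} - {x, Suc x mod b} = {..<b} - {y, Suc y mod b}" using that(3) False unfolding Q_def by simp
    then have e: "{x, Suc x mod b} = {y, Suc y mod b}"
      using smod[OF b3 that(1)] smod[OF b3 that(2)] that(1,2) by auto
    show ?thesis
    proof (rule ccontr)
      assume "x \<noteq> y"
      then have "x = Suc y mod b" "y = Suc x mod b" using e by auto
      moreover have "Suc z mod b = (if Suc z = b then 0 else Suc z)" if "z < b" for z using that by auto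
      ultimately show False using that(1,2) b3 by (auto split: if_splits)
    qed
  qed
  define T0 where "T0 x = insert (snd (l x)) (Q (fst (l x)))" for x
  have lx: "fst (l x) < b" "b \<le> snd (l x)" "snd (l x) < k" if "x \<in> M" for x
  proof -
    have "l x \<in> ?G" using bij_betwE[OF l] that G(2) by blast
    then show "fst (l x) < b" "b \<le> snd (l x)" "snd (l x) < k" by (auto simp: mem_Times_iff)
  qed
  have "inj_on T0 M"
  proof (rule inj_onI)
    fix x y assume xy: "x \<in> M" "y \<in> M" "T0 x = T0 y"
    have "T0 z - {..<b} = {snd (l z)}" "T0 z \<inter> {..<b} = Q (fst (l z))" if "z \<in> M" for z
      using lx[OF that] Qs(1)[of "fst (l z)"] unfolding T0_def by auto
    then have "snd (l x) = snd (l y)" "Q (fst (l x)) = Q (fst (l y))" using xy by (metis singleton_inject, metis)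
    then have "l x = l y" using Qi lx xy by (simp add: prod_eq_iff)
    then show "x = y" using l xy unfolding bij_betw_def inj_on_def by blast
  qed
  moreover have "T0 x \<subseteq> {..<k} \<and> card (T0 x) = a \<and> T0 x \<noteq> {..<b} \<and> fst (l x) \<notin> T0 x \<and> snd (l x) \<in> T0 x" if x: "x \<in> M" for x
  proof (intro conjI)
    note p = lx[OF x] and q = Qs[of "fst (l x)"]
    show "T0 x \<subseteq> {..<k}" using p q k unfolding T0_def by auto
    have "snd (l x) \<notin> Q (fst (l x))" using p q by auto
    moreover have "finite (Q (fst (l x)))" using q finite_subset by blast
    ultimately show "card (T0 x) = a" using Qc[OF p(1)] k(2) unfolding T0_def by simp
    have "snd (l x) \<in> T0 x" "snd (l x) \<notin> {..<b}" using p unfolding T0_def by auto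
    then show "T0 x \<noteq> {..<b}" by metis
    show "fst (l x) \<notin> T0 x" using p q unfolding T0_def by auto
    show "snd (l x) \<in> T0 x" unfolding T0_def by simp
  qed
  moreover have "{..<b} \<subseteq> fst ` l ` M"
    using l G(1) unfolding bij_betw_def by force
  moreover have "inj_on l M" "l ` M \<subseteq> ?G" using l G(2) unfolding bij_betw_def by auto
  ultimately show ?thesis by blast
qed

context arc_ext
begin

definition extends :: "'a set \<Rightarrow> ('a \<Rightarrow> nat set) \<Rightarrow> ('a \<times> 'a \<Rightarrow> nat) \<Rightarrow> 'a \<Rightarrow> bool" where
  "extends F T c v \<longleftrightarrow> (\<exists>T2 c2. rooted_state (F \<union> (N v - F)) T2 c2 \<and> (\<forall>x\<in>F. T2 x = T x) \<and>
     (\<forall>x\<in>F. \<forall>y\<in>F. c2 (x, y) = c (x, y)))"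

text \<open>A colour-preserving automorphism maps \<open>r\<close> to a vertex from which all
  colours of \<open>R\<close> leave. Every other vertex has a set of size
  \<open>a \<le> card R\<close> different from \<open>R\<close>, and such a set cannot contain
  \<open>R\<close>.\<close>

lemma generic_finish:
  assumes sr: "s = r" and Lb: "Lb = rect" and Fam: "Fam = {X. X \<subseteq> {..<k} \<and> card X = a \<and> X \<noteq> R}"
    and R: "R \<subseteq> {..<k}" "a \<le> card R" and Nr: "N r \<noteq> {}"
    and l: "inj_on l (N r)" "l ` N r \<subseteq> R \<times> ({..<k} - R)" "R \<subseteq> fst ` l ` N r"
    and T0: "\<And>x. x \<in> N r \<Longrightarrow> T0 x \<in> Fam \<and> fst (l x) \<notin> T0 x \<and> snd (l x) \<in> T0 x"
    and adj: "\<And>x y. x \<in> N r \<Longrightarrow> y \<in> N r \<Longrightarrow> E x y \<Longrightarrow> T0 x \<noteq> T0 y"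
    and step: "\<And>F T c v. rooted_state F T c \<Longrightarrow> N r \<subseteq> F \<Longrightarrow> v \<in> F \<Longrightarrow> v \<noteq> r \<Longrightarrow> N v - F \<noteq> {} \<Longrightarrow> extends F T c v"
  shows "chi_D12 V E \<le> k"
proof -
  have rV: "r \<in> V" using Nr E_V by blast
  have nr: "r \<notin> N r" using E_irrefl by simp
  define T1 where "T1 = (\<lambda>_::'a. R)"
  \<comment> \<open>A dummy colouring: there is no arc inside \<open>{r}\<close>, and rigidity is
    trivial there.\<close>
  define c1 where "c1 = (\<lambda>_::'a \<times> 'a. 0::nat)"
  have pre1: "state {r} T1 c1"
    unfolding state_def rigid_def T1_def using rV R E_irrefl sr by auto
  have K: "N r = N r - {r}" using nr by auto
  have t: "proper_sets {r} T1 (N r) T0"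
    unfolding proper_sets_def using T0 adj Fam by (auto simp: T1_def)
  have L: "l x \<in> Lb (T1 w) (T0 x)" if "x \<in> N r" "w \<in> {r}" "E x w" for x w
  proof -
    have "l x \<in> R \<times> ({..<k} - R)" using l(2) that(1) by blast
    then show ?thesis using T0[OF that(1)] unfolding T1_def Lb rect_def by (cases "l x") auto
  qed
  have dist: "\<exists>w\<in>{r}. E x w \<and> l x \<noteq> l y"
    if "x \<in> N r" "y \<in> N r" "x \<noteq> y" "\<And>w. w \<in> {r} \<Longrightarrow> E x w \<longleftrightarrow> E y w" for x y
    using that l(1) E_sym unfolding inj_on_def by auto
  have rr: "r \<in> {r}" by simp
  from extend_state[where L = "\<lambda>x w. l x", OF pre1 rr K t L dist] obtain T2 c2 where
    e0: "state ({r} \<union> N r) T2 c2" "\<forall>x\<in>{r}. T2 x = T1 x"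
    "\<forall>x\<in>N r. \<forall>w\<in>{r}. E x w \<longrightarrow> (c2 (w, x), c2 (x, w)) = l x" by blast
  have e: "state ({r} \<union> N r) T2 c2" "T2 r = R" "\<And>x. x \<in> N r \<Longrightarrow> (c2 (r, x), c2 (x, r)) = l x"
    using e0 E_sym by (simp_all add: T1_def)
  have "\<exists>y\<in>{r} \<union> N r. E x y" if "x \<in> {r} \<union> N r" for x using that Nr E_sym by blast
  then have g: "rooted_state ({r} \<union> N r) T2 c2" using e(1) unfolding rooted_state_def by blast
  have "\<exists>T' c'. rooted_state V T' c' \<and> T' r = T2 r \<and> T' s = T2 s \<and> (\<forall>x\<in>{r} \<union> N r. \<forall>y\<in>{r} \<union> N r. c' (x, y) = c2 (x, y))"
  proof (rule iterate)
    fix F T c v assume a: "rooted_state F T c" "N r \<subseteq> F" "N s \<subseteq> F" "v \<in> F" "N v - F \<noteq> {}"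
    then have "v \<noteq> r" by blast
    then have "extends F T c v" using step[OF a(1,2,4) _ a(5)] by simp
    then obtain T' c' where 1: "rooted_state (F \<union> (N v - F)) T' c'" "\<forall>x\<in>F. T' x = T x"
      "\<forall>x\<in>F. \<forall>y\<in>F. c' (x, y) = c (x, y)" unfolding extends_def by blast
    moreover have "F \<subset> F \<union> (N v - F)" using a(5) by blast
    moreover have "r \<in> F" using rooted_state_sub[OF a(1)] by blast
    ultimately show "\<exists>F' T' c'. rooted_state F' T' c' \<and> F \<subset> F' \<and> T' r = T r \<and> T' s = T s \<and> (\<forall>x\<in>F. \<forall>y\<in>F. c' (x, y) = c (x, y))"
      using sr by blast
  qed (use g sr in auto)
  then obtain T c where T: "rooted_state V T c" "T r = R" "\<And>x. x \<in> N r \<Longrightarrow> c (r, x) = c2 (r, x)"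
    using e(2) by auto
  show ?thesis
  proof (rule finish[OF T(1)])
    fix f assume f: "graph_automorphism V E f" and cf: "\<And>x y. E x y \<Longrightarrow> c (f x, f y) = c (x, y)"
    have fV: "f x \<in> V" if "x \<in> V" for x using f that unfolding graph_automorphism_def bij_betw_def by blast
    have "R \<subseteq> T (f r)"
    proof
      fix i assume "i \<in> R"
      then obtain x where x: "x \<in> N r" "fst (l x) = i" using l(3) by auto
      then have "i = c (r, x)" using e(3)[OF x(1)] T(3)[OF x(1)] by (metis fst_conv)
      also have "\<dots> = c (f r, f x)" using cf x by simp
      also have "\<dots> \<in> T (f r)"
      proof -
        have "x \<in> V" "E r x" using x E_V by blast+
        then have "E (f r) (f x)" using f rV unfolding graph_automorphism_def by blast
        then show ?thesis using rooted_state_col[OF T(1) fV[OF rV] fV[OF \<open>x \<in> V\<close>]] by blast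
      qed
      finally show "i \<in> T (f r)" .
    qed
    moreover have "T (f r) \<in> Fam" if "f r \<noteq> r" using rooted_state_T[OF T(1) fV[OF rV] that] .
    ultimately have "f r = r"
      using R Fam card_seteq[of "T (f r)" R] finite_subset[of _ "{..<k}"] by blast
    then show "f r = r \<and> f s = s" using sr by simp
  qed
qed

section \<open>Extension steps for \<open>\<Delta>\<close> other than 4\<close>

text \<open>Excluding \<open>R\<close> from \<open>Fam\<close> costs one set if
  \<open>a = b\<close>, which the extra 1 in \<open>reach_bound\<close> covers; otherwise
  \<open>R\<close> does not have size \<open>a\<close>.\<close>

lemma choices_reach:
  assumes Lb: "Lb = rect" and Fam: "Fam = {X. X \<subseteq> {..<k} \<and> card X = a \<and> X \<noteq> R}" and R: "card R = b"
    and \<Delta>: "4 * \<Delta> \<le> k\<^sup>2" "(k - 1)\<^sup>2 < 4 * \<Delta>" "\<Delta> \<noteq> 4" "2 \<le> \<Delta>"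
    and a: "a = k div 2" "b = k - a" and S: "S \<in> Fam"
    and n: "n + (if \<Delta> = 6 \<or> \<Delta> = 9 then 3 else 2) \<le> \<Delta>"
  shows "choices S n \<Delta>"
  unfolding choices_def
proof (intro allI impI)
  fix U :: "(nat \<times> nat) set" assume U: "finite U \<and> card U \<le> n"
  let ?M = "S \<times> ({..<k} - S) - U"
  have S': "S \<subseteq> {..<k}" "card S = a" using S Fam by auto
  have b: "\<Delta> + (if a = b then 1 else 0) \<le> card (reach k a S ?M)"
    by (rule reach_bound[OF \<Delta> a S']) (use U n in auto)
  have "reach k a S ?M - {R} \<subseteq> {X \<in> Fam. \<not> Lb S X \<subseteq> U}" using Fam Lb unfolding reach_def by auto
  then have "card (reach k a S ?M - {R}) \<le> card {X \<in> Fam. \<not> Lb S X \<subseteq> U}" using fin_Fam by (intro card_mono) auto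
  moreover have "\<Delta> \<le> card (reach k a S ?M - {R})"
  proof (cases "a = b")
    case True
    then show ?thesis using b diff_card_le_card_Diff[of "{R}" "reach k a S ?M"] by simp
  next
    case False
    then have "R \<notin> reach k a S ?M" using R unfolding reach_def by auto
    then show ?thesis using b False by simp
  qed
  ultimately show "\<Delta> \<le> card {X \<in> Fam. \<not> Lb S X \<subseteq> U}" by simp
qed

lemma greedy_extends:
  assumes g: "rooted_state F T c" and v: "v \<in> F" and ch: "choices (T v) (card (N v - F) - 1) \<Delta>"
  shows "extends F T c v"
proof -
  obtain T2 l2 where "assignment F T v (N v - F) T2 l2"
    using greedy[OF g v order.refl empty_subsetI assignment_empty ch] by blast
  then show ?thesis using assignment_extend[OF g v refl] unfolding extends_def by blast
qed

lemma card_avail: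
  "card Fam \<le> card {X \<in> Fam. (\<forall>w\<in>F. E u w \<longrightarrow> X \<noteq> T w) \<and> (\<forall>y\<in>K. E u y \<longrightarrow> X \<noteq> T' y)} +
     card (T ` (N u \<inter> F) \<union> T' ` (N u \<inter> K))" (is "_ \<le> card ?A + card ?B")
proof -
  have "Fam \<subseteq> ?A \<union> ?B" by auto
  moreover have "finite (?A \<union> ?B)" using fin_Fam fin_N by auto
  ultimately have "card Fam \<le> card (?A \<union> ?B)" by (rule card_mono[rotated])
  also have "\<dots> \<le> card ?A + card ?B" by (rule card_Un_le)
  finally show ?thesis .
qed

lemma card_used:
  assumes "K \<inter> F = {}"
  shows "card (T ` (N u \<inter> F) \<union> T' ` (N u \<inter> K)) \<le> \<Delta>"
proof -
  have "card (T ` (N u \<inter> F) \<union> T' ` (N u \<inter> K)) \<le> card (N u \<inter> F) + card (N u \<inter> K)"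
    using card_Un_le[of "T ` (N u \<inter> F)" "T' ` (N u \<inter> K)"] card_image_le[of "N u \<inter> F" T] card_image_le[of "N u \<inter> K" T'] fin_N
    by (meson add_mono finite_Int le_trans)
  also have "\<dots> = card (N u \<inter> F \<union> N u \<inter> K)" using assms fin_N by (intro card_Un_disjoint[symmetric]) auto
  also have "\<dots> \<le> card (N u)" using fin_N by (intro card_mono) auto
  also have "\<dots> \<le> \<Delta>" by (rule deg)
  finally show ?thesis .
qed

lemma rect_single:
  assumes Lb: "Lb = rect" and Fam: "Fam \<subseteq> {X. X \<subseteq> {..<k} \<and> card X = a}"
  shows "\<forall>S\<in>Fam. \<forall>X\<in>Fam. \<forall>Y\<in>Fam. \<forall>q. Lb S X = {q} \<longrightarrow> Lb S Y = {q} \<longrightarrow> X = Y"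
proof (intro ballI allI impI)
  fix S X Y q assume a: "S \<in> Fam" "X \<in> Fam" "Y \<in> Fam" "Lb S X = {q}" "Lb S Y = {q}"
  have f: "finite Z \<and> card Z = a" if "Z \<in> Fam" for Z using that Fam finite_subset[of Z "{..<k}"] by auto
  show "X = Y" using rect_singleton[of S X q] rect_singleton[of S Y q] f a Lb by metis
qed

text \<open>All kids but one are coloured greedily. The last one, \<open>u\<close>, is chosen with a
  second coloured neighbour if any kid has one; then at least 10 sets are available to it, more than
  the at most 7 other kids can block.\<close>

lemma step_degree_9:
  assumes Lb: "Lb = rect" and Fam: "Fam = {X. X \<subseteq> {..<k} \<and> card X = 3 \<and> X \<noteq> R}" and R: "card R = 3"
    and k: "k = 6" "\<Delta> = 9"
    and g: "rooted_state F T c" and v: "v \<in> F" "v \<noteq> r" "N v - F \<noteq> {}"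
  shows "extends F T c v"
proof (rule ccontr)
  assume no: "\<not> extends F T c v"
  let ?K = "N v - F"
  have S: "T v \<in> Fam" by (rule rooted_state_T[OF g v(1,2)])
  have ch: "choices (T v) 6 \<Delta>" by (rule choices_reach[OF Lb Fam R]) (use k S in simp_all)
  obtain u where u: "u \<in> ?K" and ucond: "(\<exists>w\<in>F. E u w \<and> w \<noteq> v) \<or> (\<forall>x\<in>?K. \<forall>w\<in>F. E x w \<longrightarrow> w = v)"
    using v(3) by blast
  have c8: "card ?K \<le> 8" using card_kids[OF g v(1)] k by simp
  have fK: "finite ?K" using fin_N by blast
  have cKu: "card (?K - {u}) \<le> 7" using c8 u fK by simp
  have "choices (T v) (card (?K - {u}) - 1) \<Delta>" by (rule choices_mono[OF ch]) (use cKu in simp)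
  then obtain T' l where p: "assignment F T v (?K - {u}) T' l"
    using greedy[OF g v(1) Diff_subset empty_subsetI assignment_empty] by blast
  have cFam: "19 \<le> card Fam"
  proof -
    have "card {X. X \<subseteq> {..<k} \<and> card X = 3} = 20" using n_subsets[of "{..<k}" 3] k by (simp add: eval_nat_numeral)
    moreover have "{X. X \<subseteq> {..<k} \<and> card X = 3} \<subseteq> insert R Fam" unfolding Fam by auto
    ultimately have "20 \<le> card (insert R Fam)" using card_mono[of "insert R Fam"] fin_Fam by (metis finite_insert)
    then show ?thesis using card_insert_le_m1[of 20 Fam R] fin_Fam by (auto simp: card_insert_if split: if_splits)
  qed
  from ucond show False
  proof
    assume "\<exists>w\<in>F. E u w \<and> w \<noteq> v"
    then obtain w0 where w0: "w0 \<in> F" "E u w0" "w0 \<noteq> v" by blast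
    define A where "A = {X \<in> Fam. (\<forall>w\<in>F. E u w \<longrightarrow> X \<noteq> T w) \<and> (\<forall>y\<in>?K - {u}. E u y \<longrightarrow> X \<noteq> T' y)}"
    have "card Fam \<le> card A + 9" unfolding A_def
      using card_avail[of F u T "?K - {u}" T'] card_used[of "?K - {u}" F T u T'] k by fastforce
    then have cA: "10 \<le> card A" using cFam by simp
    have Fam3: "Fam \<subseteq> {X. X \<subseteq> {..<k} \<and> card X = 3}" using Fam by auto
    have le: "card (?K - {u}) \<le> card A" using cA cKu by simp
    have no': "\<nexists>T2 c2. rooted_state (F \<union> ?K) T2 c2 \<and> (\<forall>x\<in>F. T2 x = T x) \<and> (\<forall>x\<in>F. \<forall>y\<in>F. c2 (x, y) = c (x, y)) \<and>
      (\<forall>x\<in>?K - {u}. (c2 (v, x), c2 (x, v)) = l x \<and>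
        (\<forall>w\<in>F. E x w \<longrightarrow> (c2 (w, x), c2 (x, w)) \<in> Lb (T w) (T' x)))"
      using no unfolding extends_def by blast
    have "card A = card (?K - {u})"
      using last_kid[OF g v(1) refl u p w0 rect_single[OF Lb Fam3] A_def le no'] by blast
    then show False using cA cKu by simp
  next
    \<comment> \<open>Only the other kids can forbid sets for \<open>u\<close>, at most 7 in number,
      whereas the two free labels at \<open>v\<close> give access to at least 8 sets.\<close>
    assume q1: "\<forall>x\<in>?K. \<forall>w\<in>F. E x w \<longrightarrow> w = v"
    have e: "(N u \<inter> F - {v}) \<union> (N u \<inter> (?K - {u})) \<subseteq> ?K - {u}" using q1 u by auto
    have le7: "card ((N u \<inter> F - {v}) \<union> (N u \<inter> (?K - {u}))) \<le> 7"
      using card_mono[OF _ e] fK cKu by (meson finite_Diff le_trans)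
    have ge8: "8 \<le> card {X \<in> Fam. \<not> Lb (T v) X \<subseteq> l ` (?K - {u})}" (is "_ \<le> card ?X")
    proof -
      let ?M = "T v \<times> ({..<k} - T v) - l ` (?K - {u})"
      have S': "T v \<subseteq> {..<k}" "card (T v) = 3" using S Fam by auto
      have "card (T v \<times> ({..<k} - T v)) = 9" using S' k finite_subset[OF S'(1)]
        by (simp add: card_cartesian_product card_Diff_subset)
      moreover have "card (l ` (?K - {u})) \<le> 7" using card_image_le[of "?K - {u}" l] fK cKu by (meson finite_Diff le_trans)
      ultimately have M2: "2 \<le> card ?M" using diff_card_le_card_Diff[of "l ` (?K - {u})" "T v \<times> ({..<k} - T v)"] fK by simp
      have "2 * ((k - 2) choose (3 - 1)) + card ?M - 2 \<le> card (reach k 3 (T v) ?M) + 3"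
        by (rule reach2[OF S']) (use M2 k in auto, simp_all add: eval_nat_numeral)
      moreover have "(k - 2) choose (3 - 1) = 6" using k by (simp add: eval_nat_numeral)
      ultimately have "9 \<le> card (reach k 3 (T v) ?M)" using M2 by linarith
      then have "8 \<le> card (reach k 3 (T v) ?M - {R})" using diff_card_le_card_Diff[of "{R}" "reach k 3 (T v) ?M"] by simp
      also have "\<dots> \<le> card ?X" using fin_Fam Fam Lb by (intro card_mono) (auto simp: reach_def)
      finally show ?thesis .
    qed
    have "(?K - {u}) \<inter> F = {}" by auto
    then obtain X q where "assignment F T v (insert u (?K - {u})) (T'(u := X)) (l(u := q))"
      using greedy_step[OF p, of u] le7 ge8 by fastforce
    moreover have "insert u (?K - {u}) = ?K" using u by auto
    ultimately have "assignment F T v ?K (T'(u := X)) (l(u := q))" by simp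
    then show False using assignment_extend[OF g v(1) refl] no unfolding extends_def by blast
  qed
qed

end

section \<open>Maximum degree 6\<close>

lemma rect_card1:
  assumes "rect S X = {q}"
  shows "\<exists>i j. S - X = {i} \<and> X - S = {j}"
proof -
  have "(S - X) \<times> (X - S) = {q}" using assms unfolding rect_def .
  then have "card ((S - X) \<times> (X - S)) = 1" by simp
  then have "card (S - X) = 1" "card (X - S) = 1" by (simp_all add: card_cartesian_product)
  then show ?thesis by (meson card_1_singletonE)
qed

text \<open>If \<open>S = {x, y}\<close> and \<open>W = {x, z}\<close> shared a colour, their common
  exchanges would be \<open>{y, z}\<close> and \<open>{x, t}\<close> for two colours
  \<open>t\<close>, only three sets. So \<open>S\<close> and \<open>W\<close> are disjoint, and
  \<open>A\<close> consists of all pairs with one colour from each; \<open>e\<close> is the fifth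
  colour.\<close>

lemma common_exchanges:
  assumes A: "\<And>X. X \<in> A \<Longrightarrow> X \<subseteq> {..<5} \<and> card X = 2 \<and> (\<exists>q. rect S X = {q}) \<and> (\<exists>q. rect W X = {q})"
    and S: "S \<subseteq> {..<5}" "card S = 2" "W \<subseteq> {..<5}" "card W = 2" "S \<noteq> W" and cA: "card A = 4"
  shows "\<exists>x y z t e. S = {x, y} \<and> W = {z, t} \<and> x \<noteq> y \<and> {x, y} \<inter> {z, t} = {} \<and> e \<notin> {x, y, z, t} \<and>
    e < (5::nat) \<and> A = {{x, z}, {x, t}, {y, z}, {y, t}}"
proof -
  have m: "\<exists>p q. X = {p, q} \<and> p \<in> S \<and> q \<notin> S \<and> p \<noteq> q \<and> (\<exists>i. S - X = {i}) \<and> (\<exists>i. W - X = {i})" if X: "X \<in> A" for X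
  proof -
    obtain i j i' j' where ij: "S - X = {i}" "X - S = {j}" "W - X = {i'}" "X - W = {j'}"
      using A[OF X] rect_card1 by metis
    have fX: "finite X" "card X = 2" using A[OF X] card.infinite by fastforce+
    have "card (X - {j}) = 1" using ij(2) fX by (subst card_Diff_singleton) auto
    then obtain p where p: "X - {j} = {p}" by (meson card_1_singletonE)
    have "X = {p, j}" using p ij(2) by blast
    moreover have "p \<in> S" "j \<notin> S" "p \<noteq> j" using p ij(2) by blast+
    ultimately show ?thesis using ij by blast
  qed
  have disj: "S \<inter> W = {}"
  proof (rule ccontr)
    assume "S \<inter> W \<noteq> {}"
    then obtain x where x: "x \<in> S" "x \<in> W" by blast
    obtain y where y: "S = {x, y}" "x \<noteq> y" using S(2) x(1) by (auto simp: card_2_iff)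
    obtain z where z: "W = {x, z}" "x \<noteq> z" using S(4) x(2) by (auto simp: card_2_iff)
    have yz: "y \<noteq> z" using y z S(5) by auto
    have "A \<subseteq> insert {y, z} ((\<lambda>t. {x, t}) ` ({..<5} - {x, y, z}))"
    proof
      fix X assume X: "X \<in> A"
      obtain p q where pq: "X = {p, q}" "p \<in> S" "q \<notin> S" "p \<noteq> q" "\<exists>i. S - X = {i}" "\<exists>i. W - X = {i}"
        using m[OF X] by blast
      have q5: "q < 5" using A[OF X] pq(1) by auto
      show "X \<in> insert {y, z} ((\<lambda>t. {x, t}) ` ({..<5} - {x, y, z}))"
      proof (cases "p = x")
        case True
        have "q \<noteq> z" using pq(6) unfolding pq(1) True z(1) using z(2) by auto
        then show ?thesis using pq(1,3) True q5 y(1) by auto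
      next
        case False
        then have "p = y" using pq(2) y(1) by auto
        moreover have "q = z" using pq(6) pq(3) z y yz unfolding pq(1) \<open>p = y\<close> by (auto simp: insert_Diff_if split: if_splits)
        ultimately show ?thesis using pq(1) by auto
      qed
    qed
    then have "card A \<le> card (insert {y, z} ((\<lambda>t. {x, t}) ` ({..<5} - {x, y, z})))" by (rule card_mono[rotated]) auto
    also have "\<dots> \<le> Suc (card ((\<lambda>t. {x, t}) ` ({..<5} - {x, y, z})))" by (simp add: card_insert_if)
    also have "card ((\<lambda>t. {x, t}) ` ({..<5} - {x, y, z})) \<le> card ({..<5} - {x, y, z})" by (rule card_image_le) simp
    also have "card ({..<5} - {x, y, z}) = 2"
    proof -
      have "{x, y, z} \<subseteq> {..<5}" using S y z by auto
      moreover have "card {x, y, z} = 3" using y(2) z(2) yz by simp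
      ultimately show ?thesis by (simp add: card_Diff_subset)
    qed
    finally show False using cA by simp
  qed
  obtain x y where xy: "S = {x, y}" "x \<noteq> y" using S(2) by (auto simp: card_2_iff)
  obtain z t where zt: "W = {z, t}" "z \<noteq> t" using S(4) by (auto simp: card_2_iff)
  have "card (S \<union> W) = 4" using disj S finite_subset[OF S(1)] finite_subset[OF S(3)] by (simp add: card_Un_disjoint)
  then have "\<not> {..<5} \<subseteq> S \<union> W" using card_mono[of "S \<union> W" "{..<5::nat}"] by (auto simp: xy zt)
  then obtain e where e: "e < 5" "e \<notin> S \<union> W" by auto
  have "A \<subseteq> {{x, z}, {x, t}, {y, z}, {y, t}}"
  proof
    fix X assume X: "X \<in> A"
    obtain p q where pq: "X = {p, q}" "p \<in> S" "q \<notin> S" "p \<noteq> q" "\<exists>i. W - X = {i}"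
      using m[OF X] by blast
    have "p \<notin> W" using pq(2) disj by auto
    then have "q \<in> W" using pq(5) zt unfolding pq(1) by (auto simp: insert_Diff_if split: if_splits)
    then show "X \<in> {{x, z}, {x, t}, {y, z}, {y, t}}" using pq(1,2) xy zt by auto
  qed
  moreover have "card {{x, z}, {x, t}, {y, z}, {y, t}} \<le> 4"
    using card_length[of "[{x, z}, {x, t}, {y, z}, {y, t}]"] by simp
  ultimately have "A = {{x, z}, {x, t}, {y, z}, {y, t}}" using cA by (intro card_seteq) auto
  then show ?thesis using xy zt e disj by blast
qed

context arc_ext
begin

text \<open>If the last kid \<open>u\<close> has a second coloured neighbour and fails, all counts
  are tight: its four twins block the four available pairs, and the other six pairs all occur next
  to \<open>u\<close>. A pair containing the fifth colour then gives a contradiction.\<close>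

lemma step_degree_6:
  assumes Lb: "Lb = rect" and Fam: "Fam = {X. X \<subseteq> {..<k} \<and> card X = 2 \<and> X \<noteq> R}" and R: "card R = 3"
    and k: "k = 5" "\<Delta> = 6"
    and g: "rooted_state F T c" and v: "v \<in> F" "v \<noteq> r" "N v - F \<noteq> {}"
  shows "extends F T c v"
proof (rule ccontr)
  assume no: "\<not> extends F T c v"
  let ?K = "N v - F"
  have Fam2: "Fam = {X. X \<subseteq> {..<5} \<and> card X = 2}" using Fam R k by auto
  have S: "T v \<in> Fam" by (rule rooted_state_T[OF g v(1,2)])
  then have S': "T v \<subseteq> {..<k}" "card (T v) = 2" using Fam by auto
  have ch: "choices (T v) 3 \<Delta>" by (rule choices_reach[OF Lb Fam R]) (use k S in simp_all)
  obtain u where u: "u \<in> ?K" and ucond: "(\<exists>w\<in>F. E u w \<and> w \<noteq> v) \<or> (\<forall>x\<in>?K. \<forall>w\<in>F. E x w \<longrightarrow> w = v)"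
    using v(3) by blast
  have c5: "card ?K \<le> 5" using card_kids[OF g v(1)] k by simp
  have fK: "finite ?K" using fin_N by blast
  have cKu: "card (?K - {u}) \<le> 4" using c5 u fK by simp
  have "choices (T v) (card (?K - {u}) - 1) \<Delta>" by (rule choices_mono[OF ch]) (use cKu in simp)
  then obtain T' l where p: "assignment F T v (?K - {u}) T' l"
    using greedy[OF g v(1) Diff_subset empty_subsetI assignment_empty] by blast
  have cFam: "card Fam = 10"
    using n_subsets[of "{..<5::nat}" 2] unfolding Fam2 by (simp add: eval_nat_numeral)
  from ucond show False
  proof
    assume "\<exists>w\<in>F. E u w \<and> w \<noteq> v"
    then obtain w0 where w0: "w0 \<in> F" "E u w0" "w0 \<noteq> v" by blast
    define A where "A = {X \<in> Fam. (\<forall>w\<in>F. E u w \<longrightarrow> X \<noteq> T w) \<and> (\<forall>y\<in>?K - {u}. E u y \<longrightarrow> X \<noteq> T' y)}"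
    let ?B = "T ` (N u \<inter> F) \<union> T' ` (N u \<inter> (?K - {u}))"
    have av: "card Fam \<le> card A + card ?B" unfolding A_def by (rule card_avail)
    have us: "card ?B \<le> 6" using card_used[of "?K - {u}" F T u T'] k by fastforce
    have le: "card (?K - {u}) \<le> card A" using av us cFam cKu by simp
    have no': "\<nexists>T2 c2. rooted_state (F \<union> ?K) T2 c2 \<and> (\<forall>x\<in>F. T2 x = T x) \<and> (\<forall>x\<in>F. \<forall>y\<in>F. c2 (x, y) = c (x, y)) \<and>
      (\<forall>x\<in>?K - {u}. (c2 (v, x), c2 (x, v)) = l x \<and>
        (\<forall>w\<in>F. E x w \<longrightarrow> (c2 (w, x), c2 (x, w)) \<in> Lb (T w) (T' x)))"
      using no unfolding extends_def by blast
    have Fs: "Fam \<subseteq> {X. X \<subseteq> {..<k} \<and> card X = 2}" using Fam by auto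
    from last_kid[OF g v(1) refl u p w0 rect_single[OF Lb Fs] A_def le no'] obtain \<phi> where
      cA: "card A = card (?K - {u})" and bij: "bij_betw \<phi> A (?K - {u})" and
      ph: "\<And>X. X \<in> A \<Longrightarrow> rect (T v) X = {l (\<phi> X)}"
         "\<And>X w. X \<in> A \<Longrightarrow> w \<in> F \<Longrightarrow> E u w \<Longrightarrow> w \<noteq> v \<Longrightarrow> \<exists>q. rect (T w) X = {q}"
      unfolding Lb by blast
    have cA4: "card A = 4" and cB: "card ?B = 6" using cA av us cFam cKu by linarith+
    have uv: "E u v" using u E_sym by auto
    have TF: "T w \<in> Fam" if "w \<in> F" "E u w" for w using rooted_state_Fam[OF g that] u by blast
    \<comment> \<open>Equal sets at \<open>v\<close> and \<open>w0\<close> would leave at most five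
      used pairs, but there are six.\<close>
    have "T v \<noteq> T w0"
    proof
      assume eq: "T v = T w0"
      have "T ` (N u \<inter> F) = T ` (N u \<inter> F - {v})" using eq w0 by (auto simp: image_iff)
      then have "card ?B \<le> card (T ` (N u \<inter> F - {v})) + card (T' ` (N u \<inter> (?K - {u})))" by (simp add: card_Un_le)
      also have "\<dots> \<le> card (N u \<inter> F - {v}) + card (N u \<inter> (?K - {u}))"
        using fin_N by (intro add_mono card_image_le) auto
      also have "\<dots> = card ((N u \<inter> F - {v}) \<union> (N u \<inter> (?K - {u})))"
        using fin_N by (intro card_Un_disjoint[symmetric]) auto
      also have "\<dots> \<le> card (N u - {v})" using fin_N v(1) by (intro card_mono) auto
      also have "\<dots> < card (N u)" using fin_N uv by (intro psubset_card_mono) auto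
      finally show False using cB deg[of u] k by simp
    qed
    moreover have "X \<subseteq> {..<5} \<and> card X = 2 \<and> (\<exists>q. rect (T v) X = {q}) \<and> (\<exists>q. rect (T w0) X = {q})" if "X \<in> A" for X
    proof -
      have "X \<in> Fam" using that unfolding A_def by simp
      then show ?thesis using ph(1)[OF that] ph(2)[OF that w0] unfolding Fam2 by blast
    qed
    moreover have "T v \<subseteq> {..<5}" "card (T v) = 2" "T w0 \<subseteq> {..<5}" "card (T w0) = 2"
      using S TF[OF w0(1,2)] unfolding Fam2 by auto
    ultimately obtain x y z t e where xyz: "T v = {x, y}" "T w0 = {z, t}" "x \<noteq> y" "{x, y} \<inter> {z, t} = {}"
       "e \<notin> {x, y, z, t}" "e < 5" "A = {{x, z}, {x, t}, {y, z}, {y, t}}"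
      using common_exchanges[of A "T v" "T w0"] cA4 by blast
    \<comment> \<open>Not being available, \<open>{e, x}\<close> is the set of a neighbour of
      \<open>u\<close>. A neighbour in \<open>F\<close> is impossible, since \<open>{e, x}\<close>
      is disjoint from \<open>{y, z}\<close> and not related to it by an exchange. A kid
      \<open>y0\<close> would have a label with \<open>e\<close> at \<open>v\<close>, but the set it
      blocks avoids \<open>e\<close>.\<close>
    have ex: "{e, x} \<in> Fam" "{e, x} \<notin> A"
      using xyz S unfolding Fam2 by (auto simp: doubleton_eq_iff)
    then consider w where "w \<in> F" "E u w" "T w = {e, x}" | y0 where "y0 \<in> ?K - {u}" "T' y0 = {e, x}"
      unfolding A_def by blast
    then show False
    proof cases
      case 1
      have "w \<noteq> v" using 1(3) xyz(1,5) by auto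
      then obtain q where "rect {e, x} {y, z} = {q}" using ph(2)[of "{y, z}" w] 1 xyz(7) by auto
      from rect_card1[OF this] obtain i where "{e, x} - {y, z} = {i}" by blast
      moreover have "{e, x} - {y, z} = {e, x}" using xyz(3-5) by auto
      ultimately show False using xyz(5) by (auto simp: doubleton_eq_iff)
    next
      case 2
      obtain X where X: "X \<in> A" "\<phi> X = y0" using bij_betw_imp_surj_on[OF bij] 2(1) by (metis imageE)
      have "l y0 \<in> Lb (T v) (T' y0)" using p 2(1) unfolding assignment_def by blast
      then have "l y0 \<in> rect {x, y} {e, x}" by (simp only: Lb 2(2) xyz(1))
      then have "snd (l y0) = e" using xyz(3,5) unfolding rect_def by auto
      moreover have "l y0 \<in> rect (T v) X" using ph(1)[OF X(1)] X(2) by simp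
      ultimately have "e \<in> X" unfolding rect_def by auto
      then show False using X(1) xyz(5,7) by auto
    qed
  next
    assume q1: "\<forall>x\<in>?K. \<forall>w\<in>F. E x w \<longrightarrow> w = v"
    \<comment> \<open>The kids get distinct labels with the corresponding exchanges as sets. These
      sets are distinct too, and \<open>v\<close> is the only coloured neighbour of every
      kid.\<close>
    let ?G = "T v \<times> ({..<k} - T v)"
    have "card ?G = 6" using S' k finite_subset[OF S'(1)] by (simp add: card_cartesian_product card_Diff_subset)
    moreover have "finite ?G" using finite_subset[OF S'(1)] by simp
    ultimately obtain l where l: "l ` ?K \<subseteq> ?G" "inj_on l ?K"
      using card_le_inj[OF fK, of ?G] c5 by auto
    define T' where "T' x = exchange (T v) (l x)" for x
    have lx: "fst (l x) \<in> T v" "snd (l x) \<notin> T v" "snd (l x) < k" if "x \<in> ?K" for x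
      using l(1) that by (auto simp: image_subset_iff mem_Times_iff)
    have r: "rect (T v) (T' x) = {l x}" if "x \<in> ?K" for x unfolding T'_def using lx[OF that] by (intro rect_exchange) auto
    have "assignment F T v ?K T' l"
      unfolding assignment_def proper_sets_def
    proof (intro conjI ballI impI)
      show "inj_on l ?K" by (rule l(2))
      fix x assume x: "x \<in> ?K"
      have "card (T' x) = 2" unfolding T'_def
        using card_exchange[of "T v" "l x"] lx[OF x] S' finite_subset[OF S'(1)] by simp
      moreover have "T' x \<subseteq> {..<5}" unfolding T'_def exchange_def using lx[OF x] S' k by auto
      ultimately show "T' x \<in> Fam" unfolding Fam2 by auto
      show "T' x \<noteq> T w" if "w \<in> F" "E x w" for w
      proof -
        have "w = v" using q1 x that by blast
        moreover have "rect (T v) (T v) = {}" by (simp add: rect_def)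
        ultimately show ?thesis using r[OF x] by force
      qed
      show "T' x \<noteq> T' y" if "y \<in> ?K" "E x y" for y
        using r[OF x] r[OF that(1)] l(2) x that E_irrefl unfolding inj_on_def by (metis singleton_inject)
      show "l x \<in> Lb (T v) (T' x)" using r[OF x] Lb by simp
    qed
    then show False using assignment_extend[OF g v(1) refl] no unfolding extends_def by blast
  qed
qed

end

section \<open>Maximum degree 4\<close>

definition Pairs4 :: "nat set set" where
  "Pairs4 = {X. X \<subseteq> {..<4} \<and> card X = 2}"

text \<open>The clause with \<open>(2, 0)\<close> is the reserved label seen from the other end of
  the edge; it keeps \<open>Lb4\<close> symmetric.\<close>

definition Lb4 :: "nat set \<Rightarrow> nat set \<Rightarrow> (nat \<times> nat) set" where
  "Lb4 S X = rect S X - (if S = {0, 1} \<and> X = {2, 3} then {(0, 2)}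
     else if S = {2, 3} \<and> X = {0, 1} then {(2, 0)} else {})"

lemma Pairs4_D: "X \<in> Pairs4 \<Longrightarrow> X \<subseteq> {..<4} \<and> card X = 2 \<and> finite X"
  unfolding Pairs4_def by (auto intro: finite_subset)

lemma Pairs4_compl:
  assumes "X \<in> Pairs4"
  shows "{..<4} - X \<in> Pairs4"
proof -
  have "card ({..<4} - X) = 2" using Pairs4_D[OF assms] by (simp add: card_Diff_subset)
  then show ?thesis unfolding Pairs4_def by blast
qed

lemma Pairs4_disjoint:
  assumes "X \<in> Pairs4" "S \<in> Pairs4" "S \<inter> X = {}"
  shows "X = {..<4} - S"
proof (rule card_subset_eq)
  show "X \<subseteq> {..<4} - S" using assms Pairs4_D[of X] by auto
  show "card X = card ({..<4} - S)" using Pairs4_D[OF assms(1)] Pairs4_D[OF Pairs4_compl[OF assms(2)]] by simp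
qed simp

lemma Pairs4_obtain:
  assumes "X \<in> Pairs4" "i \<in> X"
  shows "\<exists>j. X = {i, j} \<and> j \<noteq> i \<and> j < 4"
proof -
  obtain x y where xy: "X = {x, y}" "x \<noteq> y" using Pairs4_D[OF assms(1)] by (meson card_2_iff)
  have "x < 4" "y < 4" using Pairs4_D[OF assms(1)] xy by auto
  then show ?thesis using xy assms(2) by (cases "i = x") (auto simp: insert_commute)
qed

lemma card_Pairs4: "card Pairs4 = 6" and finite_Pairs4: "finite Pairs4"
  using n_subsets[of "{..<4::nat}" 2] unfolding Pairs4_def by (simp_all add: eval_nat_numeral)

text \<open>Two different pairs out of four colours share one colour, which leaves a
  \<open>1 \<times> 1\<close> rectangle, or are complementary with four labels, at most one of them
  reserved.\<close>

lemma Lb4_cases: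
  assumes "S \<in> Pairs4" "X \<in> Pairs4" "S \<noteq> X"
  shows "S \<inter> X \<noteq> {} \<and> (\<exists>q. Lb4 S X = {q}) \<and> Lb4 S X = rect S X \<or> S \<inter> X = {} \<and> 3 \<le> card (Lb4 S X)"
proof (cases "S \<inter> X = {}")
  case True
  have "S - X = S" "X - S = X" using True by auto
  then have r: "card (rect S X) = 4" "finite (rect S X)"
    using Pairs4_D[OF assms(1)] Pairs4_D[OF assms(2)] unfolding rect_def by (simp_all add: card_cartesian_product)
  define D :: "(nat \<times> nat) set" where "D = (if S = {0, 1} \<and> X = {2, 3} then {(0, 2)}
     else if S = {2, 3} \<and> X = {0, 1} then {(2, 0)} else {})"
  have "card D \<le> 1" "finite D" unfolding D_def by simp_all
  moreover have "Lb4 S X = rect S X - D" unfolding Lb4_def D_def ..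
  ultimately have "3 \<le> card (Lb4 S X)" using diff_card_le_card_Diff[of D "rect S X"] r(1) by simp
  then show ?thesis using True by blast
next
  case False
  have f: "finite S" "finite X" "card S = 2" "card X = 2" using Pairs4_D[OF assms(1)] Pairs4_D[OF assms(2)] by simp_all
  have "\<not> (S = {0, 1} \<and> X = {2, 3})" "\<not> (S = {2, 3} \<and> X = {0, 1})" using False by auto
  then have e: "Lb4 S X = rect S X" unfolding Lb4_def by (simp only: if_False Diff_empty)
  have "card (S \<inter> X) = 1"
  proof -
    have "card (S \<inter> X) \<noteq> 0" using False f by simp
    moreover have "card (S \<inter> X) < card S"
      using f assms(3) card_subset_eq[of X S] by (intro psubset_card_mono) auto
    ultimately show ?thesis using f(3) by linarith
  qed
  then have "card (S - X) = 1" "card (X - S) = 1"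
    using card_Diff_subset_Int[of S X] card_Diff_subset_Int[of X S] f by (simp_all add: Int_commute)
  then have "card (rect S X) = 1" unfolding rect_def by (simp add: card_cartesian_product)
  then show ?thesis using e False by (metis card_1_singletonE)
qed

lemma Lb4_single: "\<forall>S\<in>Pairs4. \<forall>X\<in>Pairs4. \<forall>Y\<in>Pairs4. \<forall>q. Lb4 S X = {q} \<longrightarrow> Lb4 S Y = {q} \<longrightarrow> X = Y"
proof (intro ballI allI impI)
  fix S X Y q assume a: "S \<in> Pairs4" "X \<in> Pairs4" "Y \<in> Pairs4" "Lb4 S X = {q}" "Lb4 S Y = {q}"
  have r: "Z = exchange S q" if "Z \<in> Pairs4" "Lb4 S Z = {q}" for Z
  proof -
    have "S \<noteq> Z" using that(2) unfolding Lb4_def rect_def by auto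
    then have "rect S Z = {q}" using Lb4_cases[OF a(1) that(1)] that(2) by auto
    then show ?thesis using rect_singleton[of S Z q] Pairs4_D[OF a(1)] Pairs4_D[OF that(1)] by simp
  qed
  show "X = Y" using r[OF a(2,4)] r[OF a(3,5)] by simp
qed

text \<open>With at most two labels in use, a pair other than \<open>S\<close> is lost only if it
  offers a single label and this one is used. As the label determines the pair, each label in
  \<open>U\<close> costs at most one of the five pairs.\<close>

lemma Lb4_choices:
  assumes S: "S \<in> Pairs4" and U: "finite U" "card U \<le> 2"
  shows "5 \<le> card {X \<in> Pairs4. \<not> Lb4 S X \<subseteq> U} + card U"
proof -
  let ?B = "{X \<in> Pairs4 - {S}. Lb4 S X \<subseteq> U}"
  have sing: "\<exists>q\<in>U. Lb4 S X = {q}" if "X \<in> ?B" for X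
  proof -
    have "card (Lb4 S X) \<le> 2" using card_mono[OF U(1), of "Lb4 S X"] that U(2) by simp
    then show ?thesis using Lb4_cases[of S X] S that by fastforce
  qed
  define g where "g X = the_elem (Lb4 S X)" for X
  have g: "Lb4 S X = {g X}" "g X \<in> U" if X: "X \<in> ?B" for X
  proof -
    obtain q where "q \<in> U" "Lb4 S X = {q}" using sing[OF X] by blast
    then show "Lb4 S X = {g X}" "g X \<in> U" by (simp_all add: g_def)
  qed
  have "inj_on g ?B"
  proof (rule inj_onI)
    fix X Y assume XY: "X \<in> ?B" "Y \<in> ?B" "g X = g Y"
    have "Lb4 S X = {g X}" "Lb4 S Y = {g X}" using g(1)[OF XY(1)] g(1)[OF XY(2)] XY(3) by simp_all
    moreover have "X \<in> Pairs4" "Y \<in> Pairs4" using XY by simp_all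
    ultimately show "X = Y" using Lb4_single S by blast
  qed
  moreover have "g ` ?B \<subseteq> U" using g(2) by blast
  ultimately have "card ?B \<le> card U" by (rule card_inj_on_le[OF _ _ U(1)])
  moreover have "card (Pairs4 - {S}) \<le> card {X \<in> Pairs4. \<not> Lb4 S X \<subseteq> U} + card ?B"
  proof -
    have "Pairs4 - {S} \<subseteq> {X \<in> Pairs4. \<not> Lb4 S X \<subseteq> U} \<union> ?B" by auto
    then have "card (Pairs4 - {S}) \<le> card ({X \<in> Pairs4. \<not> Lb4 S X \<subseteq> U} \<union> ?B)"
      using finite_Pairs4 by (intro card_mono) auto
    then show ?thesis using card_Un_le le_trans by blast
  qed
  ultimately show ?thesis using S card_Pairs4 by simp
qed

context arc_ext
begin

text \<open>The number of used sets is at most the number of neighbours of \<open>u\<close> in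
  \<open>F\<close> and \<open>K\<close>, hence at most \<open>card (N u)\<close> and
  \<open>\<Delta>\<close>. The hypothesis turns all these inequalities into equalities.\<close>

lemma used_inj:
  assumes K: "K \<inter> F = {}" and B: "\<Delta> \<le> card (T ` (N u \<inter> F) \<union> T' ` (N u \<inter> K))"
  shows "inj_on T (N u \<inter> F) \<and> card (N u) = \<Delta> \<and> N u \<subseteq> F \<union> K"
proof -
  let ?D = "N u \<inter> (F \<union> K)"
  define h where "h x = (if x \<in> F then T x else T' x)" for x
  have "h y = T' y" if "y \<in> N u \<inter> K" for y using that K unfolding h_def by auto
  then have "h ` ?D = T ` (N u \<inter> F) \<union> T' ` (N u \<inter> K)"
    unfolding Int_Un_distrib image_Un by (intro arg_cong2[where f = "(\<union>)"] image_cong) (auto simp: h_def)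
  then have 1: "\<Delta> \<le> card (h ` ?D)" using B by simp
  have fD: "finite ?D" using fin_N by auto
  have 2: "card (h ` ?D) \<le> card ?D" by (rule card_image_le[OF fD])
  have 3: "card ?D \<le> card (N u)" using fin_N by (intro card_mono) auto
  have "card (h ` ?D) = card ?D" using 1 2 3 deg[of u] by linarith
  then have "inj_on h ?D" using fD by (simp add: eq_card_imp_inj_on)
  then have "inj_on h (N u \<inter> F)" by (rule inj_on_subset) auto
  then have "inj_on T (N u \<inter> F)" unfolding inj_on_def h_def by auto
  moreover have "card ?D = card (N u)" "card (N u) = \<Delta>" using 1 2 3 deg[of u] by linarith+
  moreover have "?D = N u" using card_subset_eq[OF fin_N, of ?D u] \<open>card ?D = card (N u)\<close> by blast
  ultimately show ?thesis by blast
qed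

text \<open>The only configuration in which three kids cannot be coloured.\<close>

definition block :: "'a set \<Rightarrow> ('a \<Rightarrow> nat set) \<Rightarrow> 'a \<Rightarrow> 'a \<Rightarrow> bool" where
  "block F T v u \<longleftrightarrow> N u \<subseteq> F \<and> card (N u) = 4 \<and> inj_on T (N u) \<and> u \<in> N v - F \<and>
     (\<forall>x\<in>N v - F. N x = N u) \<and> card (N v - F) = 3 \<and>
     (\<exists>C\<in>Pairs4. T ` N u = Pairs4 - {C, {..<4} - C})"

lemma block_D:
  assumes "block F T v u"
  shows "N u \<subseteq> F" "card (N u) = 4" "inj_on T (N u)" "u \<in> N v - F" "\<forall>x\<in>N v - F. N x = N u" "card (N v - F) = 3"
    "\<exists>C\<in>Pairs4. T ` N u = Pairs4 - {C, {..<4} - C}"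
proof -
  note b = assms[unfolded block_def]
  note b1 = b[THEN conjunct2] note b2 = b1[THEN conjunct2] note b3 = b2[THEN conjunct2]
  note b4 = b3[THEN conjunct2] note b5 = b4[THEN conjunct2]
  show "N u \<subseteq> F" "card (N u) = 4" "inj_on T (N u)" "u \<in> N v - F" "\<forall>x\<in>N v - F. N x = N u" "card (N v - F) = 3"
    "\<exists>C\<in>Pairs4. T ` N u = Pairs4 - {C, {..<4} - C}"
    by (rule b[THEN conjunct1] b1[THEN conjunct1] b2[THEN conjunct1] b3[THEN conjunct1] b4[THEN conjunct1]
      b5[THEN conjunct1] b5[THEN conjunct2])+
qed

text \<open>\<open>K0\<close> consists of kids with prescribed sets and labels, as needed for the
  root edge. If \<open>last_kid\<close> finds the last kid \<open>u\<close> stuck, the six pairs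
  split into exactly two available and four used ones, and this tight count forces a block.\<close>

lemma kids_degree_4:
  assumes Lb: "Lb = Lb4" and Fam: "Fam = Pairs4" and \<Delta>: "\<Delta> = 4"
    and g: "rooted_state F T c" and v: "v \<in> F" and Tv: "T v \<in> Fam" and K0: "K0 \<subseteq> N v - F" and p0: "assignment F T v K0 T0 l0"
  shows "(\<exists>T2 c2. rooted_state (F \<union> (N v - F)) T2 c2 \<and> (\<forall>x\<in>F. T2 x = T x) \<and> (\<forall>x\<in>F. \<forall>y\<in>F. c2 (x, y) = c (x, y)) \<and>
      (\<forall>x\<in>K0. (c2 (v, x), c2 (x, v)) = l0 x \<and>
        (\<forall>w\<in>F. E x w \<longrightarrow> (c2 (w, x), c2 (x, w)) \<in> Lb (T w) (T0 x)))) \<or> (\<exists>u. block F T v u)"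
    (is "?strong \<or> _")
proof (rule disjCI)
  assume nb: "\<not> (\<exists>u. block F T v u)"
  let ?K = "N v - F"
  show ?strong
  proof (cases "K0 = ?K")
    case True
    from assignment_extend[OF g v True p0] True obtain T2 c2 where
      "rooted_state (F \<union> ?K) T2 c2" "\<forall>x\<in>F. T2 x = T x" "\<forall>x\<in>F. \<forall>y\<in>F. c2 (x, y) = c (x, y)"
      "\<forall>x\<in>K0. (c2 (v, x), c2 (x, v)) = l0 x"
      "\<forall>x\<in>K0. \<forall>w\<in>F. E x w \<longrightarrow> (c2 (w, x), c2 (x, w)) \<in> Lb (T w) (T0 x)" by metis
    then show ?thesis by blast
  next
    case False
    then obtain u where u: "u \<in> ?K" "u \<notin> K0" using K0 by blast
    have fK: "finite ?K" using fin_N by blast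
    have c3: "card ?K \<le> 3" using card_kids[OF g v] \<Delta> by simp
    then have c2: "card (?K - {u}) \<le> 2" using u fK by simp
    have ch: "choices (T v) 1 \<Delta>"
      unfolding choices_def using Lb4_choices[of "T v"] Tv Fam Lb \<Delta> by fastforce
    have "choices (T v) (card (?K - {u}) - 1) \<Delta>" by (rule choices_mono[OF ch]) (use c2 in simp)
    moreover have "K0 \<subseteq> ?K - {u}" using K0 u by auto
    ultimately obtain T' l where p: "assignment F T v (?K - {u}) T' l" and ag: "\<forall>x\<in>K0. T' x = T0 x \<and> l x = l0 x"
      using greedy[OF g v Diff_subset _ p0] by blast
    have K0u: "K0 \<subseteq> ?K - {u}" using K0 u by auto
    have lift: ?strong if "\<exists>T2 c2. rooted_state (F \<union> ?K) T2 c2 \<and> (\<forall>x\<in>F. T2 x = T x) \<and> (\<forall>x\<in>F. \<forall>y\<in>F. c2 (x, y) = c (x, y)) \<and>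
      (\<forall>x\<in>?K - {u}. (c2 (v, x), c2 (x, v)) = l x \<and>
        (\<forall>w\<in>F. E x w \<longrightarrow> (c2 (w, x), c2 (x, w)) \<in> Lb (T w) (T' x)))"
    proof -
      from that obtain T2 c2 where e: "rooted_state (F \<union> ?K) T2 c2" "\<forall>x\<in>F. T2 x = T x" "\<forall>x\<in>F. \<forall>y\<in>F. c2 (x, y) = c (x, y)"
        "\<forall>x\<in>?K - {u}. (c2 (v, x), c2 (x, v)) = l x \<and>
          (\<forall>w\<in>F. E x w \<longrightarrow> (c2 (w, x), c2 (x, w)) \<in> Lb (T w) (T' x))" by blast
      have "(c2 (v, x), c2 (x, v)) = l0 x \<and> (\<forall>w\<in>F. E x w \<longrightarrow> (c2 (w, x), c2 (x, w)) \<in> Lb (T w) (T0 x))" if x: "x \<in> K0" for x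
      proof -
        have "x \<in> ?K - {u}" using x K0u by blast
        moreover have "T' x = T0 x" "l x = l0 x" using ag x by auto
        ultimately show ?thesis using e(4) by metis
      qed
      then show ?thesis using e(1-3) by blast
    qed
    show ?thesis
    proof (cases "\<exists>w\<in>F. E u w \<and> w \<noteq> v")
      \<comment> \<open>Only the other kids, at most two, can forbid pairs for \<open>u\<close>, and
        at least three pairs offer a free label.\<close>
      case False
      have sub: "(N u \<inter> F - {v}) \<union> (N u \<inter> (?K - {u})) \<subseteq> ?K - {u}" using False by auto
      have "card ((N u \<inter> F - {v}) \<union> (N u \<inter> (?K - {u}))) \<le> 2"
        using card_mono[OF _ sub] fK c2 by (meson finite_Diff le_trans)
      moreover have "3 \<le> card {X \<in> Fam. \<not> Lb (T v) X \<subseteq> l ` (?K - {u})}"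
      proof -
        have "card (l ` (?K - {u})) \<le> 2" using card_image_le[of "?K - {u}" l] fK c2 by (meson finite_Diff le_trans)
        then show ?thesis using Lb4_choices[of "T v" "l ` (?K - {u})"] Tv Fam Lb fK by simp
      qed
      moreover have "(?K - {u}) \<inter> F = {}" by auto
      ultimately obtain X q where "assignment F T v (insert u (?K - {u})) (T'(u := X)) (l(u := q))"
        using greedy_step[OF p, of u] by fastforce
      moreover have "insert u (?K - {u}) = ?K" using u by auto
      ultimately have pK: "assignment F T v ?K (T'(u := X)) (l(u := q))" by simp
      from assignment_extend[OF g v refl pK] obtain T2 c2 where e: "rooted_state (F \<union> ?K) T2 c2" "\<forall>x\<in>F. T2 x = T x" "\<forall>x\<in>F. \<forall>y\<in>F. c2 (x, y) = c (x, y)"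
        "\<forall>x\<in>?K. (c2 (v, x), c2 (x, v)) = (l(u := q)) x"
        "\<forall>x\<in>?K. \<forall>w\<in>F. E x w \<longrightarrow> (c2 (w, x), c2 (x, w)) \<in> Lb (T w) ((T'(u := X)) x)" by blast
      have "(c2 (v, x), c2 (x, v)) = l x" "\<forall>w\<in>F. E x w \<longrightarrow> (c2 (w, x), c2 (x, w)) \<in> Lb (T w) (T' x)"
        if x: "x \<in> ?K - {u}" for x
      proof -
        have xK: "x \<in> ?K" and xu: "x \<noteq> u" using x by auto
        show "(c2 (v, x), c2 (x, v)) = l x" using bspec[OF e(4) xK] xu by simp
        show "\<forall>w\<in>F. E x w \<longrightarrow> (c2 (w, x), c2 (x, w)) \<in> Lb (T w) (T' x)" using bspec[OF e(5) xK] xu by simp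
      qed
      then show ?thesis using e(1-3) by (intro lift) blast
    next
      case True
      then obtain w0 where w0: "w0 \<in> F" "E u w0" "w0 \<noteq> v" by blast
      define A where "A = {X \<in> Fam. (\<forall>w\<in>F. E u w \<longrightarrow> X \<noteq> T w) \<and> (\<forall>y\<in>?K - {u}. E u y \<longrightarrow> X \<noteq> T' y)}"
      let ?B = "T ` (N u \<inter> F) \<union> T' ` (N u \<inter> (?K - {u}))"
      have dj: "(?K - {u}) \<inter> F = {}" by auto
      have av: "6 \<le> card A + card ?B" using card_avail[of F u T "?K - {u}" T'] card_Pairs4 Fam unfolding A_def by simp
      have us: "card ?B \<le> 4" using card_used[OF dj] \<Delta> by blast
      have le: "card (?K - {u}) \<le> card A" using av us c2 by simp
      show ?thesis
      proof (rule ccontr)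
        assume "\<not> ?strong"
        then have no': "\<nexists>T2 c2. rooted_state (F \<union> ?K) T2 c2 \<and> (\<forall>x\<in>F. T2 x = T x) \<and> (\<forall>x\<in>F. \<forall>y\<in>F. c2 (x, y) = c (x, y)) \<and>
          (\<forall>x\<in>?K - {u}. (c2 (v, x), c2 (x, v)) = l x \<and>
          (\<forall>w\<in>F. E x w \<longrightarrow> (c2 (w, x), c2 (x, w)) \<in> Lb (T w) (T' x)))" using lift by blast
        have single: "\<forall>S\<in>Fam. \<forall>X\<in>Fam. \<forall>Y\<in>Fam. \<forall>q. Lb S X = {q} \<longrightarrow> Lb S Y = {q} \<longrightarrow> X = Y"
          using Lb4_single Lb Fam by simp
        from last_kid[OF g v refl u(1) p w0 single A_def le no'] obtain \<phi> where
          cA: "card A = card (?K - {u})" and bij: "bij_betw \<phi> A (?K - {u})" and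
          tw: "\<And>X w. X \<in> A \<Longrightarrow> w \<in> F \<Longrightarrow> E (\<phi> X) w \<longleftrightarrow> E u w" and
          phv: "\<And>X. X \<in> A \<Longrightarrow> Lb (T v) X = {l (\<phi> X)}" and
          phw: "\<And>X w. X \<in> A \<Longrightarrow> w \<in> F \<Longrightarrow> E u w \<Longrightarrow> w \<noteq> v \<Longrightarrow> \<exists>q. Lb (T w) X = {q} \<and> q \<in> Lb (T w) (T' (\<phi> X))"
          by blast
        have cA2: "card A = 2" and cB: "4 \<le> card ?B" and cK: "card (?K - {u}) = 2" using cA av us c2 by linarith+
        have uv: "E u v" using u E_sym by auto
        have TF: "T w \<in> Pairs4" if "w \<in> F" "E u w" for w using rooted_state_Fam[OF g that] u Fam by blast
        have injT: "inj_on T (N u \<inter> F)" and c4: "card (N u) = 4" and Nsub: "N u \<subseteq> F \<union> (?K - {u})"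
          using used_inj[OF dj] cB \<Delta> by blast+
        have Tne: "T v \<noteq> T w0" using injT w0 uv v unfolding inj_on_def by auto
        have AF: "X \<in> Pairs4" if "X \<in> A" for X using that Fam unfolding A_def by blast
        have surj: "\<exists>X\<in>A. y = \<phi> X" if "y \<in> ?K - {u}" for y
          using bij_betw_imp_surj_on[OF bij] that by (metis imageE)
        \<comment> \<open>The set of an adjacent twin \<open>y\<close> differs from the set
          \<open>X\<close> that \<open>y\<close> blocks, yet offers the single label of
          \<open>X\<close> at both \<open>v\<close> and \<open>w0\<close>. It is therefore the
          complement of both \<open>T v\<close> and \<open>T w0\<close>, which differ.\<close>
        have noadj: "\<not> E u y" if y: "y \<in> ?K - {u}" for y
        proof
          assume uy: "E u y"
          obtain X where X: "X \<in> A" "y = \<phi> X" using surj[OF y] by blast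
          have XT: "X \<noteq> T' y" using X(1) y uy unfolding A_def by blast
          have T'F: "T' y \<in> Pairs4" using p y Fam unfolding assignment_def proper_sets_def by blast
          have cmp: "T' y = {..<4} - T w" if w: "w \<in> F" "E u w" "Lb4 (T w) X = {q}" "q \<in> Lb4 (T w) (T' y)" for w q
          proof -
            have "T w \<noteq> T' y" using w(4) unfolding Lb4_def rect_def by auto
            moreover have "\<not> (\<exists>q. Lb4 (T w) (T' y) = {q})"
            proof
              assume "\<exists>q. Lb4 (T w) (T' y) = {q}"
              then have "Lb4 (T w) (T' y) = {q}" using w(4) by auto
              then show False using Lb4_single TF[OF w(1,2)] T'F AF[OF X(1)] w(3) XT by blast
            qed
            ultimately have "T w \<inter> T' y = {}" using Lb4_cases[OF TF[OF w(1,2)] T'F] by blast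
            then show ?thesis using Pairs4_disjoint[OF T'F TF[OF w(1,2)]] by blast
          qed
          have "l y \<in> Lb (T v) (T' y)" using p y unfolding assignment_def by blast
          then have 1: "T' y = {..<4} - T v" using cmp[OF v uv] phv[OF X(1)] X(2) Lb by simp
          obtain q where "Lb (T w0) X = {q}" "q \<in> Lb (T w0) (T' y)" using phw[OF X(1) w0] X(2) by blast
          then have 2: "T' y = {..<4} - T w0" using cmp[OF w0(1,2)] Lb by simp
          have "T v \<subseteq> {..<4}" "T w0 \<subseteq> {..<4}" using TF[OF v uv] TF[OF w0(1,2)] Pairs4_D by auto
          then show False using 1 2 Tne by blast
        qed
        have NF: "N u \<subseteq> F" using Nsub noadj by blast
        have same: "N x = N u" if x: "x \<in> ?K" for x
        proof (cases "x = u")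
          case False
          then obtain X where X: "X \<in> A" "x = \<phi> X" using surj x by blast
          have "N u \<subseteq> N x" using tw[OF X(1)] X(2) NF by blast
          then show ?thesis using card_seteq[OF fin_N, of "N u" x] deg[of x] c4 \<Delta> by auto
        qed simp
        have AT: "A = Pairs4 - T ` N u" unfolding A_def Fam using NF noadj by blast
        obtain C where C: "C \<in> A" using cA2 by fastforce
        \<comment> \<open>Otherwise the complement of \<open>C\<close> is the set of some neighbour
          \<open>w\<close> of \<open>u\<close>. Then \<open>C\<close> would offer at least three
          labels at \<open>w\<close>, but a blocked set offers only one.\<close>
        have "{..<4} - C \<in> A"
        proof -
          have "{..<4} - C \<noteq> T w" if w: "w \<in> N u" for w
          proof
            assume eq: "{..<4} - C = T w"
            have wF: "w \<in> F" "E u w" using w NF by auto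
            have "\<exists>q. Lb4 (T w) C = {q}" using phv[OF C] phw[OF C wF] Lb by (cases "w = v") auto
            moreover have "T w \<inter> C = {}" unfolding eq[symmetric] by blast
            moreover have "T w \<noteq> C" using C w unfolding AT by blast
            ultimately show False using Lb4_cases[OF TF[OF wF] AF[OF C]] by auto
          qed
          then show ?thesis using Pairs4_compl[OF AF[OF C]] unfolding AT by blast
        qed
        moreover have "C \<noteq> {}" using Pairs4_D[OF AF[OF C]] by auto
        then have "{..<4} - C \<noteq> C" by blast
        ultimately have "{C, {..<4} - C} = A" using C cA2 by (intro card_seteq) (auto intro: card_ge_0_finite)
        then have "T ` N u = Pairs4 - {C, {..<4} - C}" using AT TF NF by blast
        moreover have "N u \<inter> F = N u" using NF by blast
        then have "inj_on T (N u)" using injT by simp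
        moreover have "card ?K = 3" using cK u(1) fK by simp
        moreover have "\<forall>x\<in>?K. N x = N u" by (rule ballI) (rule same)
        ultimately have "block F T v u"
          unfolding block_def using NF c4 u(1) AF[OF C] by (intro conjI bexI[of _ C])
        then show False using nb by blast
      qed
    qed
  qed
qed

section \<open>Dissolving a block\<close>

text \<open>All arc colours stay. The vertex \<open>w\<close> keeps the colour \<open>i\<close> of
  its arc to \<open>p\<close> and trades its other colour for the one outside \<open>T w\<close>
  that differs from the colour \<open>j\<close> of the arc from \<open>p\<close>. For the two
  excluded sets this could turn the label of the edge \<open>wp\<close> into the reserved
  one.\<close>

lemma rooted_state_recolour:
  assumes Lb: "Lb = Lb4" and Fam: "Fam = Pairs4" and k4: "k = 4" and g: "rooted_state F T c"
    and w: "w \<in> F" "w \<noteq> r" "w \<noteq> s" and p: "N w \<inter> F = {p}"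
    and Tw: "T w \<noteq> {1, 2}" "T w \<noteq> {0, 3}"
  shows "\<exists>X. X \<noteq> T w \<and> X \<in> Pairs4 \<and> rooted_state F (T(w := X)) c"
proof -
  have pF: "p \<in> F" "E w p" "E p w" "p \<noteq> w" using p E_sym E_irrefl by blast+
  have TwF: "T w \<in> Pairs4" using rooted_state_T[OF g w(1,2)] Fam by simp
  define i j where "i = c (w, p)" and "j = c (p, w)"
  have ij: "(i, j) \<in> Lb (T w) (T p)"
    unfolding i_def j_def by (rule rooted_state_Lb[OF g w(1) pF(1,2)]) (use w in auto)
  have col: "i \<in> T w" "i \<notin> T p" "j \<in> T p" "j \<notin> T w" using Lb_D[OF ij] by auto
  have jk: "j < 4" using rooted_state_bounded[OF g pF(1)] col(3) k4 by auto
  define X where "X = insert i ({..<4} - T w - {j})"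
  have "card ({..<4} - T w - {j}) = 1"
    using Pairs4_D[OF Pairs4_compl[OF TwF]] jk col(4) by (subst card_Diff_singleton) auto
  then obtain m where m: "{..<4} - T w - {j} = {m}" by (meson card_1_singletonE)
  then have m4: "m < 4" "m \<notin> T w" "m \<noteq> j" by auto
  have "i \<noteq> m" using m4 col(1) by blast
  then have XF: "X \<in> Pairs4" unfolding Pairs4_def X_def m using m4 col(1) Pairs4_D[OF TwF] by auto
  have Xne: "X \<noteq> T w" unfolding X_def m using m4 by auto
  have Xij: "i \<in> X" "j \<notin> X" unfolding X_def using col by auto
  have sp1: "\<not> (X = {0, 1} \<and> T p = {2, 3} \<and> (i, j) = (0, 2))"
  proof
    assume a: "X = {0, 1} \<and> T p = {2, 3} \<and> (i, j) = (0, 2)"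
    have X01: "X = {0, 1}" and i0: "i = 0" and j2: "j = 2" using a by simp_all
    obtain b where b: "T w = {0, b}" "b \<noteq> 0" "b < 4" using Pairs4_obtain[OF TwF col(1)] i0 by blast
    have "b \<noteq> 2" using col(4) j2 b(1) by auto
    moreover have "b \<noteq> 3" using Tw(2) b(1) by metis
    moreover have "b \<noteq> 1" using Xne X01 b(1) by metis
    ultimately show False using b(2,3) by linarith
  qed
  have sp2: "\<not> (X = {2, 3} \<and> T p = {0, 1} \<and> (i, j) = (2, 0))"
  proof
    assume a: "X = {2, 3} \<and> T p = {0, 1} \<and> (i, j) = (2, 0)"
    have X23: "X = {2, 3}" and i2: "i = 2" and j0: "j = 0" using a by simp_all
    obtain b where b: "T w = {2, b}" "b \<noteq> 2" "b < 4" using Pairs4_obtain[OF TwF col(1)] i2 by blast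
    have "b \<noteq> 0" using col(4) j0 b(1) by auto
    moreover have "b \<noteq> 1" using Tw(1) b(1) by (metis insert_commute)
    moreover have "b \<noteq> 3" using Xne X23 b(1) by metis
    ultimately show False using b(2,3) by linarith
  qed
  have LX: "(i, j) \<in> Lb X (T p)"
    using sp1 sp2 Xij col unfolding Lb Lb4_def rect_def by (simp split: if_splits)
  have "rooted_state F (T(w := X)) c"
    unfolding rooted_state_def state_def
  proof (intro conjI ballI impI)
    have rs: "r \<noteq> w" "s \<noteq> w" using w by auto
    show "r \<in> F" "s \<in> F" "F \<subseteq> V" using rooted_state_sub[OF g] by auto
    show "rigid F c" by (rule rooted_state_rigid[OF g])
    show "(T(w := X)) x \<subseteq> {..<k}" if "x \<in> F" for x
      using rooted_state_bounded[OF g that] XF Fam Fam_sub by auto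
    show "(T(w := X)) x \<in> Fam" if "x \<in> F" "x \<noteq> r" for x using rooted_state_T[OF g that] XF Fam by simp
    show "(T(w := X)) r \<in> Fam \<or> N r \<subseteq> F" using g rs unfolding rooted_state_def by simp
    show "\<exists>y\<in>F. E x y" if "x \<in> F" for x using g that unfolding rooted_state_def by blast
    fix x y assume xy: "x \<in> F" "y \<in> F" "E x y"
    have cases: "x = w \<and> y = p \<or> y = w \<and> x = p \<or> x \<noteq> w \<and> y \<noteq> w"
      using p xy E_sym by blast
    have "c (x, y) \<in> (T(w := X)) x \<and> c (x, y) \<notin> (T(w := X)) y"
      using cases rooted_state_col[OF g xy] col Xij pF(4) i_def j_def by auto
    then show "c (x, y) \<in> (T(w := X)) x" "c (x, y) \<notin> (T(w := X)) y" by auto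
    show "(c (x, y), c (y, x)) \<in> Lb ((T(w := X)) x) ((T(w := X)) y)" if rs: "(x, y) \<noteq> (r, s)" "(x, y) \<noteq> (s, r)"
    proof -
      have "(c (x, y), c (y, x)) \<in> Lb (T x) (T y)" by (rule rooted_state_Lb[OF g xy rs])
      then show ?thesis using cases LX Lb_sym[OF LX] pF(4) i_def j_def by auto
    qed
  qed
  then show ?thesis using Xne XF by blast
qed

text \<open>The common neighbours of the three kids carry two complementary pairs of sets.
  Recolouring one of them, \<open>w0\<close>, frees its old set for all three kids at once, which
  are pairwise non-adjacent. The vertex \<open>w1\<close> with the complementary set offers at least
  three labels, one for each kid.\<close>

lemma block_step:
  assumes Lb: "Lb = Lb4" and Fam: "Fam = Pairs4" and k4: "k = 4" and \<Delta>: "\<Delta> = 4"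
    and g: "rooted_state F T c" and rs: "N r \<subseteq> F" "N s \<subseteq> F" and b: "block F T v u"
  shows "\<exists>T2 c2. rooted_state (F \<union> (N v - F)) T2 c2 \<and> T2 r = T r \<and> T2 s = T s \<and>
     (\<forall>x\<in>F. \<forall>y\<in>F. c2 (x, y) = c (x, y))"
proof -
  let ?K = "N v - F" and ?W = "N u"
  note W = block_D(1-4)[OF b] and same' = block_D(5)[OF b] and cK = block_D(6)[OF b]
  note same = bspec[OF same']
  obtain C where C: "C \<in> Pairs4" "T ` ?W = Pairs4 - {C, {..<4} - C}" using block_D(7)[OF b] by (elim bexE)
  have vW: "v \<in> ?W" using W(4) E_sym by auto
  have nrs: "w \<noteq> r" "w \<noteq> s" if "w \<in> ?W" for w using that rs W(4) E_sym by blast+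
  have TF: "T w \<in> Pairs4" if "w \<in> ?W" for w using C(2) that by blast
  have cTW: "card (T ` ?W) = 4" using card_image[OF W(3)] W(2) by simp
  have "\<not> T ` ?W \<subseteq> {{1, 2}, {0, 3}}"
  proof
    assume "T ` ?W \<subseteq> {{1, 2}, {0, 3}}"
    then have "card (T ` ?W) \<le> card {{1, 2}, {0, 3::nat}}" by (rule card_mono[rotated]) simp
    also have "\<dots> \<le> 2" by (simp add: card_insert_if)
    finally show False using cTW by simp
  qed
  then obtain w0 where w0: "w0 \<in> ?W" "T w0 \<noteq> {1, 2}" "T w0 \<noteq> {0, 3}" by blast
  let ?X = "T w0"
  have Xs: "?X \<subseteq> {..<4}" using TF[OF w0(1)] Pairs4_D by blast
  have Cs: "C \<subseteq> {..<4}" using C(1) Pairs4_D by blast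
  have "{..<4} - ?X \<notin> {C, {..<4} - C}"
  proof
    assume "{..<4} - ?X \<in> {C, {..<4} - C}"
    then have "{..<4} - ({..<4} - ?X) \<in> {{..<4} - C, {..<4} - ({..<4} - C)}" by auto
    then have "?X \<in> {C, {..<4} - C}" using double_diff[OF Xs order.refl] double_diff[OF Cs order.refl] by auto
    moreover have "?X \<in> Pairs4 - {C, {..<4} - C}" unfolding C(2)[symmetric] using w0(1) by (rule imageI)
    ultimately show False by blast
  qed
  then have "{..<4} - ?X \<in> T ` ?W" using Pairs4_compl[OF TF[OF w0(1)]] C(2) by blast
  then obtain w1 where w1: "w1 \<in> ?W" "T w1 = {..<4} - ?X" by auto
  have disj: "T w1 \<inter> ?X = {}" unfolding w1(2) by blast
  have Xn0: "?X \<noteq> {}" using Pairs4_D[OF TF[OF w0(1)]] by auto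
  then have w10: "w1 \<noteq> w0" using disj by auto
  have w0F: "w0 \<in> F" using w0(1) W(1) by blast
  obtain p where p: "p \<in> F" "E w0 p" using g w0F unfolding rooted_state_def by blast
  have fK: "finite ?K" using fin_N by blast
  have KW: "?K \<subseteq> N w0" using same w0(1) E_sym by blast
  \<comment> \<open>The three kids and one vertex of \<open>F\<close> exhaust the at most four
    neighbours of \<open>w0\<close>, so \<open>rooted_state_recolour\<close> applies to it.\<close>
  have Np: "N w0 = insert p ?K"
  proof (rule card_seteq[symmetric, OF fin_N])
    show "insert p ?K \<subseteq> N w0" using KW p by auto
    show "card (N w0) \<le> card (insert p ?K)" using deg[of w0] cK p fK \<Delta> by simp
  qed
  then have "N w0 \<inter> F = {p}" using p by auto
  from rooted_state_recolour[OF Lb Fam k4 g w0F nrs[OF w0(1)] this w0(2,3)] obtain Y where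
    Y: "Y \<noteq> ?X" "Y \<in> Pairs4" "rooted_state F (T(w0 := Y)) c" by blast
  let ?T = "T(w0 := Y)"
  have vF: "v \<in> F" using vW W(1) by blast
  have Tne: "?T w \<noteq> ?X" if "w \<in> ?W" for w
    using Y(1) inj_onD[OF W(3), of w w0] that w0(1) by auto
  have TF2: "?T w \<in> Pairs4" if "w \<in> ?W" for w using Y(2) TF[OF that] by simp
  have xW: "w \<in> ?W" if "x \<in> ?K" "E x w" for x w using same[OF that(1)] that(2) by blast
  have t: "proper_sets F ?T ?K (\<lambda>_. ?X)"
    unfolding proper_sets_def
  proof (intro conjI ballI impI)
    fix x assume x: "x \<in> ?K"
    show "?X \<in> Fam" using TF[OF w0(1)] Fam by simp
    show "?X \<noteq> ?T w" if "w \<in> F" "E x w" for w using Tne[OF xW[OF x that(2)]] by metis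
    show "?X \<noteq> ?X" if "y \<in> ?K" "E x y" for y using xW[OF x that(2)] W(1) that(1) by blast
  qed
  have "3 \<le> card (Lb4 (T w1) ?X)" using Lb4_cases[OF TF[OF w1(1)] TF[OF w0(1)]] disj Xn0 by auto
  then obtain h where h: "inj_on h ?K" "h ` ?K \<subseteq> Lb4 (T w1) ?X"
    using card_le_inj[OF fK, of "Lb4 (T w1) ?X"] cK fin_Lb TF[OF w0(1)] TF[OF w1(1)] Fam Lb by auto
  define L where "L x w = (if w = w1 then h x else (SOME q. q \<in> Lb (?T w) ?X))" for x w
  have L: "L x w \<in> Lb (?T w) ?X" if "x \<in> ?K" "w \<in> F" "E x w" for x w
  proof (cases "w = w1")
    case True then show ?thesis using h(2) that(1) w10 Lb unfolding L_def by auto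
  next
    case False
    have "Lb (?T w) ?X \<noteq> {}" using Lb_ne[of "?T w" ?X] TF2[OF xW[OF that(1,3)]] TF[OF w0(1)] Tne[OF xW[OF that(1,3)]] Fam by simp
    then show ?thesis using False unfolding L_def by (auto intro: someI)
  qed
  have dist: "\<exists>w\<in>F. E x w \<and> L x w \<noteq> L y w"
    if "x \<in> ?K" "y \<in> ?K" "x \<noteq> y" "\<And>w. w \<in> F \<Longrightarrow> E x w \<longleftrightarrow> E y w" for x y
  proof (intro bexI conjI)
    show "w1 \<in> F" using w1 W(1) by blast
    show "E x w1" using same[OF that(1)] w1(1) by blast
    show "L x w1 \<noteq> L y w1" using h(1) that unfolding L_def inj_on_def by auto
  qed
  from extend[OF Y(3) vF refl t L dist] obtain T2 c2 where e: "rooted_state (F \<union> ?K) T2 c2" "\<forall>x\<in>F. T2 x = ?T x"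
    "\<forall>x\<in>F. \<forall>y\<in>F. c2 (x, y) = c (x, y)" by blast
  have "T2 r = T r" "T2 s = T s" using e(2) rooted_state_sub[OF g] nrs[OF w0(1)] by auto
  then show ?thesis using e by blast
qed

end

section \<open>The root edge for \<open>\<Delta> = 4\<close>\<close>

lemma Pairs4_mem: "{0, 1} \<in> Pairs4" "{2, 3} \<in> Pairs4" "{0, 2} \<in> Pairs4"
  unfolding Pairs4_def by auto

lemma rect_eqs: "rect {0, 1} {0, 2} = {(1, 2)}" "(3, 0) \<in> rect {2, 3} {0, 1}"
  by (simp_all add: rect_def insert_Diff_if)

text \<open>A common neighbour of \<open>r\<close> and \<open>s\<close> with the set
  \<open>{0, 2}\<close> thus makes colour 3 leave \<open>s\<close>.\<close>

lemma Lb4_02: "p \<in> Lb4 {2, 3} {0, 2} \<Longrightarrow> fst p = 3"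
  by (cases p) (simp add: Lb4_def rect_def)

lemma Lb4_not: "(0, 2) \<notin> Lb4 {0, 1} {2, 3}"
  unfolding Lb4_def by simp

lemma Lb4_01: "Lb4 {0, 1} {0, 2} = {(1, 2)}"
proof -
  have "(2::nat) \<in> {0, 2}" "(2::nat) \<notin> {0, 1}" "(3::nat) \<notin> {0, 2}" by simp_all
  then have "{0, 2::nat} \<noteq> {2, 3}" "{0, 2::nat} \<noteq> {0, 1}" by blast+
  then show ?thesis by (simp only: Lb4_def rect_eqs(1) if_False simp_thms Diff_empty)
qed

context arc_ext
begin

text \<open>To recognise \<open>r\<close> and \<open>s\<close> by their sets, colour 1 must leave
  \<open>r\<close> besides 0, and colour 3 must leave \<open>s\<close> besides 2. A neighbour
  \<open>a\<close> of \<open>r\<close> is prescribed for the former. It also serves the latter if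
  \<open>r\<close> and \<open>s\<close> have a common neighbour, as \<open>a\<close> is then chosen
  to be one; otherwise another neighbour of \<open>s\<close> is prescribed.\<close>

lemma special_arc:
  assumes Lb: "Lb = Lb4" and Fam: "Fam = Pairs4" and k4: "k = 4" and \<Delta>: "\<Delta> = 4"
    and rs: "E r s" and dr: "card (N r) = 4" and ds: "2 \<le> card (N s)"
  shows "chi_D12 V E \<le> k"
proof -
  have ne: "r \<noteq> s" using rs E_irrefl by auto
  define T1 where "T1 x = (if x = r then {0, 1} else {2, 3::nat})" for x
  define c1 where "c1 = (\<lambda>(x, y :: 'a). if x = r then 0 else (2::nat))"
  let ?F0 = "{r, s}"
  have g0: "rooted_state ?F0 T1 c1"
    unfolding rooted_state_def state_def rigid_def
    using E_V[OF rs] Pairs4_mem Fam k4 ne rs E_sym[OF rs] E_irrefl by (auto simp: T1_def c1_def)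
  have T1: "T1 r = {0, 1}" "T1 s = {2, 3}" using ne unfolding T1_def by auto
  obtain a where a: "E r a" "a \<noteq> s" and as: "N r \<inter> N s \<noteq> {} \<longrightarrow> E s a"
  proof (cases "N r \<inter> N s = {}")
    case True
    have "\<not> N r \<subseteq> {s}" using dr card_mono[of "{s}" "N r"] by auto
    then show ?thesis using True that by blast
  next
    case False
    then show ?thesis using that E_irrefl by blast
  qed
  let ?K = "N r - ?F0"
  have aK: "a \<in> ?K" using a E_irrefl by auto
  have "assignment ?F0 T1 r {a} (\<lambda>_. {0, 2}) (\<lambda>_. (1, 2))"
    unfolding assignment_def proper_sets_def
  proof (intro conjI ballI impI)
    show "{0, 2} \<in> Fam" using Pairs4_mem Fam by simp
    have n: "{0, 2::nat} \<noteq> {0, 1}" "{0, 2::nat} \<noteq> {2, 3}" by (simp_all add: doubleton_eq_iff)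
    show "{0, 2} \<noteq> T1 w" if "w \<in> ?F0" for w using that n T1 by (elim insertE) simp_all
    show "{0, 2} \<noteq> {0, 2::nat}" if "x \<in> {a}" "y \<in> {a}" "E x y" for x y using that E_irrefl by simp
    show "(1, 2) \<in> Lb (T1 r) {0, 2}" unfolding Lb T1(1) Lb4_01 by simp
  qed simp
  from kids_degree_4[OF Lb Fam \<Delta> g0 _ _ _ this] have "(\<exists>T2 c2. rooted_state (?F0 \<union> ?K) T2 c2 \<and> (\<forall>x\<in>?F0. T2 x = T1 x) \<and>
      (\<forall>x\<in>?F0. \<forall>y\<in>?F0. c2 (x, y) = c1 (x, y)) \<and> (\<forall>x\<in>{a}. (c2 (r, x), c2 (x, r)) = (1, 2) \<and>
        (\<forall>w\<in>?F0. E x w \<longrightarrow> (c2 (w, x), c2 (x, w)) \<in> Lb (T1 w) {0, 2}))) \<or> (\<exists>u. block ?F0 T1 r u)"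
    using aK T1 Pairs4_mem Fam by simp
  moreover have "\<not> block ?F0 T1 r u" for u
  proof
    assume "block ?F0 T1 r u"
    then have "N u \<subseteq> ?F0" "card (N u) = 4" by (rule block_D)+
    then show False using card_mono[of ?F0 "N u"] ne by simp
  qed
  ultimately obtain T2 c2 where g1: "rooted_state (?F0 \<union> ?K) T2 c2" and e: "\<forall>x\<in>?F0. T2 x = T1 x"
      "\<forall>x\<in>?F0. \<forall>y\<in>?F0. c2 (x, y) = c1 (x, y)" "\<forall>x\<in>{a}. (c2 (r, x), c2 (x, r)) = (1, 2) \<and>
        (\<forall>w\<in>?F0. E x w \<longrightarrow> (c2 (w, x), c2 (x, w)) \<in> Lb (T1 w) {0, 2})" by blast
  have T2: "T2 r = {0, 1}" "T2 s = {2, 3}" using e(1) T1 by simp_all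
  have c2: "c2 (r, s) = 0" "c2 (s, r) = 2" using e(2) ne by (simp_all add: c1_def)
  have c2r: "c2 (r, a) = 1" and c2a: "E a s \<longrightarrow> (c2 (s, a), c2 (a, s)) \<in> Lb4 {2, 3} {0, 2}"
    using e(3) T1(2) Lb by simp_all
  define F1 where "F1 = ?F0 \<union> ?K"
  have F1: "N r \<subseteq> F1" "r \<in> F1" "s \<in> F1" "a \<in> F1" "F1 \<subseteq> {r, s} \<union> N r" using aK unfolding F1_def by auto
  have g1: "rooted_state F1 T2 c2" using g1 unfolding F1_def .
  have Tr: "T2 w \<noteq> {0, 1}" if "w \<in> N r" for w
  proof -
    have "w \<in> F1" "E r w" using that F1 by auto
    then have "c2 (r, w) \<in> T2 r" "c2 (r, w) \<notin> T2 w" using rooted_state_col[OF g1 F1(2)] by blast+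
    then show ?thesis using T2(1) by auto
  qed
  \<comment> \<open>The sets around a block come in complementary pairs, so besides \<open>s\<close>
    with \<open>{2, 3}\<close> the kid \<open>u\<close> has a neighbour with \<open>{0, 1}\<close>.
    In \<open>F1\<close> only \<open>r\<close> has this set, but all neighbours of \<open>r\<close>
    are already coloured.\<close>
  have noblock: "\<not> block F1 T2 s u" for u
  proof
    assume b: "block F1 T2 s u"
    note N = block_D(1,4)[OF b]
    obtain C where C: "C \<in> Pairs4" "T2 ` N u = Pairs4 - {C, {..<4} - C}" using block_D(7)[OF b] by (elim bexE)
    have "s \<in> N u" using N(2) E_sym by auto
    then have "{2, 3} \<in> T2 ` N u" using T2(2) by (metis imageI)
    then have n: "C \<noteq> {2, 3}" "{..<4} - C \<noteq> {2, 3}" unfolding C(2) by auto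
    have c23: "{..<4} - {2, 3} = {0, 1::nat}" "{..<4} - {0, 1::nat} = {2, 3}" by auto
    have Cs: "C \<subseteq> {..<4}" using Pairs4_D[OF C(1)] by simp
    have "{..<4} - C \<noteq> {0, 1}"
    proof
      assume "{..<4} - C = {0, 1}"
      then have "C = {2, 3}" using double_diff[OF Cs order.refl] c23(2) by simp
      then show False using n(1) by simp
    qed
    moreover have "C \<noteq> {0, 1}" using n(2) c23(2) by auto
    ultimately have "{0, 1} \<in> T2 ` N u" unfolding C(2) using Pairs4_mem(1) by auto
    then obtain w where w: "w \<in> N u" "T2 w = {0, 1}" by auto
    have "w \<noteq> r" using w(1) N(2) F1(1) E_sym by blast
    moreover have "{0, 1} \<noteq> {2, 3::nat}" by (simp add: doubleton_eq_iff)
    then have "w \<noteq> s" using w(2) T2(2) by metis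
    moreover have "w \<notin> N r" using Tr w(2) by blast
    ultimately show False using w(1) N(1) F1(5) by blast
  qed
  have "\<exists>T3 c3 a'. rooted_state (F1 \<union> (N s - F1)) T3 c3 \<and> (\<forall>x\<in>F1. T3 x = T2 x) \<and>
      (\<forall>x\<in>F1. \<forall>y\<in>F1. c3 (x, y) = c2 (x, y)) \<and> E s a' \<and> c3 (s, a') = 3"
  proof (cases "N r \<inter> N s = {}")
    case False
    then have sa: "E s a" "E a s" using as E_sym by blast+
    then have sa3: "c2 (s, a) = 3" using c2a Lb4_02 by (metis fst_conv)
    have "T2 s \<in> Fam" using T2(2) Pairs4_mem Fam by simp
    from kids_degree_4[OF Lb Fam \<Delta> g1 F1(3) this empty_subsetI assignment_empty] noblock obtain T3 c3 where
      "rooted_state (F1 \<union> (N s - F1)) T3 c3" "\<forall>x\<in>F1. T3 x = T2 x" and c3: "\<forall>x\<in>F1. \<forall>y\<in>F1. c3 (x, y) = c2 (x, y)"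
      by blast
    moreover have "c3 (s, a) = 3" using c3 F1(3,4) sa3 by simp
    ultimately show ?thesis using sa(1) by blast
  next
    case True
    have "\<not> N s \<subseteq> {r}" using ds card_mono[of "{r}" "N s"] by auto
    then obtain b where b: "E s b" "b \<noteq> r" by blast
    have bF: "b \<notin> F1" using b True F1(5) E_irrefl by blast
    \<comment> \<open>In \<open>F1\<close> only \<open>r\<close> has the set \<open>{0, 1}\<close>,
      and \<open>r\<close> is not adjacent to \<open>b\<close>. Seen from \<open>s\<close>, the
      reserved label is \<open>(2, 0)\<close>, so \<open>(3, 0)\<close> is allowed.\<close>
    have pab: "assignment F1 T2 s {b} (\<lambda>_. {0, 1}) (\<lambda>_. (3, 0))"
      unfolding assignment_def proper_sets_def
    proof (intro conjI ballI impI)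
      fix x assume "x \<in> {b}"
      then have x: "x = b" by simp
      show "{0, 1} \<in> Fam" using Pairs4_mem Fam by simp
      show "{0, 1} \<noteq> T2 w" if wF: "w \<in> F1" "E x w" for w
      proof -
        have "w \<noteq> r" using wF(2) x bF F1(1) E_sym by blast
        then consider "w = s" | "w \<in> N r" using F1(5) wF(1) by blast
        then show ?thesis using Tr T2(2) by cases (auto simp: doubleton_eq_iff)
      qed
      show "{0, 1} \<noteq> {0, 1::nat}" if "y \<in> {b}" "E x y" for y using that x E_irrefl by simp
      show "(3, 0) \<in> Lb (T2 s) {0, 1}" using rect_eqs(2) unfolding Lb T2(2) Lb4_def by auto
    qed simp
    have "T2 s \<in> Fam" "{b} \<subseteq> N s - F1" using T2(2) Pairs4_mem Fam b bF by auto
    from kids_degree_4[OF Lb Fam \<Delta> g1 F1(3) this pab] noblock obtain T3 c3 where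
      "rooted_state (F1 \<union> (N s - F1)) T3 c3" "\<forall>x\<in>F1. T3 x = T2 x" "\<forall>x\<in>F1. \<forall>y\<in>F1. c3 (x, y) = c2 (x, y)"
      "\<forall>x\<in>{b}. (c3 (s, x), c3 (x, s)) = (3, 0) \<and> (\<forall>w\<in>F1. E x w \<longrightarrow> (c3 (w, x), c3 (x, w)) \<in> Lb (T2 w) {0, 1})"
      by blast
    then show ?thesis using b(1) by (intro exI[of _ T3] exI[of _ c3] exI[of _ b]) simp
  qed
  then obtain T3 c3 a' where g2: "rooted_state (F1 \<union> (N s - F1)) T3 c3" and T3: "\<forall>x\<in>F1. T3 x = T2 x"
    and c3: "\<forall>x\<in>F1. \<forall>y\<in>F1. c3 (x, y) = c2 (x, y)" and a': "E s a'" "c3 (s, a') = 3" by blast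
  define F2 where "F2 = F1 \<union> (N s - F1)"
  have F2: "N r \<subseteq> F2" "N s \<subseteq> F2" "r \<in> F2" "s \<in> F2" using F1 unfolding F2_def by auto
  have g2: "rooted_state F2 T3 c3" using g2 unfolding F2_def .
  have "\<exists>T c. rooted_state V T c \<and> T r = T3 r \<and> T s = T3 s \<and> (\<forall>x\<in>F2. \<forall>y\<in>F2. c (x, y) = c3 (x, y))"
  proof (rule iterate[OF _ g2 F2(1,2)])
    fix F T c v assume h: "rooted_state F T c" "N r \<subseteq> F" "N s \<subseteq> F" "v \<in> F" "N v - F \<noteq> {}"
    have "v \<noteq> r" using h by blast
    then have Tv: "T v \<in> Fam" using rooted_state_T[OF h(1,4)] by blast
    have "\<exists>T2 c2. rooted_state (F \<union> (N v - F)) T2 c2 \<and> T2 r = T r \<and> T2 s = T s \<and> (\<forall>x\<in>F. \<forall>y\<in>F. c2 (x, y) = c (x, y))"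
    proof (cases "\<exists>u. block F T v u")
      case True
      then show ?thesis using block_step[OF Lb Fam k4 \<Delta> h(1-3)] by blast
    next
      case False
      then obtain T2 c2 where "rooted_state (F \<union> (N v - F)) T2 c2" "\<forall>x\<in>F. T2 x = T x"
        "\<forall>x\<in>F. \<forall>y\<in>F. c2 (x, y) = c (x, y)"
        using kids_degree_4[OF Lb Fam \<Delta> h(1,4) Tv empty_subsetI assignment_empty] by blast
      then show ?thesis using rooted_state_sub[OF h(1)] by blast
    qed
    moreover have "F \<subset> F \<union> (N v - F)" using h(5) by blast
    ultimately show "\<exists>F' T' c'. rooted_state F' T' c' \<and> F \<subset> F' \<and> T' r = T r \<and> T' s = T s \<and> (\<forall>x\<in>F. \<forall>y\<in>F. c' (x, y) = c (x, y))" by blast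
  qed
  then obtain T c where g: "rooted_state V T c" and T: "T r = {0, 1}" "T s = {2, 3}"
    and c: "\<forall>x\<in>F2. \<forall>y\<in>F2. c (x, y) = c3 (x, y)" using T3 T2 F1 by auto
  have cv: "c (r, s) = 0" "c (s, r) = 2" "c (r, a) = 1" "c (s, a') = 3"
    using c c3 c2 c2r F1 F2 a a' by auto
  show ?thesis
  proof (rule finish[OF g])
    fix f assume f: "graph_automorphism V E f" and cf: "\<And>x y. E x y \<Longrightarrow> c (f x, f y) = c (x, y)"
    have fV: "f x \<in> V" if "x \<in> V" for x using f that unfolding graph_automorphism_def bij_betw_def by blast
    have fE: "E (f x) (f y)" if "E x y" for x y
      using f E_V[OF that] that unfolding graph_automorphism_def by blast
    have mem: "c (x, y) \<in> T (f x)" if "E x y" for x y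
      using rooted_state_col[OF g fV fV fE[OF that]] E_V[OF that] cf[OF that] by simp
    have TF: "T x \<in> Pairs4" if "x \<in> V" for x
      using rooted_state_T[OF g that] T(1) Pairs4_mem(1) Fam by (cases "x = r") auto
    have "{0, 1} \<subseteq> T (f r)" using mem[OF rs] mem[OF a(1)] cv by auto
    then have "T (f r) = {0, 1}"
      using card_seteq[of "T (f r)" "{0, 1}"] Pairs4_D[OF TF[OF fV]] E_V[OF rs] by auto
    moreover have "{2, 3} \<subseteq> T (f s)" using mem[OF E_sym[OF rs]] mem[OF a'(1)] cv by auto
    then have "T (f s) = {2, 3}"
      using card_seteq[of "T (f s)" "{2, 3}"] Pairs4_D[OF TF[OF fV]] E_V[OF rs] by auto
    ultimately have Tf: "T (f r) = {0, 1}" "T (f s) = {2, 3}" by auto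
    have l: "(c (f r, f s), c (f s, f r)) = (0, 2)" using cf[OF rs] cf[OF E_sym[OF rs]] cv by simp
    have "{0, 1} \<noteq> {2, 3::nat}" by (simp add: doubleton_eq_iff)
    then have nsr: "(f r, f s) \<noteq> (s, r)" using Tf(1) T(2) by (metis prod.inject)
    \<comment> \<open>Any other edge between vertices with these sets has its label in
      \<open>Lb4\<close>, which lacks \<open>(0, 2)\<close>.\<close>
    have "(f r, f s) = (r, s)"
    proof (rule ccontr)
      assume "(f r, f s) \<noteq> (r, s)"
      from rooted_state_Lb[OF g fV fV fE[OF rs] this nsr] E_V[OF rs]
      have "(c (f r, f s), c (f s, f r)) \<in> Lb (T (f r)) (T (f s))" by blast
      then show False unfolding l Tf Lb using Lb4_not by blast
    qed
    then show "f r = r \<and> f s = s" by simp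
  qed
qed

end

section \<open>The bound\<close>

context arc_ext
begin

text \<open>As \<open>v\<close> has at most \<open>\<Delta> - 1\<close> kids, at most
  \<open>\<Delta> - 2\<close> labels are in use before the last one. By \<open>choices_reach\<close>
  this suffices for the greedy colouring unless \<open>\<Delta>\<close> is 6 or 9.\<close>

lemma rect_step:
  assumes Lb: "Lb = rect" and Fam: "Fam = {X. X \<subseteq> {..<k} \<and> card X = a \<and> X \<noteq> R}" and R: "card R = b"
    and \<Delta>: "4 * \<Delta> \<le> k\<^sup>2" "(k - 1)\<^sup>2 < 4 * \<Delta>" "\<Delta> \<noteq> 4" "2 \<le> \<Delta>"
    and a: "a = k div 2" "b = k - a"
    and g: "rooted_state F T c" and v: "v \<in> F" "v \<noteq> r" "N v - F \<noteq> {}"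
  shows "extends F T c v"
proof -
  have k5: "k = 5" if "\<Delta> = 6"
  proof (rule antisym)
    show "k \<le> 5"
    proof (rule ccontr)
      assume "\<not> k \<le> 5"
      then have "5\<^sup>2 \<le> (k - 1)\<^sup>2" by (intro power_mono) auto
      then show False using \<Delta>(2) that by simp
    qed
    show "5 \<le> k"
    proof (rule ccontr)
      assume "\<not> 5 \<le> k"
      then have "k\<^sup>2 \<le> 4\<^sup>2" by (intro power_mono) auto
      then show False using \<Delta>(1) that by simp
    qed
  qed
  have k6: "k = 6" if "\<Delta> = 9"
  proof (rule antisym)
    show "k \<le> 6"
    proof (rule ccontr)
      assume "\<not> k \<le> 6"
      then have "6\<^sup>2 \<le> (k - 1)\<^sup>2" by (intro power_mono) auto
      then show False using \<Delta>(2) that by simp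
    qed
    show "6 \<le> k"
    proof (rule ccontr)
      assume "\<not> 6 \<le> k"
      then have "k\<^sup>2 \<le> 5\<^sup>2" by (intro power_mono) auto
      then show False using \<Delta>(1) that by simp
    qed
  qed
  have fK: "finite (N v - F)" using fin_N by blast
  consider "\<Delta> = 6" | "\<Delta> = 9" | "\<Delta> \<noteq> 6" "\<Delta> \<noteq> 9" by blast
  then show ?thesis
  proof cases
    case 1
    have k: "k = 5" by (rule k5[OF 1])
    then have "a = 2" "b = 3" using a by simp_all
    then show ?thesis using step_degree_6[OF Lb _ _ k 1 g v] Fam R by simp
  next
    case 2
    have k: "k = 6" by (rule k6[OF 2])
    then have "a = 3" "b = 3" using a by simp_all
    then show ?thesis using step_degree_9[OF Lb _ _ k 2 g v] Fam R by simp
  next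
    case 3
    have "card (N v - F) < \<Delta>" by (rule card_kids[OF g v(1)])
    moreover have "card (N v - F) \<noteq> 0" using v(3) fK by simp
    ultimately have "card (N v - F) - 1 + (if \<Delta> = 6 \<or> \<Delta> = 9 then 3 else 2) \<le> \<Delta>" using 3 by simp
    then have "choices (T v) (card (N v - F) - 1) \<Delta>"
      by (rule choices_reach[OF Lb Fam R \<Delta> a rooted_state_T[OF g v(1,2)]])
    then show ?thesis by (rule greedy_extends[OF g v(1)])
  qed
qed

end

lemma connected_closed:
  assumes "simple_graph V E" "connected_graph V E" "r \<in> S" "r \<in> V" "\<And>x y. x \<in> S \<Longrightarrow> E x y \<Longrightarrow> y \<in> S"
  shows "V \<subseteq> S"
proof
  fix y assume "y \<in> V"
  then have "E\<^sup>*\<^sup>* r y" using assms(2,4) unfolding connected_graph_def by blast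
  then show "y \<in> S" by induction (use assms in auto)
qed

lemma arc_ext_rect:
  assumes G: "simple_graph V E" "connected_graph V E" and deg: "\<And>v. card {u. E v u} \<le> \<Delta>"
  shows "arc_ext V E \<Delta> k {X. X \<subseteq> {..<k} \<and> card X = a \<and> X \<noteq> R} rect"
proof
  fix S T assume a: "S \<in> {X. X \<subseteq> {..<k} \<and> card X = a \<and> X \<noteq> R}" "T \<in> {X. X \<subseteq> {..<k} \<and> card X = a \<and> X \<noteq> R}" "S \<noteq> T"
  then have "finite S" "finite T" using finite_subset[of _ "{..<k}"] by auto
  then show "rect S T \<noteq> {}" using rect_nonempty[of S T] a by auto
qed (use assms in \<open>auto simp: rect_def\<close>)

text \<open>By \<open>leaf\<close>, for \<open>\<Delta> = 1\<close> and \<open>\<Delta> = 4\<close>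
  the root and its neighbours exhaust the graph, and the colouring ends with the labels at the root.
  In all other cases \<open>rect_step\<close> continues it.\<close>

lemma generic_bound:
  fixes E :: "'a \<Rightarrow> 'a \<Rightarrow> bool"
  assumes G: "simple_graph V E" "connected_graph V E"
    and deg: "\<And>v. card {u. E v u} \<le> \<Delta>" and r: "card {u. E r u} = \<Delta>"
    and k: "4 * \<Delta> \<le> k\<^sup>2" "(k - 1)\<^sup>2 < 4 * \<Delta>"
    and leaf: "\<Delta> = 4 \<or> \<Delta> = 1 \<Longrightarrow> V \<subseteq> insert r {u. E r u}"
  shows "chi_D12 V E \<le> k"
proof -
  have d1: "1 \<le> \<Delta>" using k(2) by (cases \<Delta>) auto
  have k2: "2 \<le> k"
  proof (rule ccontr)
    assume "\<not> 2 \<le> k"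
    then have "k\<^sup>2 \<le> 1\<^sup>2" by (intro power_mono) auto
    then show False using k(1) d1 by simp
  qed
  define a where "a = k div 2"
  define b where "b = k - a"
  have ab: "k = a + b" "1 \<le> a" "b = a \<or> b = a + 1" using k2 unfolding a_def b_def by auto
  have dab: "\<Delta> \<le> a * b" "b \<le> \<Delta>"
  proof -
    show "\<Delta> \<le> a * b" using ab(3)
    proof
      assume "b = a" then show ?thesis using k(1) ab(1) by (simp add: power2_eq_square algebra_simps)
    next
      assume "b = a + 1"
      then have "4 * \<Delta> \<le> 4 * (a * (a + 1)) + 1" using k(1) ab(1) by (simp add: power2_eq_square algebra_simps)
      then show ?thesis using \<open>b = a + 1\<close> by simp
    qed
    show "b \<le> \<Delta>" using ab(3)
    proof
      assume b: "b = a"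
      obtain n where n: "a = Suc n" using ab(2) by (cases a) auto
      have "4 * (n * n) + 4 * n + 1 < 4 * \<Delta>" using k(2) unfolding ab(1) b n by (simp add: power2_eq_square algebra_simps)
      then have "n * n + n < \<Delta>" by linarith
      then show ?thesis using b n by linarith
    next
      assume b: "b = a + 1"
      have "4 * (a * a) < 4 * \<Delta>" using k(2) unfolding ab(1) b by (simp add: power2_eq_square algebra_simps)
      then have "a * a < \<Delta>" by simp
      moreover have "a \<le> a * a" using ab(2) by (cases a) auto
      ultimately show ?thesis using b by linarith
    qed
  qed
  let ?Nr = "{u. E r u}"
  have fV: "finite V" "\<And>u v. E u v \<Longrightarrow> u \<in> V \<and> v \<in> V" "\<And>u v. E u v \<Longrightarrow> E v u" "\<And>u. \<not> E u u"
    using G(1) unfolding simple_graph_def by blast+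
  have fN: "finite ?Nr" by (rule finite_subset[OF _ fV(1)]) (use fV(2) in blast)
  have "card ?Nr \<noteq> 0" using r d1 by linarith
  then have Nne: "?Nr \<noteq> {}" by (metis card.empty)
  then have rV: "r \<in> V" using fV(2) by blast
  \<comment> \<open>The root set and the labels at the root are left open here, because
    \<open>k = 3\<close> needs choices that \<open>root_labels\<close> does not supply.\<close>
  have fin: "chi_D12 V E \<le> k"
    if R: "R \<subseteq> {..<k}" "a \<le> card R"
      and l: "inj_on l ?Nr" "l ` ?Nr \<subseteq> R \<times> ({..<k} - R)" "R \<subseteq> fst ` l ` ?Nr"
      and T0: "\<And>x. x \<in> ?Nr \<Longrightarrow> T0 x \<subseteq> {..<k} \<and> card (T0 x) = a \<and> T0 x \<noteq> R \<and> fst (l x) \<notin> T0 x \<and> snd (l x) \<in> T0 x"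
      and adj: "\<And>x y. x \<in> ?Nr \<Longrightarrow> y \<in> ?Nr \<Longrightarrow> E x y \<Longrightarrow> T0 x \<noteq> T0 y"
      and st: "V \<subseteq> insert r ?Nr \<or> \<Delta> \<noteq> 4 \<and> 2 \<le> \<Delta> \<and> card R = b"
    for R T0 and l :: "'a \<Rightarrow> nat \<times> nat"
  proof -
    let ?Fam = "{X. X \<subseteq> {..<k} \<and> card X = a \<and> X \<noteq> R}"
    interpret arc_ext V E \<Delta> k ?Fam rect r r by (rule arc_ext_rect[OF G deg])
    show ?thesis
    proof (rule generic_finish[OF refl refl refl R Nne l])
      show "T0 x \<in> ?Fam \<and> fst (l x) \<notin> T0 x \<and> snd (l x) \<in> T0 x" if "x \<in> ?Nr" for x using T0[OF that] by simp
      show "T0 x \<noteq> T0 y" if "x \<in> ?Nr" "y \<in> ?Nr" "E x y" for x y using adj that by blast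
      fix F T c v assume h: "rooted_state F T c" "?Nr \<subseteq> F" "v \<in> F" "v \<noteq> r" "{u. E v u} - F \<noteq> {}"
      have "\<not> V \<subseteq> insert r ?Nr"
      proof
        assume "V \<subseteq> insert r ?Nr"
        then have "V \<subseteq> F" using h(2) rooted_state_sub[OF h(1)] by blast
        then show False using h(5) fV(2) by blast
      qed
      then have "\<Delta> \<noteq> 4" "2 \<le> \<Delta>" "card R = b" using st by auto
      then show "extends F T c v" using rect_step[OF refl refl _ k _ _ a_def b_def h(1,3-5)] by blast
    qed
  qed
  show ?thesis
  proof (cases "k = 3")
    case False
    then have "b = a \<or> b = a + 1 \<and> 3 \<le> b" using ab by auto
    from root_labels[OF fN r ab(1,2) dab(2,1) this] obtain l :: "'a \<Rightarrow> nat \<times> nat" and T0 where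
      *: "inj_on l ?Nr" "l ` ?Nr \<subseteq> {..<b} \<times> ({..<k} - {..<b})" "{..<b} \<subseteq> fst ` l ` ?Nr" "inj_on T0 ?Nr"
      "\<And>x. x \<in> ?Nr \<Longrightarrow> T0 x \<subseteq> {..<k} \<and> card (T0 x) = a \<and> T0 x \<noteq> {..<b} \<and> fst (l x) \<notin> T0 x \<and> snd (l x) \<in> T0 x"
      by blast
    show ?thesis
    proof (rule fin[OF _ _ *(1-3,5)])
      show "{..<b} \<subseteq> {..<k}" "a \<le> card {..<b}" using ab by auto
      show "T0 x \<noteq> T0 y" if "x \<in> ?Nr" "y \<in> ?Nr" "E x y" for x y
        using inj_onD[OF *(4) _ that(1,2)] that(3) fV(4) by blast
      have "V \<subseteq> insert r ?Nr" if "\<Delta> = 4 \<or> \<not> 2 \<le> \<Delta>"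
        using leaf that d1 by (cases "\<Delta> = 4") auto
      then show "V \<subseteq> insert r ?Nr \<or> \<Delta> \<noteq> 4 \<and> 2 \<le> \<Delta> \<and> card {..<b} = b" by auto
    qed
  next
    case True
    then have D: "\<Delta> = 2" using k by simp
    have a1: "a = 1" "b = 2" using True unfolding a_def b_def by simp_all
    obtain x y where xy: "?Nr = {x, y}" "x \<noteq> y" using r D by (metis card_2_iff)
    show ?thesis
    proof (cases "E x y")
      \<comment> \<open>Both neighbours share the set \<open>{2}\<close> and are told apart by the
        colours 0 and 1 on the arcs from the root.\<close>
      case False
      define l :: "'a \<Rightarrow> nat \<times> nat" where "l z = (if z = x then (0, 2) else (1, 2))" for z
      have nE: "\<not> E z w" if "z \<in> ?Nr" "w \<in> ?Nr" for z w
        using that False fV(3,4) unfolding xy(1) by blast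
      show ?thesis
      proof (rule fin[of "{0, 1}" l "\<lambda>_. {2}"])
        show "inj_on l ?Nr" unfolding xy(1) l_def using xy(2) by (simp add: inj_on_def)
        show "l ` ?Nr \<subseteq> {0, 1} \<times> ({..<k} - {0, 1})" "{0, 1} \<subseteq> fst ` l ` ?Nr"
          unfolding xy(1) l_def using xy(2) True by auto
        show "{2} \<noteq> {2::nat}" if "z \<in> ?Nr" "w \<in> ?Nr" "E z w" for z w using nE that by blast
        show "{2} \<subseteq> {..<k} \<and> card {2::nat} = a \<and> {2} \<noteq> {0, 1::nat} \<and> fst (l z) \<notin> {2} \<and> snd (l z) \<in> {2}" for z
          unfolding l_def using True a1 by auto
        show "V \<subseteq> insert r ?Nr \<or> \<Delta> \<noteq> 4 \<and> 2 \<le> \<Delta> \<and> card {0, 1::nat} = b" using D a1 by simp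
      qed (use True a1 in auto)
    next
      case tri: True
      txt \<open>A triangle needs three different singletons, so here the root set has size \<open>a\<close> instead of \<open>b\<close>.\<close>
      have Nx: "{u. E z u} = {r, w}" if "E r z" "E r w" "E z w" for z w
      proof (rule card_seteq[symmetric])
        show "finite {u. E z u}" by (rule finite_subset[OF _ fV(1)]) (use fV(2) in blast)
        show "{r, w} \<subseteq> {u. E z u}" using that fV(3) by blast
        have "r \<noteq> w" using that fV(4) by blast
        then show "card {u. E z u} \<le> card {r, w}" using deg[of z] D by simp
      qed
      have rx: "E r x" "E r y" using xy(1) by blast+
      have V: "V \<subseteq> insert r ?Nr"
      proof (rule connected_closed[OF G _ rV])
        fix z w assume zw: "z \<in> insert r ?Nr" "E z w"
        have "E x w \<Longrightarrow> w \<in> {r, y}" using Nx[OF rx tri] by blast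
        moreover have "E y w \<Longrightarrow> w \<in> {r, x}" using Nx[OF rx(2,1) fV(3)[OF tri]] by blast
        moreover have "E r w \<Longrightarrow> w \<in> {x, y}" using xy(1) by blast
        moreover have "z = r \<or> z = x \<or> z = y" using zw(1) unfolding xy(1) by simp
        ultimately have "w = r \<or> w = x \<or> w = y" using zw(2) by (elim disjE) blast+
        then show "w \<in> insert r ?Nr" unfolding xy(1) by simp
      qed simp
      define l :: "'a \<Rightarrow> nat \<times> nat" where "l z = (if z = x then (0, 1) else (0, 2))" for z
      define T0 where "T0 z = (if z = x then {1} else {2::nat})" for z
      show ?thesis
      proof (rule fin[of "{0}" l T0])
        show "inj_on l ?Nr" unfolding xy(1) l_def using xy(2) by (simp add: inj_on_def)
        show "l ` ?Nr \<subseteq> {0} \<times> ({..<k} - {0})" "{0} \<subseteq> fst ` l ` ?Nr"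
          unfolding xy(1) l_def using xy(2) True by auto
        show "T0 z \<noteq> T0 w" if "z \<in> ?Nr" "w \<in> ?Nr" "E z w" for z w
        proof -
          have "z \<noteq> w" using that(3) fV(4) by blast
          then show ?thesis using that(1,2) xy(2) unfolding xy(1) T0_def by auto
        qed
        show "T0 z \<subseteq> {..<k} \<and> card (T0 z) = a \<and> T0 z \<noteq> {0} \<and> fst (l z) \<notin> T0 z \<and> snd (l z) \<in> T0 z" for z
          unfolding l_def T0_def using True a1 by auto
      qed (use True a1 V in auto)
    qed
  qed
qed

theorem theorem2p3:
  fixes V :: "'a set" and E :: "'a \<Rightarrow> 'a \<Rightarrow> bool"
  assumes "simple_graph V E" and "connected_graph V E"
  shows "chi_D12 V E \<le> nat \<lceil>2 * sqrt (real (max_degree V E))\<rceil>"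
proof -
  let ?D = "max_degree V E"
  define k where "k = nat \<lceil>2 * sqrt (real ?D)\<rceil>"
  have fV: "finite V" "V \<noteq> {}" "\<And>u v. E u v \<Longrightarrow> u \<in> V \<and> v \<in> V" "\<And>u v. E u v \<Longrightarrow> E v u" "\<And>u. \<not> E u u"
    using assms(1) unfolding simple_graph_def by blast+
  have fN: "finite {u. E v u}" for v by (rule finite_subset[OF _ fV(1)]) (use fV(3) in blast)
  have dg: "degree V E v = card {u. E v u}" for v
  proof -
    have "{u \<in> V. E v u} = {u. E v u}" using fV(3) by blast
    then show ?thesis unfolding degree_def by simp
  qed
  have deg: "card {u. E v u} \<le> ?D" for v
  proof (cases "v \<in> V")
    case True then show ?thesis using fV(1) dg unfolding max_degree_def by (metis Max_ge finite_imageI imageI)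
  next
    case False
    then have "{u. E v u} = {}" using fV(3) by blast
    then show ?thesis by simp
  qed
  have "?D \<in> degree V E ` V" unfolding max_degree_def using fV(1,2) by (intro Max_in) auto
  then obtain r where r: "r \<in> V" "card {u. E r u} = ?D" using dg by auto
  have "chi_D12 V E \<le> k"
  proof (cases "?D = 0")
    \<comment> \<open>The graph is a single vertex, and 0 colours suffice.\<close>
    case True
    have nE: "\<not> E u v" for u v
    proof -
      have "card {w. E u w} = 0" using deg[of u] True by simp
      then show ?thesis using fN[of u] by auto
    qed
    have V: "V \<subseteq> {r}" by (rule connected_closed[OF assms _ r(1)]) (use nE in auto)
    have "proper_type1_arc_colouring E 0 (\<lambda>_. 0)"
      unfolding proper_type1_arc_colouring_def arcs_def using nE by simp
    moreover have "distinguishing_arc_colouring V E (\<lambda>_. 0)"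
      unfolding distinguishing_arc_colouring_def
    proof (intro allI impI ballI)
      fix f x assume f: "graph_automorphism V E f \<and> (\<forall>(u, v)\<in>arcs E. 0 = 0)" and x: "x \<in> V"
      then have "f x \<in> V" unfolding graph_automorphism_def bij_betw_def by blast
      then show "f x = x" using V x by blast
    qed
    ultimately have "chi_D12 V E \<le> 0" unfolding chi_D12_def by (intro Least_le) blast
    then show ?thesis by simp
  next
    case False
    have rk: "2 * sqrt (real ?D) \<le> real k" "real k - 1 < 2 * sqrt (real ?D)"
    proof -
      have "0 \<le> 2 * sqrt (real ?D)" by simp
      then have "0 \<le> \<lceil>2 * sqrt (real ?D)\<rceil>" by linarith
      then have "real k = real_of_int \<lceil>2 * sqrt (real ?D)\<rceil>" unfolding k_def by (rule of_nat_nat)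
      then show "2 * sqrt (real ?D) \<le> real k" "real k - 1 < 2 * sqrt (real ?D)" by linarith+
    qed
    have sq: "(2 * sqrt (real ?D))\<^sup>2 = 4 * real ?D" by (simp add: power_mult_distrib)
    have "4 * real ?D \<le> (real k)\<^sup>2" using power_mono[OF rk(1), of 2] sq by simp
    then have k1: "4 * ?D \<le> k\<^sup>2" by (metis of_nat_le_iff of_nat_mult of_nat_numeral of_nat_power)
    have "1 \<le> k" using k1 False by (cases k) auto
    then have "(real (k - 1))\<^sup>2 < (2 * sqrt (real ?D))\<^sup>2" using rk(2) by (intro power_strict_mono) auto
    then have "real ((k - 1)\<^sup>2) < real (4 * ?D)" using sq by simp
    then have k2: "(k - 1)\<^sup>2 < 4 * ?D" by (simp only: of_nat_less_iff)
    show ?thesis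
    proof (cases "(?D = 4 \<or> ?D = 1) \<and> \<not> V \<subseteq> insert r {u. E r u}")
      case False
      then show ?thesis using generic_bound[OF assms deg r(2) k1 k2] by blast
    next
      case True
      \<comment> \<open>If all neighbours of \<open>r\<close> were leaves, \<open>r\<close> and its
        neighbours would exhaust the graph. The degree of \<open>s\<close> rules out
        \<open>\<Delta> = 1\<close>, and \<open>s\<close> becomes the second root vertex.\<close>
      have "\<exists>s. E r s \<and> 2 \<le> card {u. E s u}"
      proof (rule ccontr)
        assume no: "\<not> ?thesis"
        have "V \<subseteq> insert r {u. E r u}"
        proof (rule connected_closed[OF assms _ r(1)])
          fix x y assume xy: "x \<in> insert r {u. E r u}" "E x y"
          show "y \<in> insert r {u. E r u}"
          proof (cases "x = r")
            case False
            then have "E r x" using xy(1) by blast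
            then have "card {u. E x u} \<le> 1" "E x r" using no fV(4) by (fastforce, blast)
            then have "y = r" using card_le_Suc0_iff_eq[OF fN[of x]] xy(2) by auto
            then show ?thesis by simp
          qed (use xy in blast)
        qed simp
        then show False using True by blast
      qed
      then obtain s where s: "E r s" "2 \<le> card {u. E s u}" by blast
      have D4: "?D = 4" using True deg[of s] s(2) by auto
      have k4: "k = 4"
      proof (rule antisym)
        show "k \<le> 4"
        proof (rule ccontr)
          assume "\<not> k \<le> 4"
          then have "4\<^sup>2 \<le> (k - 1)\<^sup>2" by (intro power_mono) auto
          then show False using k2 D4 by simp
        qed
        show "4 \<le> k"
        proof (rule ccontr)
          assume "\<not> 4 \<le> k"
          then have "k\<^sup>2 \<le> 3\<^sup>2" by (intro power_mono) auto
          then show False using k1 D4 by simp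
        qed
      qed
      interpret arc_ext V E ?D k Pairs4 Lb4 r s
      proof
        show "Pairs4 \<subseteq> Pow {..<k}" unfolding Pairs4_def k4 by blast
        show "Lb4 S T \<subseteq> rect S T" for S T unfolding Lb4_def by blast
        show "Lb4 S T \<noteq> {}" if "S \<in> Pairs4" "T \<in> Pairs4" "S \<noteq> T" for S T
          using Lb4_cases[OF that] by auto
        show "(q, p) \<in> Lb4 T S" if "(p, q) \<in> Lb4 S T" for S T p q
          using that unfolding Lb4_def rect_def by (auto split: if_splits)
      qed (use assms deg in auto)
      show ?thesis by (rule special_arc[OF refl refl k4 D4 s(1) _ s(2)]) (use r D4 in simp)
    qed
  qed
  then show ?thesis unfolding k_def .
qed

end
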